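(* Let $\mathbf{C}$ be a pre-Hilbert $*$-category, let $\mathbf{C}_{\le 1}$ be its wide subcategory of contractions, and let $\mathbf{C}_1$ be its wide subcategory of isometries. The following statements are equivalent: (i) $\mathbf{C}$ is a Hilbert $*$-category; (ii) $\mathbf{C}_{\le 1}$ has directed colimits; (iii) $\mathbf{C}_1$ has directed colimits.
   Context: A $*$-category is a category equipped with a choice of morphism $f^*\colon Y\to X$ for each morphism $f\colon X\to Y$ such that $1^*=1$, $(gf)^*=f^*g^*$ and $(f^* )^*=f$. A morphism $f$ is isometric (an isometry) if $f^*f=1$, and coisometric (a coisometry) if $ff^*=1$. In a $*$-category with a zero object, a binary product $(r_1\colon X\to X_1,\ r_2\colon X\to X_2)$ is orthonormal if $r_1,r_2$ are coisometries and $r_1r_2^*=0$. A pre-Hilbert $*$-category is a $*$-category with a zero object, in which every pair of objects has an orthonormal product (written $X_1\oplus X_2$), every morphism has a kernel that is an isometry, and, for each object $X$, the diagonal $X\to X\oplus X$ (with both components $1$) is a kernel of some morphism. It is known that every pre-Hilbert $*$-category is canonically enriched in rational vector spaces, with $(f+g)^*=f^*+g^*$, orthonormal products being biproducts. For each object $A$, the Hermitian elements ($a^*=a$) of $\mathbf{C}(A,A)$ are partially ordered by: $f\le g$ iff $g-f=h^*h$ for some morphism $h\colon A\to X$. A morphism $f$ is a contraction if $f^*f\le 1$; contractions are closed under composition and involution and include all isometries and coisometries. A directed set is a non-empty preordered set in which every pair of elements has an upper bound. A directed diagram $(f_{j\le k}\colon X_j\to X_k)_{j,k\in J}$ is a functor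 from a directed set $J$ (viewed as a category with an arrow $j\to k$ when $j\le k$); directed colimits are colimits of such diagrams. Dually, a codirected diagram $(f_{j\le k}\colon X_k\to X_j)_{j,k\in J}$ consists of objects $X_j$ indexed by a directed set $J$ and morphisms $f_{j\le k}\colon X_k\to X_j$ for $j\le k$ with $f_{j\le j}=1$ and $f_{j\le k}f_{k\le l}=f_{j\le l}$. A cone on it is a family $(g_j\colon Y\to X_j)_{j\in J}$ with $f_{j\le k}g_k=g_j$ for all $j\le k$. Given a codirected diagram of contractions in $\mathbf{C}$, an $\ell^2$-cone is a cone $(g_j\colon Y\to X_j)_{j\in J}$ such that the increasing net $(g_j^*g_j)_{j\in J}$ in $\mathbf{C}(Y,Y)$ is bounded above. An $\ell^2$-limit is an $\ell^2$-cone $(f_j\colon X\to X_j)_{j\in J}$ such that for all $\ell^2$-cones $(g_j\colon Y\to X_j)_{j\in J}$ there is a unique morphism $g\colon Y\to X$ with $f_jg=g_j$ for all $j$, and this $g$ satisfies $g^*g=\sup_{j\in J}g_j^*g_j$ (in particular this least upper bound exists). A Hilbert $*$-category is a pre-Hilbert $*$-category that has $\ell^2$-limits of all codirected diagrams of contractions. *)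

theory Defs
  imports Main
begin

section \<open>Categories\<close>

text \<open>Only the values of the fields on objects and arrows, and of composition on composable
  pairs, are meaningful.\<close>

record ('o, 'm) cat =
  Obj :: "'o set"
  Arr :: "'m set"
  Dom :: "'m \<Rightarrow> 'o"
  Cod :: "'m \<Rightarrow> 'o"
  Ide :: "'o \<Rightarrow> 'm"  ("\<one>\<index>")
  Comp :: "'m \<Rightarrow> 'm \<Rightarrow> 'm"  (infixl "\<cdot>\<index>" 70)

definition Hom :: "('o, 'm, 'z) cat_scheme \<Rightarrow> 'o \<Rightarrow> 'o \<Rightarrow> 'm set" where
  "Hom C X Y = {f \<in> Arr C. Dom C f = X \<and> Cod C f = Y}"

locale category =
  fixes C :: "('o, 'm, 'z) cat_scheme" (structure)
  assumes dom_in_Obj: "f \<in> Arr C \<Longrightarrow> Dom C f \<in> Obj C"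
    and cod_in_Obj: "f \<in> Arr C \<Longrightarrow> Cod C f \<in> Obj C"
    and ide_in_Hom: "X \<in> Obj C \<Longrightarrow> \<one> X \<in> Hom C X X"
    and comp_in_Hom: "f \<in> Hom C X Y \<Longrightarrow> g \<in> Hom C Y Z \<Longrightarrow> g \<cdot> f \<in> Hom C X Z"
    and comp_assoc:
      "f \<in> Hom C W X \<Longrightarrow> g \<in> Hom C X Y \<Longrightarrow> h \<in> Hom C Y Z \<Longrightarrow> (h \<cdot> g) \<cdot> f = h \<cdot> (g \<cdot> f)"
    and comp_ide_right: "f \<in> Hom C X Y \<Longrightarrow> f \<cdot> \<one> X = f"
    and comp_ide_left: "f \<in> Hom C X Y \<Longrightarrow> \<one> Y \<cdot> f = f"

definition is_zero_object :: "('o, 'm, 'z) cat_scheme \<Rightarrow> 'o \<Rightarrow> bool" where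
  "is_zero_object C Z \<longleftrightarrow> Z \<in> Obj C \<and>
    (\<forall>X\<in>Obj C. (\<exists>!f. f \<in> Hom C X Z) \<and> (\<exists>!f. f \<in> Hom C Z X))"

text \<open>The following is meaningful when a zero object exists; it does not depend on which one is
  used.\<close>

definition zero_arr :: "('o, 'm, 'z) cat_scheme \<Rightarrow> 'o \<Rightarrow> 'o \<Rightarrow> 'm" where
  "zero_arr C X Y = (THE f. \<exists>Z s t. is_zero_object C Z \<and> s \<in> Hom C X Z \<and> t \<in> Hom C Z Y \<and>
    f = t \<cdot>\<^bsub>C\<^esub> s)"

definition is_kernel :: "('o, 'm, 'z) cat_scheme \<Rightarrow> 'm \<Rightarrow> 'm \<Rightarrow> bool" where
  "is_kernel C k f \<longleftrightarrow> k \<in> Arr C \<and> f \<in> Arr C \<and> Cod C k = Dom C f \<and>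
    f \<cdot>\<^bsub>C\<^esub> k = zero_arr C (Dom C k) (Cod C f) \<and>
    (\<forall>W\<in>Obj C. \<forall>g\<in>Hom C W (Dom C f). f \<cdot>\<^bsub>C\<^esub> g = zero_arr C W (Cod C f) \<longrightarrow>
      (\<exists>!h. h \<in> Hom C W (Dom C k) \<and> k \<cdot>\<^bsub>C\<^esub> h = g))"

definition is_product ::
    "('o, 'm, 'z) cat_scheme \<Rightarrow> 'o \<Rightarrow> 'o \<Rightarrow> 'o \<Rightarrow> 'm \<Rightarrow> 'm \<Rightarrow> bool" where
  "is_product C X1 X2 P r1 r2 \<longleftrightarrow> P \<in> Obj C \<and> r1 \<in> Hom C P X1 \<and> r2 \<in> Hom C P X2 \<and>
    (\<forall>W\<in>Obj C. \<forall>f1\<in>Hom C W X1. \<forall>f2\<in>Hom C W X2.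
      \<exists>!u. u \<in> Hom C W P \<and> r1 \<cdot>\<^bsub>C\<^esub> u = f1 \<and> r2 \<cdot>\<^bsub>C\<^esub> u = f2)"

definition wide_subcat :: "('o, 'm, 'z) cat_scheme \<Rightarrow> 'm set \<Rightarrow> ('o, 'm) cat" where
  "wide_subcat C S = \<lparr>Obj = Obj C, Arr = Arr C \<inter> S, Dom = Dom C, Cod = Cod C, Ide = Ide C,
    Comp = Comp C\<rparr>"


section \<open>Directed diagrams and colimits\<close>

definition directed_set :: "'j set \<Rightarrow> 'j rel \<Rightarrow> bool" where
  "directed_set J r \<longleftrightarrow> J \<noteq> {} \<and> preorder_on J r \<and>
    (\<forall>i\<in>J. \<forall>j\<in>J. \<exists>k\<in>J. (i, k) \<in> r \<and> (j, k) \<in> r)"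

definition directed_diagram ::
    "('o, 'm, 'z) cat_scheme \<Rightarrow> 'j set \<Rightarrow> 'j rel \<Rightarrow> ('j \<Rightarrow> 'o) \<Rightarrow> ('j \<Rightarrow> 'j \<Rightarrow> 'm) \<Rightarrow> bool" where
  "directed_diagram C J r X f \<longleftrightarrow> directed_set J r \<and>
    (\<forall>j\<in>J. X j \<in> Obj C) \<and>
    (\<forall>(j, k)\<in>r. f j k \<in> Hom C (X j) (X k)) \<and>
    (\<forall>j\<in>J. f j j = \<one>\<^bsub>C\<^esub> (X j)) \<and>
    (\<forall>j k l. (j, k) \<in> r \<longrightarrow> (k, l) \<in> r \<longrightarrow> f k l \<cdot>\<^bsub>C\<^esub> f j k = f j l)"

definition is_cocone ::
    "('o, 'm, 'z) cat_scheme \<Rightarrow> 'j set \<Rightarrow> 'j rel \<Rightarrow> ('j \<Rightarrow> 'o) \<Rightarrow> ('j \<Rightarrow> 'j \<Rightarrow> 'm) \<Rightarrow>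
      'o \<Rightarrow> ('j \<Rightarrow> 'm) \<Rightarrow> bool" where
  "is_cocone C J r X f Y g \<longleftrightarrow> Y \<in> Obj C \<and> (\<forall>j\<in>J. g j \<in> Hom C (X j) Y) \<and>
    (\<forall>(j, k)\<in>r. g k \<cdot>\<^bsub>C\<^esub> f j k = g j)"

definition is_colimit ::
    "('o, 'm, 'z) cat_scheme \<Rightarrow> 'j set \<Rightarrow> 'j rel \<Rightarrow> ('j \<Rightarrow> 'o) \<Rightarrow> ('j \<Rightarrow> 'j \<Rightarrow> 'm) \<Rightarrow>
      'o \<Rightarrow> ('j \<Rightarrow> 'm) \<Rightarrow> bool" where
  "is_colimit C J r X f L c \<longleftrightarrow> is_cocone C J r X f L c \<and>
    (\<forall>Y g. is_cocone C J r X f Y g \<longrightarrow>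
      (\<exists>!u. u \<in> Hom C L Y \<and> (\<forall>j\<in>J. u \<cdot>\<^bsub>C\<^esub> c j = g j)))"

text \<open>HOL cannot quantify over all types inside a formula, so the size of the index sets is a
  parameter: the type \<open>'j\<close>, passed as \<open>TYPE('j)\<close>, plays the role of the universe, and the
  small directed sets are the directed sets on arbitrary subsets of \<open>'j\<close>.\<close>

definition has_directed_colimits :: "'j itself \<Rightarrow> ('o, 'm, 'z) cat_scheme \<Rightarrow> bool" where
  "has_directed_colimits U C \<longleftrightarrow>
    (\<forall>(J :: 'j set) r X f. directed_diagram C J r X f \<longrightarrow> (\<exists>L c. is_colimit C J r X f L c))"

definition codirected_diagram ::
    "('o, 'm, 'z) cat_scheme \<Rightarrow> 'j set \<Rightarrow> 'j rel \<Rightarrow> ('j \<Rightarrow> 'o) \<Rightarrow> ('j \<Rightarrow> 'j \<Rightarrow> 'm) \<Rightarrow> bool" where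
  "codirected_diagram C J r X f \<longleftrightarrow> directed_set J r \<and>
    (\<forall>j\<in>J. X j \<in> Obj C) \<and>
    (\<forall>(j, k)\<in>r. f j k \<in> Hom C (X k) (X j)) \<and>
    (\<forall>j\<in>J. f j j = \<one>\<^bsub>C\<^esub> (X j)) \<and>
    (\<forall>j k l. (j, k) \<in> r \<longrightarrow> (k, l) \<in> r \<longrightarrow> f j k \<cdot>\<^bsub>C\<^esub> f k l = f j l)"

definition is_cone ::
    "('o, 'm, 'z) cat_scheme \<Rightarrow> 'j set \<Rightarrow> 'j rel \<Rightarrow> ('j \<Rightarrow> 'o) \<Rightarrow> ('j \<Rightarrow> 'j \<Rightarrow> 'm) \<Rightarrow>
      'o \<Rightarrow> ('j \<Rightarrow> 'm) \<Rightarrow> bool" where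
  "is_cone C J r X f Y g \<longleftrightarrow> Y \<in> Obj C \<and> (\<forall>j\<in>J. g j \<in> Hom C Y (X j)) \<and>
    (\<forall>(j, k)\<in>r. f j k \<cdot>\<^bsub>C\<^esub> g k = g j)"


section \<open>Pre-Hilbert *-categories\<close>

record ('o, 'm) star_cat = "('o, 'm) cat" +
  Star :: "'m \<Rightarrow> 'm"  ("_\<^sup>\<star>\<index>" [1000] 999)

locale star_category = category C
  for C :: "('o, 'm, 'z) star_cat_scheme" (structure) +
  assumes star_in_Hom: "f \<in> Hom C X Y \<Longrightarrow> f\<^sup>\<star> \<in> Hom C Y X"
    and star_ide: "X \<in> Obj C \<Longrightarrow> (\<one> X)\<^sup>\<star> = \<one> X"
    and star_comp: "f \<in> Hom C X Y \<Longrightarrow> g \<in> Hom C Y Z \<Longrightarrow> (g \<cdot> f)\<^sup>\<star> = f\<^sup>\<star> \<cdot> g\<^sup>\<star>"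
    and star_star: "f \<in> Arr C \<Longrightarrow> (f\<^sup>\<star>)\<^sup>\<star> = f"

definition isometry :: "('o, 'm, 'z) star_cat_scheme \<Rightarrow> 'm \<Rightarrow> bool" where
  "isometry C f \<longleftrightarrow> f \<in> Arr C \<and> f\<^sup>\<star>\<^bsub>C\<^esub> \<cdot>\<^bsub>C\<^esub> f = \<one>\<^bsub>C\<^esub> (Dom C f)"

definition coisometry :: "('o, 'm, 'z) star_cat_scheme \<Rightarrow> 'm \<Rightarrow> bool" where
  "coisometry C f \<longleftrightarrow> f \<in> Arr C \<and> f \<cdot>\<^bsub>C\<^esub> f\<^sup>\<star>\<^bsub>C\<^esub> = \<one>\<^bsub>C\<^esub> (Cod C f)"

definition orthonormal_product ::
    "('o, 'm, 'z) star_cat_scheme \<Rightarrow> 'o \<Rightarrow> 'o \<Rightarrow> 'o \<Rightarrow> 'm \<Rightarrow> 'm \<Rightarrow> bool" where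
  "orthonormal_product C X1 X2 P r1 r2 \<longleftrightarrow> is_product C X1 X2 P r1 r2 \<and>
    coisometry C r1 \<and> coisometry C r2 \<and> r1 \<cdot>\<^bsub>C\<^esub> r2\<^sup>\<star>\<^bsub>C\<^esub> = zero_arr C X2 X1"

definition is_diagonal ::
    "('o, 'm, 'z) star_cat_scheme \<Rightarrow> 'o \<Rightarrow> 'o \<Rightarrow> 'm \<Rightarrow> 'm \<Rightarrow> 'm \<Rightarrow> bool" where
  "is_diagonal C X P r1 r2 d \<longleftrightarrow> orthonormal_product C X X P r1 r2 \<and> d \<in> Hom C X P \<and>
    r1 \<cdot>\<^bsub>C\<^esub> d = \<one>\<^bsub>C\<^esub> X \<and> r2 \<cdot>\<^bsub>C\<^esub> d = \<one>\<^bsub>C\<^esub> X"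

locale pre_hilbert_category = star_category C
  for C :: "('o, 'm, 'z) star_cat_scheme" (structure) +
  assumes ex_zero_object: "\<exists>Z. is_zero_object C Z"
    and ex_orthonormal_product:
      "X1 \<in> Obj C \<Longrightarrow> X2 \<in> Obj C \<Longrightarrow> \<exists>P r1 r2. orthonormal_product C X1 X2 P r1 r2"
    and ex_isometric_kernel: "f \<in> Arr C \<Longrightarrow> \<exists>k. is_kernel C k f \<and> isometry C k"
    and diagonal_is_kernel: "is_diagonal C X P r1 r2 d \<Longrightarrow> \<exists>f. is_kernel C d f"


section \<open>Canonical enrichment and order\<close>

text \<open>The biproduct formula for the sum of parallel arrows \<open>f, g : X \<rightarrow> Y\<close>: the pairing
  \<open>u : X \<rightarrow> Y \<oplus> Y\<close> of \<open>f\<close> and \<open>g\<close> followed by the codiagonal of \<open>Y\<close>. The codiagonal is the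
  adjoint of the diagonal, because the coprojections of an orthonormal product are the adjoints of
  its projections. The result does not depend on the choice of \<open>Y \<oplus> Y\<close>.\<close>

definition plus_arr :: "('o, 'm, 'z) star_cat_scheme \<Rightarrow> 'm \<Rightarrow> 'm \<Rightarrow> 'm" where
  "plus_arr C f g = (THE s. \<exists>P r1 r2 d u. is_diagonal C (Cod C f) P r1 r2 d \<and>
    u \<in> Hom C (Dom C f) P \<and> r1 \<cdot>\<^bsub>C\<^esub> u = f \<and> r2 \<cdot>\<^bsub>C\<^esub> u = g \<and> s = d\<^sup>\<star>\<^bsub>C\<^esub> \<cdot>\<^bsub>C\<^esub> u)"

definition minus_arr :: "('o, 'm, 'z) star_cat_scheme \<Rightarrow> 'm \<Rightarrow> 'm \<Rightarrow> 'm" where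
  "minus_arr C g f = (THE h. h \<in> Hom C (Dom C g) (Cod C g) \<and> plus_arr C h f = g)"

definition Herm :: "('o, 'm, 'z) star_cat_scheme \<Rightarrow> 'o \<Rightarrow> 'm set" where
  "Herm C A = {a \<in> Hom C A A. a\<^sup>\<star>\<^bsub>C\<^esub> = a}"

definition herm_le :: "('o, 'm, 'z) star_cat_scheme \<Rightarrow> 'o \<Rightarrow> 'm \<Rightarrow> 'm \<Rightarrow> bool" where
  "herm_le C A f g \<longleftrightarrow> f \<in> Herm C A \<and> g \<in> Herm C A \<and>
    (\<exists>X\<in>Obj C. \<exists>h\<in>Hom C A X. minus_arr C g f = h\<^sup>\<star>\<^bsub>C\<^esub> \<cdot>\<^bsub>C\<^esub> h)"

definition herm_bdd_above :: "('o, 'm, 'z) star_cat_scheme \<Rightarrow> 'o \<Rightarrow> 'm set \<Rightarrow> bool" where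
  "herm_bdd_above C A S \<longleftrightarrow> (\<exists>b\<in>Herm C A. \<forall>a\<in>S. herm_le C A a b)"

definition herm_is_sup :: "('o, 'm, 'z) star_cat_scheme \<Rightarrow> 'o \<Rightarrow> 'm set \<Rightarrow> 'm \<Rightarrow> bool" where
  "herm_is_sup C A S s \<longleftrightarrow> s \<in> Herm C A \<and> (\<forall>a\<in>S. herm_le C A a s) \<and>
    (\<forall>b\<in>Herm C A. (\<forall>a\<in>S. herm_le C A a b) \<longrightarrow> herm_le C A s b)"

definition contraction :: "('o, 'm, 'z) star_cat_scheme \<Rightarrow> 'm \<Rightarrow> bool" where
  "contraction C f \<longleftrightarrow>
    f \<in> Arr C \<and> herm_le C (Dom C f) (f\<^sup>\<star>\<^bsub>C\<^esub> \<cdot>\<^bsub>C\<^esub> f) (\<one>\<^bsub>C\<^esub> (Dom C f))"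

definition contraction_subcat :: "('o, 'm, 'z) star_cat_scheme \<Rightarrow> ('o, 'm) cat" where
  "contraction_subcat C = wide_subcat C {f. contraction C f}"

definition isometry_subcat :: "('o, 'm, 'z) star_cat_scheme \<Rightarrow> ('o, 'm) cat" where
  "isometry_subcat C = wide_subcat C {f. isometry C f}"


section \<open>Hilbert *-categories\<close>

text \<open>For a diagram of contractions the net \<open>g\<^sub>j\<^sup>\<star> g\<^sub>j\<close> of a cone is automatically increasing, so only
  its boundedness is demanded.\<close>

definition l2_cone ::
    "('o, 'm, 'z) star_cat_scheme \<Rightarrow> 'j set \<Rightarrow> 'j rel \<Rightarrow> ('j \<Rightarrow> 'o) \<Rightarrow> ('j \<Rightarrow> 'j \<Rightarrow> 'm) \<Rightarrow>
      'o \<Rightarrow> ('j \<Rightarrow> 'm) \<Rightarrow> bool" where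
  "l2_cone C J r X f Y g \<longleftrightarrow> is_cone C J r X f Y g \<and>
    herm_bdd_above C Y ((\<lambda>j. (g j)\<^sup>\<star>\<^bsub>C\<^esub> \<cdot>\<^bsub>C\<^esub> g j) ` J)"

definition l2_limit ::
    "('o, 'm, 'z) star_cat_scheme \<Rightarrow> 'j set \<Rightarrow> 'j rel \<Rightarrow> ('j \<Rightarrow> 'o) \<Rightarrow> ('j \<Rightarrow> 'j \<Rightarrow> 'm) \<Rightarrow>
      'o \<Rightarrow> ('j \<Rightarrow> 'm) \<Rightarrow> bool" where
  "l2_limit C J r X f L p \<longleftrightarrow> l2_cone C J r X f L p \<and>
    (\<forall>Y g. l2_cone C J r X f Y g \<longrightarrow>
      (\<exists>!u. u \<in> Hom C Y L \<and> (\<forall>j\<in>J. p j \<cdot>\<^bsub>C\<^esub> u = g j)) \<and>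
      (\<forall>u. u \<in> Hom C Y L \<and> (\<forall>j\<in>J. p j \<cdot>\<^bsub>C\<^esub> u = g j) \<longrightarrow>
        herm_is_sup C Y ((\<lambda>j. (g j)\<^sup>\<star>\<^bsub>C\<^esub> \<cdot>\<^bsub>C\<^esub> g j) ` J) (u\<^sup>\<star>\<^bsub>C\<^esub> \<cdot>\<^bsub>C\<^esub> u)))"

definition hilbert_category :: "'j itself \<Rightarrow> ('o, 'm, 'z) star_cat_scheme \<Rightarrow> bool" where
  "hilbert_category U C \<longleftrightarrow> pre_hilbert_category C \<and>
    (\<forall>(J :: 'j set) r X f. codirected_diagram C J r X f \<longrightarrow>
      (\<forall>(j, k)\<in>r. contraction C (f j k)) \<longrightarrow> (\<exists>L p. l2_limit C J r X f L p))"

end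

theory Submission
  imports Defs
begin

text \<open>The main tool is a Douglas lemma valid in every pre-Hilbert *-category: if \<open>e\<close> is epic and
  \<open>t\<^sup>\<star> t \<le> e\<^sup>\<star> e\<close>, then \<open>t\<close> factors through \<open>e\<close> by a unique contraction. Hence an \<open>\<ell>\<^sup>2\<close>-cone bounded
  by \<open>b = h\<^sup>\<star> h\<close>, with \<open>h\<close> epic, is a cone of contractions composed with \<open>h\<close>, so \<open>\<ell>\<^sup>2\<close>-limits are the
  same as limits of contractions.

  If contractions have directed colimits, then the colimit of a diagram of isometries consists of
  isometries, because the adjoints of the diagram give cocones into its objects; and the defect
  \<open>1 - u\<^sup>\<star> u\<close> of the mediator \<open>u\<close> of an isometric cocone vanishes on the whole diagram.

  Conversely, assume that isometries have directed colimits. The defects of a contractive cocone on a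
  diagram of isometries form, by the Douglas lemma, another diagram of isometries; adding its colimit
  dilates the cocone to an isometric one, so isometric colimits are universal for contractive cocones
  as well. A chain of contractions \<open>f\<close> has minimal isometric dilations over its finite parts; these
  have a colimit \<open>V\<close>, and the colimit of the chain is the orthogonal complement in \<open>V\<close> of the kernels
  of the compressions to the top object of each finite part. Finally, directed colimits in any category
  reduce to colimits of chains. The finite parts can be indexed by the given universe unless it is
  finite, when every directed set has a top element.\<close>

section \<open>Directed diagrams\<close>

text \<open>Contractions are not closed under addition, and a colimit hypothesis says nothing about
  arrows outside its subcategory. Linear arguments therefore run in \<open>C\<close>, with kernels
  and positive elements, and uniqueness has to be extended from isometries or contractions to all
  arrows of \<open>C\<close> before it can be combined with them. Subtraction itself must be derived
  from the diagonal being a kernel, and the role of square roots is taken over by the arrows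
  \<open>h\<close> that the order attaches to every inequality. Chains are forced by the dilation.
  The inner product between the copies of \<open>X i\<close> and \<open>X j\<close> is to be
  \<open>f i j\<close> when \<open>i\<close> lies below \<open>j\<close>. For incomparable indices
  nothing is prescribed: the obvious candidate \<open>(f j k)\<^sup>\<star> \<cdot> f i k\<close> at
  an upper bound \<open>k\<close> depends on \<open>k\<close> once the transitions stop being
  isometric.\<close>

lemma directed_setD:
  assumes "directed_set J r"
  shows "J \<noteq> {}" "r \<subseteq> J \<times> J" "\<And>j. j \<in> J \<Longrightarrow> (j, j) \<in> r" "trans r"
    "\<And>i j. i \<in> J \<Longrightarrow> j \<in> J \<Longrightarrow> \<exists>k\<in>J. (i, k) \<in> r \<and> (j, k) \<in> r"
  using assms by (auto simp: directed_set_def preorder_on_def refl_on_def)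

lemma directed_diagramD:
  assumes "directed_diagram C J r X f"
  shows "directed_set J r" "\<And>j. j \<in> J \<Longrightarrow> X j \<in> Obj C"
    "\<And>j k. (j, k) \<in> r \<Longrightarrow> f j k \<in> Hom C (X j) (X k)"
    "\<And>j. j \<in> J \<Longrightarrow> f j j = \<one>\<^bsub>C\<^esub> (X j)"
    "\<And>j k l. (j, k) \<in> r \<Longrightarrow> (k, l) \<in> r \<Longrightarrow> f k l \<cdot>\<^bsub>C\<^esub> f j k = f j l"
    "\<And>j k. (j, k) \<in> r \<Longrightarrow> j \<in> J" "\<And>j k. (j, k) \<in> r \<Longrightarrow> k \<in> J"
  using assms directed_setD(2)[of J r] by (auto simp: directed_diagram_def)

lemma is_coconeD:
  assumes "is_cocone C J r X f Y g"
  shows "Y \<in> Obj C" "\<And>j. j \<in> J \<Longrightarrow> g j \<in> Hom C (X j) Y"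
    "\<And>j k. (j, k) \<in> r \<Longrightarrow> g k \<cdot>\<^bsub>C\<^esub> f j k = g j"
  using assms by (auto simp: is_cocone_def)

lemma is_colimitD:
  assumes "is_colimit C J r X f L c"
  shows "is_cocone C J r X f L c"
    "\<And>Y g. is_cocone C J r X f Y g \<Longrightarrow> \<exists>u\<in>Hom C L Y. \<forall>j\<in>J. u \<cdot>\<^bsub>C\<^esub> c j = g j"
    "\<And>Y g u v. is_cocone C J r X f Y g \<Longrightarrow> u \<in> Hom C L Y \<Longrightarrow> v \<in> Hom C L Y \<Longrightarrow>
      (\<And>j. j \<in> J \<Longrightarrow> u \<cdot>\<^bsub>C\<^esub> c j = g j) \<Longrightarrow> (\<And>j. j \<in> J \<Longrightarrow> v \<cdot>\<^bsub>C\<^esub> c j = g j) \<Longrightarrow> u = v"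
  using assms unfolding is_colimit_def by blast+

lemma is_colimitI:
  assumes "is_cocone C J r X f L c"
    and "\<And>Y g. is_cocone C J r X f Y g \<Longrightarrow> \<exists>u\<in>Hom C L Y. \<forall>j\<in>J. u \<cdot>\<^bsub>C\<^esub> c j = g j"
    and "\<And>Y g u v. is_cocone C J r X f Y g \<Longrightarrow> u \<in> Hom C L Y \<Longrightarrow> v \<in> Hom C L Y \<Longrightarrow>
      (\<And>j. j \<in> J \<Longrightarrow> u \<cdot>\<^bsub>C\<^esub> c j = g j) \<Longrightarrow> (\<And>j. j \<in> J \<Longrightarrow> v \<cdot>\<^bsub>C\<^esub> c j = g j) \<Longrightarrow> u = v"
  shows "is_colimit C J r X f L c"
  unfolding is_colimit_def
proof (intro conjI allI impI)
  fix Y g assume g: "is_cocone C J r X f Y g"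
  obtain u where u: "u \<in> Hom C L Y" "\<forall>j\<in>J. u \<cdot>\<^bsub>C\<^esub> c j = g j"
    using assms(2)[OF g] by blast
  show "\<exists>!u. u \<in> Hom C L Y \<and> (\<forall>j\<in>J. u \<cdot>\<^bsub>C\<^esub> c j = g j)"
  proof (intro ex1I conjI)
    fix v assume "v \<in> Hom C L Y \<and> (\<forall>j\<in>J. v \<cdot>\<^bsub>C\<^esub> c j = g j)"
    then show "v = u" using assms(3)[OF g, of v u] u by blast
  qed (use u in auto)
qed fact

lemma finite_directed_upper_bound:
  assumes "directed_set J r" "finite F" "F \<subseteq> J"
  shows "\<exists>t\<in>J. \<forall>x\<in>F. (x, t) \<in> r"
  using assms(2,3)
proof (induction F rule: finite_induct)
  case empty
  then show ?case using directed_setD(1)[OF assms(1)] by auto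
next
  case (insert x F)
  then obtain t where t: "t \<in> J" "\<forall>y\<in>F. (y, t) \<in> r" by auto
  obtain k where "k \<in> J" "(x, k) \<in> r" "(t, k) \<in> r"
    using directed_setD(5)[OF assms(1), of x t] t insert.prems by auto
  then show ?case using t transD[OF directed_setD(4)[OF assms(1)]] by blast
qed

context category
begin

lemma colimit_top:
  assumes dd: "directed_diagram C J r X f" and t: "t \<in> J" "\<And>j. j \<in> J \<Longrightarrow> (j, t) \<in> r"
  shows "is_colimit C J r X f (X t) (\<lambda>j. f j t)"
proof (rule is_colimitI)
  note D = directed_diagramD[OF dd]
  show "is_cocone C J r X f (X t) (\<lambda>j. f j t)"
    using D t by (auto simp: is_cocone_def)
  fix Y g assume g: "is_cocone C J r X f Y g"
  note G = is_coconeD[OF g]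
  show "\<exists>u\<in>Hom C (X t) Y. \<forall>j\<in>J. u \<cdot> f j t = g j"
    using G t by blast
  fix u v assume "u \<in> Hom C (X t) Y" "v \<in> Hom C (X t) Y"
    "\<And>j. j \<in> J \<Longrightarrow> u \<cdot> f j t = g j" "\<And>j. j \<in> J \<Longrightarrow> v \<cdot> f j t = g j"
  then show "u = v" using D(4) t(1) comp_ide_right by metis
qed

lemma directed_diagram_reindex:
  assumes dd: "directed_diagram C J r X f" and I: "directed_set I q"
    and m: "\<And>i. i \<in> I \<Longrightarrow> m i \<in> J" "\<And>i i'. (i, i') \<in> q \<Longrightarrow> (m i, m i') \<in> r"
  shows "directed_diagram C I q (\<lambda>i. X (m i)) (\<lambda>i i'. f (m i) (m i'))"
proof -
  note D = directed_diagramD[OF dd]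
  show ?thesis unfolding directed_diagram_def
    using I m D by (auto simp: directed_set_def)
qed

text \<open>A preorder carries at most one transition from \<open>X j\<close> to \<open>X k\<close>,
  so the composite \<open>c i \<cdot> f j (m i)\<close> does not change when \<open>i\<close> grows.
  As \<open>I\<close> is directed, any two admissible \<open>i\<close> give the same arrow, and the
  arbitrary choice \<open>n j\<close> in \<open>d\<close> is harmless.\<close>

lemma colimit_cofinal:
  assumes dd: "directed_diagram C J r X f" and I: "directed_set I q"
    and m: "\<And>i. i \<in> I \<Longrightarrow> m i \<in> J" "\<And>i i'. (i, i') \<in> q \<Longrightarrow> (m i, m i') \<in> r"
    and cof: "\<And>j. j \<in> J \<Longrightarrow> \<exists>i\<in>I. (j, m i) \<in> r"
    and colim: "is_colimit C I q (\<lambda>i. X (m i)) (\<lambda>i i'. f (m i) (m i')) L c"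
  shows "\<exists>c. is_colimit C J r X f L c"
proof -
  note D = directed_diagramD[OF dd] and I' = directed_setD[OF I]
  note K = is_coconeD[OF is_colimitD(1)[OF colim]]
  obtain n where n: "\<And>j. j \<in> J \<Longrightarrow> n j \<in> I" "\<And>j. j \<in> J \<Longrightarrow> (j, m (n j)) \<in> r"
    using cof by metis
  define d where "d j = c (n j) \<cdot> f j (m (n j))" for j
  have later: "c i \<cdot> f j (m i) = c i' \<cdot> f j (m i')" if "(i, i') \<in> q" "(j, m i) \<in> r" for i i' j
  proof -
    have i: "i \<in> I" "i' \<in> I" using that I'(2) by auto
    have "c i \<cdot> f j (m i) = (c i' \<cdot> f (m i) (m i')) \<cdot> f j (m i)" using K(3)[OF that(1)] by simp
    also have "\<dots> = c i' \<cdot> (f (m i) (m i') \<cdot> f j (m i))"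
      by (rule comp_assoc[OF D(3)[OF that(2)] D(3)[OF m(2)[OF that(1)]] K(2)[OF i(2)]])
    also have "\<dots> = c i' \<cdot> f j (m i')" using D(5)[OF that(2) m(2)[OF that(1)]] by simp
    finally show ?thesis .
  qed
  have d: "d j = c i \<cdot> f j (m i)" if i: "i \<in> I" "(j, m i) \<in> r" for i j
  proof -
    have j: "j \<in> J" using i D(6) by blast
    obtain k where k: "(n j, k) \<in> q" "(i, k) \<in> q" using I'(5)[OF n(1)[OF j] i(1)] by blast
    show ?thesis unfolding d_def using later[OF k(1) n(2)[OF j]] later[OF k(2) i(2)] by simp
  qed
  have cd: "c i = d (m i)" if "i \<in> I" for i
    using d[OF that, of "m i"] I'(3)[OF that] m D(4) K(2)[OF that] comp_ide_right that by metis
  have dhom: "d j \<in> Hom C (X j) L" if "j \<in> J" for j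
    unfolding d_def by (rule comp_in_Hom[OF D(3)[OF n(2)[OF that]] K(2)[OF n(1)[OF that]]])
  have "is_colimit C J r X f L d"
  proof (rule is_colimitI)
    have "d k \<cdot> f j k = d j" if "(j, k) \<in> r" for j k
    proof -
      have k: "k \<in> J" using that D(7) by blast
      have "d k \<cdot> f j k = c (n k) \<cdot> (f k (m (n k)) \<cdot> f j k)" unfolding d_def
        by (rule comp_assoc[OF D(3)[OF that] D(3)[OF n(2)[OF k]] K(2)[OF n(1)[OF k]]])
      also have "\<dots> = c (n k) \<cdot> f j (m (n k))" using D(5)[OF that n(2)[OF k]] by simp
      also have "\<dots> = d j"
        using d[OF n(1)[OF k]] transD[OF directed_setD(4)[OF D(1)] that n(2)[OF k]] by simp
      finally show ?thesis .
    qed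
    then show "is_cocone C J r X f L d" using K(1) dhom by (auto simp: is_cocone_def)
    fix Y g assume g: "is_cocone C J r X f Y g"
    note G = is_coconeD[OF g]
    have gm: "is_cocone C I q (\<lambda>i. X (m i)) (\<lambda>i i'. f (m i) (m i')) Y (\<lambda>i. g (m i))"
      using G m by (auto simp: is_cocone_def)
    show "\<exists>u\<in>Hom C L Y. \<forall>j\<in>J. u \<cdot> d j = g j"
    proof -
      obtain u where u: "u \<in> Hom C L Y" "\<forall>i\<in>I. u \<cdot> c i = g (m i)"
        using is_colimitD(2)[OF colim gm] by blast
      have "u \<cdot> d j = g j" if j: "j \<in> J" for j
      proof -
        have "u \<cdot> d j = (u \<cdot> c (n j)) \<cdot> f j (m (n j))" unfolding d_def
          by (rule comp_assoc[symmetric, OF D(3)[OF n(2)[OF j]] K(2)[OF n(1)[OF j]] u(1)])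
        then show ?thesis using u(2) n[OF j] G(3) by auto
      qed
      then show ?thesis using u(1) by blast
    qed
    fix u v assume "u \<in> Hom C L Y" "v \<in> Hom C L Y"
      "\<And>j. j \<in> J \<Longrightarrow> u \<cdot> d j = g j" "\<And>j. j \<in> J \<Longrightarrow> v \<cdot> d j = g j"
    then show "u = v" using is_colimitD(3)[OF colim gm, of u v] cd m(1) by simp
  qed
  then show ?thesis by blast
qed

text \<open>Brings index sets of a foreign type, such as sets of finite subsets, back under a
  hypothesis that speaks only about subsets of \<open>'j\<close>: the diagram is relabelled along
  \<open>\<phi>\<close>, and relabelling is a cofinal reindexing.\<close>

lemma colimit_of_smaller_index:
  fixes J :: "'i set" and \<phi> :: "'i \<Rightarrow> 'j"
  assumes has: "has_directed_colimits TYPE('j) C"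
    and dd: "directed_diagram C J r X f" and inj: "inj_on \<phi> J"
  shows "\<exists>L c. is_colimit C J r X f L c"
proof -
  note D = directed_diagramD[OF dd] and S = directed_setD[OF directed_diagramD(1)[OF dd]]
  define m where "m = inv_into J \<phi>"
  define q where "q = {(a, b). a \<in> \<phi> ` J \<and> b \<in> \<phi> ` J \<and> (m a, m b) \<in> r}"
  have mphi: "m (\<phi> j) = j" if "j \<in> J" for j using that inj by (simp add: m_def)
  have q: "directed_set (\<phi> ` J) q"
  proof -
    have "trans q" unfolding trans_def q_def using transD[OF S(4)] by blast
    moreover have "\<exists>k\<in>\<phi> ` J. (a, k) \<in> q \<and> (b, k) \<in> q" if ab: "a \<in> \<phi> ` J" "b \<in> \<phi> ` J" for a b
    proof -
      obtain i j where ij: "i \<in> J" "j \<in> J" "a = \<phi> i" "b = \<phi> j" using ab by blast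
      obtain k where "k \<in> J" "(i, k) \<in> r" "(j, k) \<in> r" using S(5) ij by blast
      then show ?thesis using ij mphi by (intro bexI[of _ "\<phi> k"]) (auto simp: q_def)
    qed
    ultimately show ?thesis using S(1,3) mphi
      by (auto simp: directed_set_def preorder_on_def refl_on_def q_def)
  qed
  have m: "\<And>i. i \<in> \<phi> ` J \<Longrightarrow> m i \<in> J" "\<And>i i'. (i, i') \<in> q \<Longrightarrow> (m i, m i') \<in> r"
    using mphi by (auto simp: q_def)
  have cof: "\<exists>i\<in>\<phi> ` J. (j, m i) \<in> r" if "j \<in> J" for j
    using that mphi S(3) by auto
  obtain L c where "is_colimit C (\<phi> ` J) q (\<lambda>i. X (m i)) (\<lambda>i i'. f (m i) (m i')) L c"
    using has directed_diagram_reindex[where m = m, OF dd q m] unfolding has_directed_colimits_def by blast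
  from colimit_cofinal[OF dd q m cof this] show ?thesis by blast
qed

end

section \<open>Directed colimits from chains\<close>

definition incl :: "'a set set \<Rightarrow> 'a set rel" where
  "incl \<A> = {(F, G). F \<in> \<A> \<and> G \<in> \<A> \<and> F \<subseteq> G}"

lemma incl_iff [simp]: "(F, G) \<in> incl \<A> \<longleftrightarrow> F \<in> \<A> \<and> G \<in> \<A> \<and> F \<subseteq> G"
  by (simp add: incl_def)

lemma directed_set_incl:
  assumes "\<A> \<noteq> {}" "\<And>F G. F \<in> \<A> \<Longrightarrow> G \<in> \<A> \<Longrightarrow> F \<union> G \<in> \<A>"
  shows "directed_set \<A> (incl \<A>)"
proof -
  have "trans (incl \<A>)" by (auto simp: trans_def)
  moreover have "\<exists>k\<in>\<A>. (F, k) \<in> incl \<A> \<and> (G, k) \<in> incl \<A>" if "F \<in> \<A>" "G \<in> \<A>" for F G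
    using assms(2)[OF that] that by (intro bexI[of _ "F \<union> G"]) auto
  ultimately show ?thesis
    using assms(1) by (auto simp: directed_set_def preorder_on_def refl_on_def)
qed

lemma directed_set_Fpow: "directed_set (Fpow A) (incl (Fpow A))"
  by (rule directed_set_incl) (auto simp: Fpow_def)

lemma finite_subset_chain_Union:
  assumes lin: "linear_order_on I w" and ne: "I \<noteq> {}"
    and mono: "\<And>x y. (x, y) \<in> w \<Longrightarrow> B x \<subseteq> B y"
    and F: "finite F" "F \<subseteq> (\<Union>x\<in>I. B x)"
  shows "\<exists>x\<in>I. F \<subseteq> B x"
  using F
proof (induction F rule: finite_induct)
  case empty
  then show ?case using ne by auto
next
  case (insert a F)
  then obtain x y where xy: "x \<in> I" "F \<subseteq> B x" "y \<in> I" "a \<in> B y" by auto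
  have "x = y \<or> (x, y) \<in> w \<or> (y, x) \<in> w"
    using lin xy by (auto simp: linear_order_on_def total_on_def)
  then show ?case using xy mono by blast
qed

lemma linear_order_directed_set:
  assumes "linear_order_on I w" "I \<noteq> {}"
  shows "directed_set I w"
  using assms unfolding linear_order_on_def partial_order_on_def directed_set_def total_on_def
    preorder_on_def refl_on_def by metis

lemma linear_order_on_restrict:
  assumes "linear_order_on I w" "F \<subseteq> I"
  shows "linear_order_on F (w \<inter> F \<times> F)"
  using assms unfolding linear_order_on_def partial_order_on_def preorder_on_def refl_on_def
    trans_def antisym_def total_on_def by blast

text \<open>Up to a cofinal reindexing, every directed diagram is a functor on the finite subsets of a
  well-ordered set. For these, colimits are built by transfinite induction over the initial segments
  \<open>A\<close>: a top element of \<open>A\<close> may be put into every finite subset, and otherwise the finite subsets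
  of \<open>A\<close> are the union of a chain of smaller cases.\<close>

definition (in category) Fpow_cocomplete :: "'a set \<Rightarrow> bool" where
  "Fpow_cocomplete A \<longleftrightarrow> (\<forall>X f. directed_diagram C (Fpow A) (incl (Fpow A)) X f \<longrightarrow>
    (\<exists>L c. is_colimit C (Fpow A) (incl (Fpow A)) X f L c))"

context category
begin

lemma Fpow_cocomplete_empty: "Fpow_cocomplete {}"
  unfolding Fpow_cocomplete_def
proof (intro allI impI)
  fix X f assume "directed_diagram C (Fpow {}) (incl (Fpow {})) X f"
  from colimit_top[OF this, of "{}"]
  show "\<exists>L c. is_colimit C (Fpow {}) (incl (Fpow {})) X f L c" by (auto simp: Fpow_def)
qed

lemma Fpow_cocomplete_insert:
  assumes "Fpow_cocomplete B"
  shows "Fpow_cocomplete (insert x B)"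
  unfolding Fpow_cocomplete_def
proof (intro allI impI)
  fix X f assume dd: "directed_diagram C (Fpow (insert x B)) (incl (Fpow (insert x B))) X f"
  have m: "\<And>F. F \<in> Fpow B \<Longrightarrow> insert x F \<in> Fpow (insert x B)"
    "\<And>F G. (F, G) \<in> incl (Fpow B) \<Longrightarrow> (insert x F, insert x G) \<in> incl (Fpow (insert x B))"
    by (auto simp: Fpow_def)
  have cof: "\<exists>G\<in>Fpow B. (F, insert x G) \<in> incl (Fpow (insert x B))"
    if "F \<in> Fpow (insert x B)" for F
    using that by (intro bexI[of _ "F - {x}"]) (auto simp: Fpow_def)
  obtain L c where "is_colimit C (Fpow B) (incl (Fpow B)) (\<lambda>F. X (insert x F))
      (\<lambda>F G. f (insert x F) (insert x G)) L c"
    using assms directed_diagram_reindex[where m = "insert x", OF dd directed_set_Fpow m]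
    unfolding Fpow_cocomplete_def by blast
  from colimit_cofinal[OF dd directed_set_Fpow m cof this]
  show "\<exists>L c. is_colimit C (Fpow (insert x B)) (incl (Fpow (insert x B))) X f L c" by blast
qed

text \<open>A colimit of colimits. The stages \<open>L x\<close> have unique mediators
  \<open>l x y\<close> to the restricted cocones, uniqueness makes these a diagram on the chain
  \<open>I\<close>, and its colimit \<open>M\<close> serves the whole union because each finite set
  already lies in one \<open>B x\<close>.\<close>

lemma Fpow_cocomplete_Union:
  fixes I :: "'j set" and B :: "'j \<Rightarrow> 'a set"
  assumes chains: "\<And>X f. directed_diagram C I w X f \<Longrightarrow> \<exists>L c. is_colimit C I w X f L c"
    and lin: "linear_order_on I w" and ne: "I \<noteq> {}"
    and mono: "\<And>x y. (x, y) \<in> w \<Longrightarrow> B x \<subseteq> B y"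
    and B: "\<And>x. x \<in> I \<Longrightarrow> Fpow_cocomplete (B x)"
  shows "Fpow_cocomplete (\<Union>x\<in>I. B x)"
  unfolding Fpow_cocomplete_def
proof (intro allI impI)
  let ?A = "\<Union>x\<in>I. B x"
  fix X f assume dd: "directed_diagram C (Fpow ?A) (incl (Fpow ?A)) X f"
  note D = directed_diagramD[OF dd]
  note W = directed_setD[OF linear_order_directed_set[OF lin ne]]
  have sub: "F \<in> Fpow ?A" if "x \<in> I" "F \<in> Fpow (B x)" for x F
    using that by (auto simp: Fpow_def)
  have up: "F \<in> Fpow (B y)" if "(x, y) \<in> w" "F \<in> Fpow (B x)" for x y F
    using mono[OF that(1)] that(2) by (auto simp: Fpow_def)
  have ddx: "directed_diagram C (Fpow (B x)) (incl (Fpow (B x))) X f" if "x \<in> I" for x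
    using directed_diagram_reindex[OF dd directed_set_Fpow, of "B x" "\<lambda>F. F"] sub[OF that] by simp
  have "\<exists>L c. is_colimit C (Fpow (B x)) (incl (Fpow (B x))) X f L c" if "x \<in> I" for x
    using B[OF that] ddx[OF that] unfolding Fpow_cocomplete_def by blast
  then obtain L c where Lc: "\<And>x. x \<in> I \<Longrightarrow> is_colimit C (Fpow (B x)) (incl (Fpow (B x))) X f (L x) (c x)"
    by metis
  note K = is_coconeD[OF is_colimitD(1)[OF Lc]]
  have restrict: "is_cocone C (Fpow (B x)) (incl (Fpow (B x))) X f Y g"
    if "x \<in> I" "Y \<in> Obj C" "\<And>F. F \<in> Fpow (B x) \<Longrightarrow> g F \<in> Hom C (X F) Y"
      "\<And>F G. F \<in> Fpow (B x) \<Longrightarrow> G \<in> Fpow (B x) \<Longrightarrow> F \<subseteq> G \<Longrightarrow> g G \<cdot> f F G = g F" for x Y g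
    using that by (auto simp: is_cocone_def)
  have cy: "is_cocone C (Fpow (B x)) (incl (Fpow (B x))) X f (L y) (c y)" if xy: "(x, y) \<in> w" for x y
  proof -
    have "x \<in> I" "y \<in> I" using xy W(2) by auto
    then show ?thesis using K[of y] up[OF xy] by (intro restrict) auto
  qed
  have "\<exists>u. (x, y) \<in> w \<longrightarrow> u \<in> Hom C (L x) (L y) \<and> (\<forall>F\<in>Fpow (B x). u \<cdot> c x F = c y F)" for x y
  proof (cases "(x, y) \<in> w")
    case True
    then have "x \<in> I" using W(2) by auto
    then show ?thesis using is_colimitD(2)[OF Lc cy[OF True]] by blast
  qed auto
  then obtain l where lw: "\<And>x y. (x, y) \<in> w \<longrightarrow> l x y \<in> Hom C (L x) (L y) \<and>
      (\<forall>F\<in>Fpow (B x). l x y \<cdot> c x F = c y F)"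
    by metis
  have l: "\<And>x y. (x, y) \<in> w \<Longrightarrow> l x y \<in> Hom C (L x) (L y)"
    "\<And>x y F. (x, y) \<in> w \<Longrightarrow> F \<in> Fpow (B x) \<Longrightarrow> l x y \<cdot> c x F = c y F"
    using lw by simp_all
  have "directed_diagram C I w L l"
    unfolding directed_diagram_def
  proof (intro conjI ballI allI impI)
    show "directed_set I w" by (rule linear_order_directed_set[OF lin ne])
    show "L x \<in> Obj C" if "x \<in> I" for x using K(1)[OF that] .
    show "case p of (x, y) \<Rightarrow> l x y \<in> Hom C (L x) (L y)" if "p \<in> w" for p using that l(1) by auto
    show "l x x = \<one> (L x)" if "x \<in> I" for x
      by (rule is_colimitD(3)[OF Lc[OF that] cy[OF W(3)[OF that]]])
        (auto simp: l W(3)[OF that] ide_in_Hom K(1)[OF that] comp_ide_left[OF K(2)[OF that]])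
    show "l y z \<cdot> l x y = l x z" if xy: "(x, y) \<in> w" and yz: "(y, z) \<in> w" for x y z
    proof -
      have x: "x \<in> I" and xz: "(x, z) \<in> w" using W(2) xy transD[OF W(4) xy yz] by auto
      have "(l y z \<cdot> l x y) \<cdot> c x F = c z F" if F: "F \<in> Fpow (B x)" for F
        using comp_assoc[OF K(2)[OF x F] l(1)[OF xy] l(1)[OF yz]] l(2)[OF xy F]
          l(2)[OF yz up[OF xy F]] by simp
      then show ?thesis
        using is_colimitD(3)[OF Lc[OF x] cy[OF xz], of "l y z \<cdot> l x y" "l x z"]
          comp_in_Hom[OF l(1)[OF xy] l(1)[OF yz]] l[OF xz] by auto
    qed
  qed
  then obtain M e where Me: "is_colimit C I w L l M e" using chains by blast
  note E = is_coconeD[OF is_colimitD(1)[OF Me]]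
  have "\<exists>x\<in>I. F \<in> Fpow (B x)" if "F \<in> Fpow ?A" for F
    using finite_subset_chain_Union[where F = F, OF lin ne mono] that by (auto simp: Fpow_def)
  then obtain n where n: "\<And>F. F \<in> Fpow ?A \<Longrightarrow> n F \<in> I" "\<And>F. F \<in> Fpow ?A \<Longrightarrow> F \<in> Fpow (B (n F))"
    by metis
  define d where "d F = e (n F) \<cdot> c (n F) F" for F
  have later: "e x \<cdot> c x F = e y \<cdot> c y F" if xy: "(x, y) \<in> w" and F: "F \<in> Fpow (B x)" for x y F
  proof -
    have x: "x \<in> I" and y: "y \<in> I" using W(2) xy by auto
    show ?thesis using comp_assoc[OF K(2)[OF x F] l(1)[OF xy] E(2)[OF y]] E(3)[OF xy] l(2)[OF xy F]
      by simp
  qed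
  have d: "d F = e x \<cdot> c x F" if x: "x \<in> I" "F \<in> Fpow (B x)" for x F
  proof -
    have F: "F \<in> Fpow ?A" using sub x by blast
    obtain k where k: "(n F, k) \<in> w" "(x, k) \<in> w" using W(5)[OF n(1)[OF F] x(1)] by blast
    show ?thesis unfolding d_def using later[OF k(1) n(2)[OF F]] later[OF k(2) x(2)] by simp
  qed
  have "is_colimit C (Fpow ?A) (incl (Fpow ?A)) X f M d"
  proof (rule is_colimitI)
    have "d G \<cdot> f F G = d F" if FG: "F \<in> Fpow ?A" "G \<in> Fpow ?A" "F \<subseteq> G" for F G
    proof -
      have x: "n G \<in> I" and G: "G \<in> Fpow (B (n G))" using n[OF FG(2)] by auto
      have F: "F \<in> Fpow (B (n G))" using G FG(3) FG(1) by (auto simp: Fpow_def)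
      have "d G \<cdot> f F G = e (n G) \<cdot> (c (n G) G \<cdot> f F G)"
        unfolding d_def using D(3) FG by (intro comp_assoc[OF _ K(2)[OF x G] E(2)[OF x]]) auto
      also have "\<dots> = d F" using K(3)[OF x, of F G] F G FG d[OF x F] by simp
      finally show ?thesis .
    qed
    moreover have "d F \<in> Hom C (X F) M" if "F \<in> Fpow ?A" for F
      unfolding d_def using comp_in_Hom[OF K(2)[OF n[OF that]] E(2)[OF n(1)[OF that]]] .
    ultimately show "is_cocone C (Fpow ?A) (incl (Fpow ?A)) X f M d"
      using E(1) by (auto simp: is_cocone_def)
    fix Y g assume g: "is_cocone C (Fpow ?A) (incl (Fpow ?A)) X f Y g"
    note G = is_coconeD[OF g]
    have gx: "is_cocone C (Fpow (B x)) (incl (Fpow (B x))) X f Y g" if "x \<in> I" for x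
      using G sub[OF that] by (intro restrict[OF that]) auto
    obtain v where v: "\<And>x. x \<in> I \<Longrightarrow> v x \<in> Hom C (L x) Y"
      "\<And>x F. x \<in> I \<Longrightarrow> F \<in> Fpow (B x) \<Longrightarrow> v x \<cdot> c x F = g F"
      using is_colimitD(2)[OF Lc gx] by metis
    have vc: "is_cocone C I w L l Y v"
    proof -
      have "v y \<cdot> l x y = v x" if xy: "(x, y) \<in> w" for x y
      proof (rule is_colimitD(3)[OF Lc gx])
        show x: "x \<in> I" "x \<in> I" using W(2) xy by auto
        have y: "y \<in> I" using W(2) xy by auto
        show "v y \<cdot> l x y \<in> Hom C (L x) Y" "v x \<in> Hom C (L x) Y"
          using comp_in_Hom[OF l(1)[OF xy] v(1)[OF y]] v(1)[OF x(1)] by auto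
        fix F assume F: "F \<in> Fpow (B x)"
        show "(v y \<cdot> l x y) \<cdot> c x F = g F" "v x \<cdot> c x F = g F"
          using comp_assoc[OF K(2)[OF x(1) F] l(1)[OF xy] v(1)[OF y]] l(2)[OF xy F]
            v(2)[OF y up[OF xy F]] v(2)[OF x(1) F] by auto
      qed
      then show ?thesis using G(1) v(1) by (auto simp: is_cocone_def)
    qed
    have Fn: "u \<cdot> d F = (u \<cdot> e x) \<cdot> c x F" if "u \<in> Hom C M Y" "x \<in> I" "F \<in> Fpow (B x)" for u x F
      using comp_assoc[OF K(2)[OF that(2,3)] E(2)[OF that(2)] that(1)] d[OF that(2,3)] by simp
    show "\<exists>u\<in>Hom C M Y. \<forall>F\<in>Fpow ?A. u \<cdot> d F = g F"
    proof -
      obtain u where u: "u \<in> Hom C M Y" "\<And>x. x \<in> I \<Longrightarrow> u \<cdot> e x = v x"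
        using is_colimitD(2)[OF Me vc] by blast
      then have "u \<cdot> d F = g F" if "F \<in> Fpow ?A" for F
        using Fn[OF u(1) n[OF that]] n[OF that] v(2) by auto
      then show ?thesis using u(1) by blast
    qed
    \<comment> \<open>Uniqueness is used twice: at each stage \<open>L x\<close> to identify
      \<open>u \<cdot> e x\<close> with \<open>v x\<close>, then at \<open>M\<close> to identify
      \<open>u\<close>.\<close>
    have determined: "u \<cdot> e x = v x"
      if u: "u \<in> Hom C M Y" "\<And>F. F \<in> Fpow ?A \<Longrightarrow> u \<cdot> d F = g F" and x: "x \<in> I" for u x
      using is_colimitD(3)[OF Lc[OF x] gx[OF x], of "u \<cdot> e x" "v x"]
        comp_in_Hom[OF E(2)[OF x] u(1)] v x Fn[OF u(1) x] u(2) sub[OF x] by auto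
    fix u u' assume "u \<in> Hom C M Y" "u' \<in> Hom C M Y"
      "\<And>F. F \<in> Fpow ?A \<Longrightarrow> u \<cdot> d F = g F" "\<And>F. F \<in> Fpow ?A \<Longrightarrow> u' \<cdot> d F = g F"
    then show "u = u'" using is_colimitD(3)[OF Me vc, of u u'] determined by blast
  qed
  then show "\<exists>L c. is_colimit C (Fpow ?A) (incl (Fpow ?A)) X f L c" by blast
qed

lemma Fpow_cocomplete_UNIV:
  assumes chains: "\<And>(I :: 'j set) w X f. linear_order_on I w \<Longrightarrow> directed_diagram C I w X f \<Longrightarrow>
    \<exists>L c. is_colimit C I w X f L c"
  shows "Fpow_cocomplete (UNIV :: 'j set)"
proof -
  obtain w :: "'j rel" where w: "well_order_on UNIV w" using well_order_on by blast
  have lin: "linear_order_on UNIV w" and wf: "wf (w - Id)"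
    using w by (auto simp: well_order_on_def)
  have refl: "(x, x) \<in> w" for x
    using lin by (auto simp: linear_order_on_def partial_order_on_def preorder_on_def refl_on_def)
  have trans: "trans w"
    using lin by (auto simp: linear_order_on_def partial_order_on_def preorder_on_def)
  have step: "Fpow_cocomplete (\<Union>x\<in>I. {y. (y, x) \<in> w})"
    if "\<And>x. x \<in> I \<Longrightarrow> Fpow_cocomplete {y. (y, x) \<in> w}" for I
  proof (cases "I = {}")
    case True
    then show ?thesis using Fpow_cocomplete_empty by simp
  next
    case False
    let ?w = "w \<inter> I \<times> I"
    have linI: "linear_order_on I ?w"
      by (rule linear_order_on_restrict[OF lin subset_UNIV])
    show ?thesis
      by (rule Fpow_cocomplete_Union[OF chains[OF linI] linI False _ that])
        (auto intro: transD[OF trans])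
  qed
  have "Fpow_cocomplete {y. (y, x) \<in> w}" for x
    using wf
  proof (induction x rule: wf_induct_rule)
    case (less x)
    \<comment> \<open>The strict segment below \<open>x\<close> is a union of closed segments
      whether or not it has a top, so successor and limit stages are one case; at the least element
      the union is empty.\<close>
    have "(\<Union>y\<in>{y. (y, x) \<in> w - Id}. {z. (z, y) \<in> w}) = {y. (y, x) \<in> w - Id}"
    proof -
      have "z \<noteq> x" if "(z, y) \<in> w" "(y, x) \<in> w" "y \<noteq> x" for y z
        using that lin by (auto simp: linear_order_on_def partial_order_on_def antisym_def)
      then show ?thesis using refl transD[OF trans] by (auto intro: transD[OF trans])
    qed
    moreover have "{y. (y, x) \<in> w} = insert x {y. (y, x) \<in> w - Id}" using refl by auto
    ultimately show ?case using Fpow_cocomplete_insert step[of "{y. (y, x) \<in> w - Id}"] less by auto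
  qed
  moreover have "(\<Union>x\<in>UNIV. {y. (y, x) \<in> w}) = UNIV" using refl by auto
  ultimately show ?thesis using step[of UNIV] by simp
qed

end

section \<open>Monotone upper bounds and the passage to arbitrary directed sets\<close>

text \<open>Upper bounds picked separately for each finite set would not be monotone. Recursion
  along strict inclusion puts \<open>m F\<close> above the finitely many earlier values as well.
  Elements outside \<open>J\<close> impose no condition, so that \<open>m\<close> is defined on all
  finite subsets of the type.\<close>

lemma ex_monotone_upper_bound:
  fixes J :: "'a set"
  assumes S: "directed_set J r"
  shows "\<exists>m. \<forall>F. finite F \<longrightarrow> m F \<in> J \<and> (\<forall>x\<in>F \<inter> J. (x, m F) \<in> r) \<and> (\<forall>G. G \<subset> F \<longrightarrow> (m G, m F) \<in> r)"
proof (rule dependent_wf_choice[where P = "\<lambda>m F k. finite F \<longrightarrow>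
      k \<in> J \<and> (\<forall>x\<in>F \<inter> J. (x, k) \<in> r) \<and> (\<forall>G. G \<subset> F \<longrightarrow> (m G, k) \<in> r)", OF wf_finite_psubset])
  fix m F assume IH: "\<And>G. (G, F) \<in> finite_psubset \<Longrightarrow> finite G \<longrightarrow>
      m G \<in> J \<and> (\<forall>x\<in>G \<inter> J. (x, m G) \<in> r) \<and> (\<forall>K. K \<subset> G \<longrightarrow> (m K, m G) \<in> r)"
  show "\<exists>k. finite F \<longrightarrow> k \<in> J \<and> (\<forall>x\<in>F \<inter> J. (x, k) \<in> r) \<and> (\<forall>G. G \<subset> F \<longrightarrow> (m G, k) \<in> r)"
  proof (cases "finite F")
    case True
    have "m G \<in> J" if "G \<subset> F" for G
      using IH[of G] that True finite_subset[of G F] by (auto simp: finite_psubset_def)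
    moreover have "finite {G. G \<subset> F}"
      by (rule finite_subset[of _ "Pow F"]) (use True in auto)
    ultimately obtain k where "k \<in> J" "\<forall>x\<in>(F \<inter> J) \<union> m ` {G. G \<subset> F}. (x, k) \<in> r"
      using finite_directed_upper_bound[OF S, of "(F \<inter> J) \<union> m ` {G. G \<subset> F}"] True by auto
    then show ?thesis by blast
  qed auto
next
  \<comment> \<open>The recursion principle also asks that the requirement on \<open>m F\<close> see
    only the values at smaller sets.\<close>
  fix m m' :: "'a set \<Rightarrow> 'a" and F k
  assume "\<And>G. (G, F) \<in> finite_psubset \<Longrightarrow> m G = m' G"
  then have "finite F \<Longrightarrow> G \<subset> F \<Longrightarrow> m G = m' G" for G by (simp add: finite_psubset_def)
  then show "(finite F \<longrightarrow> k \<in> J \<and> (\<forall>x\<in>F \<inter> J. (x, k) \<in> r) \<and> (\<forall>G. G \<subset> F \<longrightarrow> (m G, k) \<in> r)) =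
    (finite F \<longrightarrow> k \<in> J \<and> (\<forall>x\<in>F \<inter> J. (x, k) \<in> r) \<and> (\<forall>G. G \<subset> F \<longrightarrow> (m' G, k) \<in> r))"
    by (cases "finite F") simp_all
qed

text \<open>Singletons make \<open>m\<close> cofinal, since \<open>m {j}\<close> lies above
  \<open>j\<close>. All chains met on the way are subsets of a well-ordered \<open>'j\<close>, so
  the hypothesis on chains never leaves the universe.\<close>

theorem (in category) directed_colimits_from_chains:
  assumes chains: "\<And>(I :: 'j set) w X f. linear_order_on I w \<Longrightarrow> directed_diagram C I w X f \<Longrightarrow>
    \<exists>L c. is_colimit C I w X f L c"
  shows "has_directed_colimits TYPE('j) C"
  unfolding has_directed_colimits_def
proof (intro allI impI)
  fix J :: "'j set" and r X f assume dd: "directed_diagram C J r X f"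
  note D = directed_diagramD[OF dd] and S = directed_setD[OF directed_diagramD(1)[OF dd]]
  obtain m where m0: "\<forall>F. finite F \<longrightarrow>
      m F \<in> J \<and> (\<forall>x\<in>F \<inter> J. (x, m F) \<in> r) \<and> (\<forall>G. G \<subset> F \<longrightarrow> (m G, m F) \<in> r)"
    using ex_monotone_upper_bound[OF D(1)] by (elim exE)
  have m: "\<And>F. finite F \<Longrightarrow> m F \<in> J" "\<And>F x. finite F \<Longrightarrow> x \<in> F \<inter> J \<Longrightarrow> (x, m F) \<in> r"
    "\<And>F G. finite F \<Longrightarrow> G \<subset> F \<Longrightarrow> (m G, m F) \<in> r"
    using m0 by simp_all
  have m1: "\<And>F. F \<in> Fpow UNIV \<Longrightarrow> m F \<in> J"
    and m2: "\<And>F G. (F, G) \<in> incl (Fpow UNIV) \<Longrightarrow> (m F, m G) \<in> r"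
    using m(1) S(3) m(3) by (auto simp: Fpow_def)
  have cof: "\<exists>F\<in>Fpow UNIV. (j, m F) \<in> r" if "j \<in> J" for j
    using m(2)[of "{j}" j] that by (intro bexI[of _ "{j}"]) (auto simp: Fpow_def)
  obtain L c where "is_colimit C (Fpow UNIV) (incl (Fpow UNIV)) (\<lambda>F. X (m F)) (\<lambda>F G. f (m F) (m G)) L c"
    using Fpow_cocomplete_UNIV[OF chains, unfolded Fpow_cocomplete_def]
      directed_diagram_reindex[where m = m, OF dd directed_set_Fpow m1 m2] by blast
  from colimit_cofinal[OF dd directed_set_Fpow m1 m2 cof this]
  show "\<exists>L c. is_colimit C J r X f L c" by blast
qed

text \<open>Finite sets are images of lists, and the lists of each length are no more numerous than
  an infinite \<open>'j\<close>. Infinity is essential: a finite type has more subsets than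
  elements.\<close>

lemma ex_inj_on_Fpow:
  includes cardinal_syntax
  assumes "infinite (UNIV :: 'j set)"
  shows "\<exists>\<phi> :: 'j set \<Rightarrow> 'j. inj_on \<phi> (Fpow UNIV)"
proof -
  let ?U = "UNIV :: 'j set"
  have "|{xs :: 'j list. length xs = n}| \<le>o |?U|" for n
  proof (induction n)
    case 0
    then show ?case by (simp add: card_of_singl_ordLeq)
  next
    case (Suc n)
    have "{xs :: 'j list. length xs = Suc n} \<subseteq> (\<lambda>(x, xs). x # xs) ` (?U \<times> {xs. length xs = n})"
      by (auto simp: length_Suc_conv image_iff)
    then have "|{xs :: 'j list. length xs = Suc n}| \<le>o |?U \<times> {xs :: 'j list. length xs = n}|"
      by (rule ordLeq_transitive[OF card_of_mono1 card_of_image])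
    also have "|?U \<times> {xs :: 'j list. length xs = n}| \<le>o |?U|"
      by (rule card_of_Sigma_ordLeq_infinite[OF assms ordLeq_refl[OF card_of_Card_order]])
        (use Suc in simp)
    finally show ?case .
  qed
  then have "|\<Union>n\<in>(UNIV :: nat set). {xs :: 'j list. length xs = n}| \<le>o |?U|"
    using assms infinite_iff_card_of_nat[of ?U] by (intro card_of_UNION_ordLeq_infinite) auto
  moreover have "(\<Union>n\<in>(UNIV :: nat set). {xs :: 'j list. length xs = n}) = UNIV" by auto
  ultimately have "|UNIV :: 'j list set| \<le>o |?U|" by simp
  moreover have "Fpow ?U \<subseteq> set ` UNIV" by (auto simp: Fpow_def image_iff dest: finite_list)
  then have "|Fpow ?U| \<le>o |UNIV :: 'j list set|"
    by (rule ordLeq_transitive[OF card_of_mono1 card_of_image])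
  ultimately have "|Fpow ?U| \<le>o |?U|"
    using ordLeq_transitive[of "|Fpow ?U|" "|UNIV :: 'j list set|" "|?U|"] by simp
  then show ?thesis using card_of_ordLeq[of "Fpow ?U" ?U] by auto
qed

section \<open>Arrow calculus in pre-Hilbert *-categories\<close>

context category
begin

lemma HomD:
  assumes "f \<in> Hom C X Y"
  shows "f \<in> Arr C" "Dom C f = X" "Cod C f = Y" "X \<in> Obj C" "Y \<in> Obj C"
  using assms dom_in_Obj cod_in_Obj by (auto simp: Hom_def)

lemma in_Hom: "f \<in> Hom C X Y \<longleftrightarrow> f \<in> Arr C \<and> Dom C f = X \<and> Cod C f = Y"
  by (simp add: Hom_def)

lemma comp_simps [simp]:
  assumes "f \<in> Arr C" "g \<in> Arr C" "Cod C f = Dom C g"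
  shows "g \<cdot> f \<in> Arr C" "Dom C (g \<cdot> f) = Dom C f" "Cod C (g \<cdot> f) = Cod C g"
  using comp_in_Hom[of f "Dom C f" "Cod C f" g "Cod C g"] assms by (auto simp: Hom_def)

lemma assoc [simp]:
  "f \<in> Arr C \<Longrightarrow> g \<in> Arr C \<Longrightarrow> h \<in> Arr C \<Longrightarrow> Cod C f = Dom C g \<Longrightarrow> Cod C g = Dom C h \<Longrightarrow>
    (h \<cdot> g) \<cdot> f = h \<cdot> (g \<cdot> f)"
  using comp_assoc[of f "Dom C f" "Cod C f" g "Cod C g" h "Cod C h"] by (auto simp: Hom_def)

lemma ide_simps [simp]:
  assumes "X \<in> Obj C"
  shows "\<one> X \<in> Arr C" "Dom C (\<one> X) = X" "Cod C (\<one> X) = X"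
  using ide_in_Hom[OF assms] by (auto simp: Hom_def)

lemma comp_ide [simp]:
  assumes "f \<in> Arr C"
  shows "Dom C f = X \<Longrightarrow> f \<cdot> \<one> X = f" "Cod C f = Y \<Longrightarrow> \<one> Y \<cdot> f = f"
  using assms comp_ide_left comp_ide_right by (auto simp: Hom_def)

lemma Dom_Cod_Obj [simp]: "f \<in> Arr C \<Longrightarrow> Dom C f \<in> Obj C" "f \<in> Arr C \<Longrightarrow> Cod C f \<in> Obj C"
  using dom_in_Obj cod_in_Obj by auto

text \<open>Composites are kept nested to the right, where the left side of
  \<open>h \<cdot> g = k\<close> is hidden as soon as an arrow follows. This form applies such an
  equation inside a longer composite.\<close>

lemma comp_reassoc:
  assumes "h \<cdot> g = k" "f \<in> Arr C" "g \<in> Arr C" "h \<in> Arr C" "Cod C f = Dom C g" "Cod C g = Dom C h"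
  shows "h \<cdot> (g \<cdot> f) = k \<cdot> f"
  using assms by (metis assoc)

end

context star_category
begin

lemma star_simps [simp]:
  assumes "f \<in> Arr C"
  shows "f\<^sup>\<star> \<in> Arr C" "Dom C (f\<^sup>\<star>) = Cod C f" "Cod C (f\<^sup>\<star>) = Dom C f" "(f\<^sup>\<star>)\<^sup>\<star> = f"
  using star_in_Hom[of f "Dom C f" "Cod C f"] star_star assms by (auto simp: Hom_def)

lemma star_compose [simp]:
  "f \<in> Arr C \<Longrightarrow> g \<in> Arr C \<Longrightarrow> Cod C f = Dom C g \<Longrightarrow> (g \<cdot> f)\<^sup>\<star> = f\<^sup>\<star> \<cdot> g\<^sup>\<star>"
  using star_comp[of f "Dom C f" "Cod C f" g "Cod C g"] by (auto simp: Hom_def)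

declare star_ide [simp]

lemma star_eq_iff: "f \<in> Arr C \<Longrightarrow> g \<in> Arr C \<Longrightarrow> f\<^sup>\<star> = g\<^sup>\<star> \<longleftrightarrow> f = g"
  by (metis star_star)

lemma isometryD:
  assumes "isometry C u" "u \<in> Hom C X Y"
  shows "u\<^sup>\<star> \<cdot> u = \<one> X" "\<And>x. x \<in> Arr C \<Longrightarrow> Cod C x = X \<Longrightarrow> u\<^sup>\<star> \<cdot> (u \<cdot> x) = x"
proof -
  note [simp] = HomD[OF assms(2)]
  show u: "u\<^sup>\<star> \<cdot> u = \<one> X" using assms(1) by (simp add: isometry_def)
  show "u\<^sup>\<star> \<cdot> (u \<cdot> x) = x" if "x \<in> Arr C" "Cod C x = X" for x
    using comp_reassoc[OF u, of x] that by simp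
qed

lemma isometryI: "u \<in> Hom C X Y \<Longrightarrow> u\<^sup>\<star> \<cdot> u = \<one> X \<Longrightarrow> isometry C u"
  by (auto simp: isometry_def Hom_def)

lemma isometry_ide: "X \<in> Obj C \<Longrightarrow> isometry C (\<one> X)"
  by (simp add: isometry_def)

lemma isometry_comp:
  assumes "isometry C f" "isometry C g" "f \<in> Hom C X Y" "g \<in> Hom C Y Z"
  shows "isometry C (g \<cdot> f)"
proof -
  note [simp] = HomD[OF assms(3)] HomD[OF assms(4)] isometryD[OF assms(1,3)] isometryD[OF assms(2,4)]
  show ?thesis by (rule isometryI[of _ X Z]) (simp_all add: in_Hom)
qed

end

context pre_hilbert_category
begin

abbreviation zero ("\<zero>") where "\<zero> \<equiv> zero_arr C"
abbreviation plus (infixl "\<oplus>" 65) where "f \<oplus> g \<equiv> plus_arr C f g"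

lemma is_zero_objectD:
  assumes "is_zero_object C Z" "X \<in> Obj C"
  shows "\<exists>f. f \<in> Hom C X Z" "\<exists>f. f \<in> Hom C Z X"
    "\<And>f g. f \<in> Hom C X Z \<Longrightarrow> g \<in> Hom C X Z \<Longrightarrow> f = g"
    "\<And>f g. f \<in> Hom C Z X \<Longrightarrow> g \<in> Hom C Z X \<Longrightarrow> f = g"
  using assms unfolding is_zero_object_def by auto

text \<open>Two zero objects are compared by \<open>w\<close>, which commutes with the arrows into
  and out of them; hence the description in \<open>zero_arr\<close> denotes one arrow.\<close>

lemma zero_arr_eq:
  assumes Z: "is_zero_object C Z" and s: "s \<in> Hom C X Z" and t: "t \<in> Hom C Z Y"
  shows "\<zero> X Y = t \<cdot> s"
  unfolding zero_arr_def
proof (rule the_equality)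
  show "\<exists>Z s' t'. is_zero_object C Z \<and> s' \<in> Hom C X Z \<and> t' \<in> Hom C Z Y \<and> t \<cdot> s = t' \<cdot> s'"
    using assms by blast
  note [simp] = HomD[OF s] HomD[OF t]
  fix f assume "\<exists>Z s t. is_zero_object C Z \<and> s \<in> Hom C X Z \<and> t \<in> Hom C Z Y \<and> f = t \<cdot> s"
  then obtain Z' s' t' where Z': "is_zero_object C Z'" and s': "s' \<in> Hom C X Z'"
    and t': "t' \<in> Hom C Z' Y" and f: "f = t' \<cdot> s'" by blast
  note [simp] = HomD[OF s'] HomD[OF t']
  obtain w where w: "w \<in> Hom C Z Z'" using is_zero_objectD(2)[OF Z HomD(4)[OF t']] by blast
  note [simp] = HomD[OF w]
  have "w \<cdot> s = s'"
  proof -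
    have "w \<cdot> s \<in> Hom C X Z'" by (simp add: in_Hom)
    then show ?thesis using is_zero_objectD(3)[OF Z' HomD(4)[OF s]] s' by blast
  qed
  moreover have "t' \<cdot> w = t"
  proof -
    have "t' \<cdot> w \<in> Hom C Z Y" by (simp add: in_Hom)
    then show ?thesis using is_zero_objectD(4)[OF Z HomD(5)[OF t]] t by blast
  qed
  ultimately show "f = t \<cdot> s" unfolding f using assoc[of s w t'] by simp
qed

lemma zero_factors:
  assumes "X \<in> Obj C" "Y \<in> Obj C"
  shows "\<exists>Z s t. is_zero_object C Z \<and> s \<in> Hom C X Z \<and> t \<in> Hom C Z Y \<and> \<zero> X Y = t \<cdot> s"
proof -
  obtain Z where Z: "is_zero_object C Z" using ex_zero_object by blast
  obtain s t where "s \<in> Hom C X Z" "t \<in> Hom C Z Y"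
    using is_zero_objectD(1)[OF Z assms(1)] is_zero_objectD(2)[OF Z assms(2)] by blast
  then show ?thesis using Z zero_arr_eq[OF Z] by blast
qed

lemma zero_simps [simp]:
  assumes "X \<in> Obj C" "Y \<in> Obj C"
  shows "\<zero> X Y \<in> Arr C" "Dom C (\<zero> X Y) = X" "Cod C (\<zero> X Y) = Y" "(\<zero> X Y)\<^sup>\<star> = \<zero> Y X"
proof -
  obtain Z s t where Z: "is_zero_object C Z" "s \<in> Hom C X Z" "t \<in> Hom C Z Y" "\<zero> X Y = t \<cdot> s"
    using zero_factors[OF assms] by blast
  note [simp] = HomD[OF Z(2)] HomD[OF Z(3)]
  show "\<zero> X Y \<in> Arr C" "Dom C (\<zero> X Y) = X" "Cod C (\<zero> X Y) = Y" using Z(4) by auto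
  have "\<zero> Y X = s\<^sup>\<star> \<cdot> t\<^sup>\<star>" by (rule zero_arr_eq[OF Z(1)]) (simp_all add: in_Hom)
  then show "(\<zero> X Y)\<^sup>\<star> = \<zero> Y X" using Z(4) by simp
qed

lemma comp_zero [simp]:
  assumes "f \<in> Arr C"
  shows "W \<in> Obj C \<Longrightarrow> X = Dom C f \<Longrightarrow> f \<cdot> \<zero> W X = \<zero> W (Cod C f)"
    and "W \<in> Obj C \<Longrightarrow> X = Cod C f \<Longrightarrow> \<zero> X W \<cdot> f = \<zero> (Dom C f) W"
proof -
  note [simp] = assms
  show "f \<cdot> \<zero> W X = \<zero> W (Cod C f)" if h: "W \<in> Obj C" "X = Dom C f"
  proof -
    obtain Z s t where Z: "is_zero_object C Z" "s \<in> Hom C W Z" "t \<in> Hom C Z X" "\<zero> W X = t \<cdot> s"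
      using zero_factors[of W X] h by auto
    note [simp] = HomD[OF Z(2)] HomD[OF Z(3)]
    have "\<zero> W (Cod C f) = (f \<cdot> t) \<cdot> s"
      by (rule zero_arr_eq[OF Z(1)]) (simp_all add: in_Hom h(2)[symmetric])
    then show ?thesis using Z(4) h(2) by simp
  qed
  show "\<zero> X W \<cdot> f = \<zero> (Dom C f) W" if h: "W \<in> Obj C" "X = Cod C f"
  proof -
    obtain Z s t where Z: "is_zero_object C Z" "s \<in> Hom C X Z" "t \<in> Hom C Z W" "\<zero> X W = t \<cdot> s"
      using zero_factors[of X W] h by auto
    note [simp] = HomD[OF Z(2)] HomD[OF Z(3)]
    have "\<zero> (Dom C f) W = t \<cdot> (s \<cdot> f)"
      by (rule zero_arr_eq[OF Z(1)]) (simp_all add: in_Hom h(2)[symmetric])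
    then show ?thesis using Z(4) h(2) by simp
  qed
qed

lemma biproductD:
  assumes "orthonormal_product C X Y P r s"
  shows "r \<in> Hom C P X" "s \<in> Hom C P Y"
    "r \<in> Arr C" "s \<in> Arr C" "Dom C r = P" "Dom C s = P" "Cod C r = X" "Cod C s = Y"
    "X \<in> Obj C" "Y \<in> Obj C" "P \<in> Obj C"
    "r \<cdot> r\<^sup>\<star> = \<one> X" "s \<cdot> s\<^sup>\<star> = \<one> Y" "r \<cdot> s\<^sup>\<star> = \<zero> Y X" "s \<cdot> r\<^sup>\<star> = \<zero> X Y"
    "\<And>x. x \<in> Arr C \<Longrightarrow> Cod C x = X \<Longrightarrow> r \<cdot> (r\<^sup>\<star> \<cdot> x) = x"
    "\<And>x. x \<in> Arr C \<Longrightarrow> Cod C x = Y \<Longrightarrow> s \<cdot> (s\<^sup>\<star> \<cdot> x) = x"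
    "\<And>x. x \<in> Arr C \<Longrightarrow> Cod C x = X \<Longrightarrow> s \<cdot> (r\<^sup>\<star> \<cdot> x) = \<zero> (Dom C x) Y"
    "\<And>x. x \<in> Arr C \<Longrightarrow> Cod C x = Y \<Longrightarrow> r \<cdot> (s\<^sup>\<star> \<cdot> x) = \<zero> (Dom C x) X"
proof -
  show r: "r \<in> Hom C P X" and s: "s \<in> Hom C P Y"
    using assms by (auto simp: orthonormal_product_def is_product_def)
  note [simp] = HomD[OF r] HomD[OF s]
  show "r \<in> Arr C" "s \<in> Arr C" "Dom C r = P" "Dom C s = P" "Cod C r = X" "Cod C s = Y"
    "X \<in> Obj C" "Y \<in> Obj C" "P \<in> Obj C" by simp_all
  show e: "r \<cdot> r\<^sup>\<star> = \<one> X" "s \<cdot> s\<^sup>\<star> = \<one> Y" "r \<cdot> s\<^sup>\<star> = \<zero> Y X"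
    using assms by (auto simp: orthonormal_product_def coisometry_def)
  have "(r \<cdot> s\<^sup>\<star>)\<^sup>\<star> = \<zero> X Y" by (simp only: e) simp
  then show e': "s \<cdot> r\<^sup>\<star> = \<zero> X Y" by simp
  fix x assume "x \<in> Arr C"
  note [simp] = this
  show "r \<cdot> (r\<^sup>\<star> \<cdot> x) = x" if "Cod C x = X" using comp_reassoc[OF e(1), of x] that by simp
  show "s \<cdot> (s\<^sup>\<star> \<cdot> x) = x" if "Cod C x = Y" using comp_reassoc[OF e(2), of x] that by simp
  show "s \<cdot> (r\<^sup>\<star> \<cdot> x) = \<zero> (Dom C x) Y" if "Cod C x = X" using comp_reassoc[OF e', of x] that by simp
  show "r \<cdot> (s\<^sup>\<star> \<cdot> x) = \<zero> (Dom C x) X" if "Cod C x = Y" using comp_reassoc[OF e(3), of x] that by simp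
qed

lemma ex_pairing:
  assumes "orthonormal_product C X Y P r s" "f \<in> Hom C W X" "g \<in> Hom C W Y"
  shows "\<exists>u\<in>Hom C W P. r \<cdot> u = f \<and> s \<cdot> u = g"
  using assms HomD(4)[OF assms(2)] unfolding orthonormal_product_def is_product_def by blast

lemma product_ext:
  assumes P: "orthonormal_product C X Y P r s" and "u \<in> Hom C W P" "v \<in> Hom C W P"
    and "r \<cdot> u = r \<cdot> v" "s \<cdot> u = s \<cdot> v"
  shows "u = v"
proof -
  have "r \<cdot> v \<in> Hom C W X" "s \<cdot> v \<in> Hom C W Y" "W \<in> Obj C"
    using comp_in_Hom[OF assms(3)] biproductD(1,2)[OF P] HomD(4)[OF assms(3)] by auto
  then show ?thesis using assms unfolding orthonormal_product_def is_product_def by blast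
qed

text \<open>The adjoints \<open>r\<^sup>\<star>\<close> and \<open>s\<^sup>\<star>\<close> are
  coprojections, because the involution turns \<open>product_ext\<close> into this
  statement.\<close>

lemma coproduct_ext:
  assumes P: "orthonormal_product C X Y P r s" and u: "u \<in> Hom C P W" and v: "v \<in> Hom C P W"
    and "u \<cdot> r\<^sup>\<star> = v \<cdot> r\<^sup>\<star>" "u \<cdot> s\<^sup>\<star> = v \<cdot> s\<^sup>\<star>"
  shows "u = v"
proof -
  note [simp] = biproductD[OF P] HomD[OF u] HomD[OF v]
  have "r \<cdot> u\<^sup>\<star> = r \<cdot> v\<^sup>\<star>" "s \<cdot> u\<^sup>\<star> = s \<cdot> v\<^sup>\<star>"
    using arg_cong[OF assms(4), of "Star C"] arg_cong[OF assms(5), of "Star C"] by simp_all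
  then have "u\<^sup>\<star> = v\<^sup>\<star>" using product_ext[OF P, of "u\<^sup>\<star>" W "v\<^sup>\<star>"] by (simp add: in_Hom)
  then show ?thesis by (simp add: star_eq_iff)
qed

lemma diagonal_star:
  assumes "is_diagonal C X P r s d"
  shows "orthonormal_product C X X P r s" "d \<in> Hom C X P" "d\<^sup>\<star> \<cdot> r\<^sup>\<star> = \<one> X" "d\<^sup>\<star> \<cdot> s\<^sup>\<star> = \<one> X"
    "r \<cdot> d = \<one> X" "s \<cdot> d = \<one> X"
    "\<And>x. x \<in> Arr C \<Longrightarrow> Cod C x = X \<Longrightarrow> d\<^sup>\<star> \<cdot> (r\<^sup>\<star> \<cdot> x) = x"
    "\<And>x. x \<in> Arr C \<Longrightarrow> Cod C x = X \<Longrightarrow> d\<^sup>\<star> \<cdot> (s\<^sup>\<star> \<cdot> x) = x"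
    "\<And>x. x \<in> Arr C \<Longrightarrow> Cod C x = X \<Longrightarrow> r \<cdot> (d \<cdot> x) = x"
    "\<And>x. x \<in> Arr C \<Longrightarrow> Cod C x = X \<Longrightarrow> s \<cdot> (d \<cdot> x) = x"
proof -
  show P: "orthonormal_product C X X P r s" and d: "d \<in> Hom C X P"
    and e': "r \<cdot> d = \<one> X" "s \<cdot> d = \<one> X"
    using assms by (simp_all add: is_diagonal_def)
  note [simp] = biproductD[OF P] HomD[OF d]
  have "(r \<cdot> d)\<^sup>\<star> = \<one> X" "(s \<cdot> d)\<^sup>\<star> = \<one> X" by (simp_all only: e') simp_all
  then show e: "d\<^sup>\<star> \<cdot> r\<^sup>\<star> = \<one> X" "d\<^sup>\<star> \<cdot> s\<^sup>\<star> = \<one> X" by simp_all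
  fix x assume x: "x \<in> Arr C" "Cod C x = X"
  show "d\<^sup>\<star> \<cdot> (r\<^sup>\<star> \<cdot> x) = x" using comp_reassoc[OF e(1), of x] x by simp
  show "d\<^sup>\<star> \<cdot> (s\<^sup>\<star> \<cdot> x) = x" using comp_reassoc[OF e(2), of x] x by simp
  show "r \<cdot> (d \<cdot> x) = x" using comp_reassoc[OF e'(1), of x] x by simp
  show "s \<cdot> (d \<cdot> x) = x" using comp_reassoc[OF e'(2), of x] x by simp
qed

lemma ex_diagonal:
  assumes "X \<in> Obj C"
  shows "\<exists>P r s d. is_diagonal C X P r s d"
proof -
  obtain P r s where P: "orthonormal_product C X X P r s" using ex_orthonormal_product assms by blast
  then show ?thesis using ex_pairing[OF P ide_in_Hom ide_in_Hom] assms
    unfolding is_diagonal_def by blast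
qed

text \<open>Independence of the chosen product. The comparison \<open>\<phi>\<close> of two products
  carries coprojections to coprojections, which is where orthonormality enters, and therefore
  respects the codiagonals.\<close>

lemma plus_eq:
  assumes d: "is_diagonal C Y P r s d" and u: "u \<in> Hom C X P"
  shows "(r \<cdot> u) \<oplus> (s \<cdot> u) = d\<^sup>\<star> \<cdot> u"
  unfolding plus_arr_def
proof (rule the_equality)
  note P = diagonal_star(1)[OF d]
  note [simp] = diagonal_star(3-)[OF d] HomD[OF diagonal_star(2)[OF d]] HomD[OF u] biproductD[OF P]
  show "\<exists>P' r' s' d' u'. is_diagonal C (Cod C (r \<cdot> u)) P' r' s' d' \<and> u' \<in> Hom C (Dom C (r \<cdot> u)) P' \<and>
      r' \<cdot> u' = r \<cdot> u \<and> s' \<cdot> u' = s \<cdot> u \<and> d\<^sup>\<star> \<cdot> u = d'\<^sup>\<star> \<cdot> u'"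
    by (intro exI[of _ P] exI[of _ r] exI[of _ s] exI[of _ d] exI[of _ u]) (use d u in simp)
  fix z assume "\<exists>P' r' s' d' u'. is_diagonal C (Cod C (r \<cdot> u)) P' r' s' d' \<and>
      u' \<in> Hom C (Dom C (r \<cdot> u)) P' \<and> r' \<cdot> u' = r \<cdot> u \<and> s' \<cdot> u' = s \<cdot> u \<and> z = d'\<^sup>\<star> \<cdot> u'"
  then obtain P' r' s' d' u' where d': "is_diagonal C Y P' r' s' d'" and u': "u' \<in> Hom C X P'"
    and eq: "r' \<cdot> u' = r \<cdot> u" "s' \<cdot> u' = s \<cdot> u" "z = d'\<^sup>\<star> \<cdot> u'" by auto
  note P' = diagonal_star(1)[OF d']
  note [simp] = diagonal_star(3-)[OF d'] HomD[OF diagonal_star(2)[OF d']] HomD[OF u'] biproductD[OF P']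
  obtain \<phi> where \<phi>: "\<phi> \<in> Hom C P P'" "r' \<cdot> \<phi> = r" "s' \<cdot> \<phi> = s"
    using ex_pairing[OF P' biproductD(1,2)[OF P]] by blast
  note [simp] = HomD[OF \<phi>(1)]
  have ru: "r' \<cdot> (\<phi> \<cdot> x) = r \<cdot> x" "s' \<cdot> (\<phi> \<cdot> x) = s \<cdot> x" if "x \<in> Arr C" "Cod C x = P" for x
    using \<phi> that comp_reassoc[of r' \<phi> r x] comp_reassoc[of s' \<phi> s x] by simp_all
  have u'eq: "u' = \<phi> \<cdot> u"
    by (rule product_ext[OF P', of _ X]) (simp_all add: in_Hom ru eq)
  have \<phi>r: "\<phi> \<cdot> r\<^sup>\<star> = r'\<^sup>\<star>"
    by (rule product_ext[OF P', of _ Y]) (simp_all add: in_Hom ru)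
  have \<phi>s: "\<phi> \<cdot> s\<^sup>\<star> = s'\<^sup>\<star>"
    by (rule product_ext[OF P', of _ Y]) (simp_all add: in_Hom ru)
  have e: "d'\<^sup>\<star> \<cdot> \<phi> = d\<^sup>\<star>"
    by (rule coproduct_ext[OF P, of _ Y]) (simp_all add: in_Hom \<phi>r \<phi>s)
  show "z = d\<^sup>\<star> \<cdot> u" unfolding eq(3) u'eq using comp_reassoc[OF e, of u] by simp
qed

lemma plus_in_Hom:
  assumes "f \<in> Hom C X Y" "g \<in> Hom C X Y"
  shows "f \<oplus> g \<in> Hom C X Y"
proof -
  note [simp] = HomD[OF assms(1)] HomD[OF assms(2)]
  obtain P r s d where d: "is_diagonal C Y P r s d" using ex_diagonal[of Y] by auto
  note P = diagonal_star(1)[OF d]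
  obtain u where u: "u \<in> Hom C X P" "r \<cdot> u = f" "s \<cdot> u = g" using ex_pairing[OF P assms] by blast
  note [simp] = HomD[OF diagonal_star(2)[OF d]] HomD[OF u(1)]
  show ?thesis using plus_eq[OF d u(1)] u by (simp add: in_Hom)
qed

lemma plus_simps [simp]:
  assumes "f \<in> Arr C" "g \<in> Arr C" "Dom C f = Dom C g" "Cod C f = Cod C g"
  shows "f \<oplus> g \<in> Arr C" "Dom C (f \<oplus> g) = Dom C g" "Cod C (f \<oplus> g) = Cod C g"
  using plus_in_Hom[of f "Dom C g" "Cod C g" g] assms by (auto simp: in_Hom)

lemma plus_comp [simp]:
  assumes "f \<in> Arr C" "g \<in> Arr C" "Dom C f = Dom C g" "Cod C f = Cod C g" "h \<in> Arr C" "Cod C h = Dom C g"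
  shows "(f \<oplus> g) \<cdot> h = f \<cdot> h \<oplus> g \<cdot> h"
proof -
  note [simp] = assms
  obtain P r s d where d: "is_diagonal C (Cod C g) P r s d" using ex_diagonal[of "Cod C g"] by auto
  note P = diagonal_star(1)[OF d]
  obtain u where u: "u \<in> Hom C (Dom C g) P" "r \<cdot> u = f" "s \<cdot> u = g"
    using ex_pairing[OF P, of f "Dom C g" g] by (auto simp: in_Hom)
  note [simp] = HomD[OF diagonal_star(2)[OF d]] HomD[OF u(1)] biproductD[OF P]
  have uh: "u \<cdot> h \<in> Hom C (Dom C h) P" by (simp add: in_Hom)
  have "r \<cdot> (u \<cdot> h) = f \<cdot> h" "s \<cdot> (u \<cdot> h) = g \<cdot> h"
    using comp_reassoc[OF u(2), of h] comp_reassoc[OF u(3), of h] by simp_all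
  moreover have "f \<oplus> g = d\<^sup>\<star> \<cdot> u" using plus_eq[OF d u(1)] u by simp
  ultimately show ?thesis using plus_eq[OF d uh] by simp
qed

text \<open>Naturality of the codiagonal. The arrow \<open>kk\<close> is \<open>k\<close> on both
  summands, and \<open>d'\<^sup>\<star> \<cdot> kk = k \<cdot> d\<^sup>\<star>\<close> is tested on
  coprojections.\<close>

lemma comp_plus [simp]:
  assumes "f \<in> Arr C" "g \<in> Arr C" "Dom C f = Dom C g" "Cod C f = Cod C g" "k \<in> Arr C" "Dom C k = Cod C g"
  shows "k \<cdot> (f \<oplus> g) = k \<cdot> f \<oplus> k \<cdot> g"
proof -
  note [simp] = assms
  obtain P r s d where d: "is_diagonal C (Cod C g) P r s d" using ex_diagonal[of "Cod C g"] by auto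
  obtain P' r' s' d' where d': "is_diagonal C (Cod C k) P' r' s' d'" using ex_diagonal[of "Cod C k"] by auto
  note P = diagonal_star(1)[OF d] and P' = diagonal_star(1)[OF d']
  obtain u where u: "u \<in> Hom C (Dom C g) P" "r \<cdot> u = f" "s \<cdot> u = g"
    using ex_pairing[OF P, of f "Dom C g" g] by (auto simp: in_Hom)
  note [simp] = diagonal_star(3-)[OF d] diagonal_star(3-)[OF d'] HomD[OF diagonal_star(2)[OF d]]
    HomD[OF diagonal_star(2)[OF d']] HomD[OF u(1)] biproductD[OF P] biproductD[OF P']
  obtain kk where kk: "kk \<in> Hom C P P'" "r' \<cdot> kk = k \<cdot> r" "s' \<cdot> kk = k \<cdot> s"
    using ex_pairing[OF P', of "k \<cdot> r" P "k \<cdot> s"] by (auto simp: in_Hom)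
  note [simp] = HomD[OF kk(1)]
  have kkx: "r' \<cdot> (kk \<cdot> x) = k \<cdot> (r \<cdot> x)" "s' \<cdot> (kk \<cdot> x) = k \<cdot> (s \<cdot> x)" if "x \<in> Arr C" "Cod C x = P" for x
    using that comp_reassoc[OF kk(2), of x] comp_reassoc[OF kk(3), of x] by simp_all
  have kku: "kk \<cdot> u \<in> Hom C (Dom C g) P'" by (simp add: in_Hom)
  have kkr: "kk \<cdot> r\<^sup>\<star> = r'\<^sup>\<star> \<cdot> k" "kk \<cdot> s\<^sup>\<star> = s'\<^sup>\<star> \<cdot> k"
    by (rule product_ext[OF P', of _ "Cod C g"]; simp add: in_Hom kkx)+
  have e: "d'\<^sup>\<star> \<cdot> kk = k \<cdot> d\<^sup>\<star>"
    by (rule coproduct_ext[OF P, of _ "Cod C k"]) (simp_all add: in_Hom kkr)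
  have "k \<cdot> (f \<oplus> g) = d'\<^sup>\<star> \<cdot> (kk \<cdot> u)"
    using plus_eq[OF d u(1)] u comp_reassoc[OF e, of u] by simp
  then show ?thesis using plus_eq[OF d' kku] by (simp add: kkx u)
qed

lemma plus_zero [simp]:
  assumes "f \<in> Arr C" "X = Dom C f" "Y = Cod C f"
  shows "f \<oplus> \<zero> X Y = f" "\<zero> X Y \<oplus> f = f"
proof -
  note [simp] = assms
  obtain P r s d where d: "is_diagonal C (Cod C f) P r s d" using ex_diagonal[of "Cod C f"] by auto
  note P = diagonal_star(1)[OF d]
  note [simp] = diagonal_star(3-)[OF d] HomD[OF diagonal_star(2)[OF d]] biproductD[OF P]
  have "r\<^sup>\<star> \<cdot> f \<in> Hom C (Dom C f) P" "s\<^sup>\<star> \<cdot> f \<in> Hom C (Dom C f) P" by (simp_all add: in_Hom)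
  from plus_eq[OF d this(1)] plus_eq[OF d this(2)]
  show "f \<oplus> \<zero> X Y = f" "\<zero> X Y \<oplus> f = f" by simp_all
qed

text \<open>An Eckmann-Hilton argument: the codiagonal is additive by \<open>comp_plus\<close>, and
  sums of pairs are formed componentwise. Setting suitable entries to zero yields commutativity and
  associativity.\<close>

lemma plus_interchange:
  assumes a: "a \<in> Hom C X Y" and b: "b \<in> Hom C X Y" and c: "c \<in> Hom C X Y" and e: "e \<in> Hom C X Y"
  shows "(a \<oplus> b) \<oplus> (c \<oplus> e) = (a \<oplus> c) \<oplus> (b \<oplus> e)"
proof -
  note [simp] = HomD[OF a] HomD[OF b] HomD[OF c] HomD[OF e]
  obtain P r s d where d: "is_diagonal C Y P r s d" using ex_diagonal[of Y] by auto
  note P = diagonal_star(1)[OF d]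
  note [simp] = diagonal_star(3-)[OF d] HomD[OF diagonal_star(2)[OF d]] biproductD[OF P]
  obtain u v where u: "u \<in> Hom C X P" "r \<cdot> u = a" "s \<cdot> u = c" and v: "v \<in> Hom C X P" "r \<cdot> v = b" "s \<cdot> v = e"
    using ex_pairing[OF P a c] ex_pairing[OF P b e] by blast
  note [simp] = HomD[OF u(1)] HomD[OF v(1)]
  have uv: "u \<oplus> v \<in> Hom C X P" by (simp add: in_Hom)
  show ?thesis using plus_eq[OF d uv] plus_eq[OF d u(1)] plus_eq[OF d v(1)] u v by simp
qed

lemma plus_comm:
  assumes "a \<in> Arr C" "b \<in> Arr C" "Dom C a = Dom C b" "Cod C a = Cod C b"
  shows "a \<oplus> b = b \<oplus> a"
  using plus_interchange[of "\<zero> (Dom C a) (Cod C a)" "Dom C a" "Cod C a" a b "\<zero> (Dom C a) (Cod C a)"] assms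
  by (simp add: in_Hom)

lemma plus_assoc:
  assumes "a \<in> Arr C" "b \<in> Arr C" "c \<in> Arr C" "Dom C a = Dom C b" "Cod C a = Cod C b"
    "Dom C b = Dom C c" "Cod C b = Cod C c"
  shows "(a \<oplus> b) \<oplus> c = a \<oplus> (b \<oplus> c)"
  using plus_interchange[of a "Dom C a" "Cod C a" b "\<zero> (Dom C a) (Cod C a)" c] assms
  by (simp add: in_Hom)

text \<open>The diagonal is \<open>r\<^sup>\<star> \<oplus> s\<^sup>\<star>\<close>, so the adjoint
  of \<open>d\<^sup>\<star> \<cdot> u\<close> splits into the adjoints of the components of
  \<open>u\<close>.\<close>

lemma star_plus [simp]:
  assumes "a \<in> Arr C" "b \<in> Arr C" "Dom C a = Dom C b" "Cod C a = Cod C b"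
  shows "(a \<oplus> b)\<^sup>\<star> = a\<^sup>\<star> \<oplus> b\<^sup>\<star>"
proof -
  note [simp] = assms
  obtain P r s d where d: "is_diagonal C (Cod C b) P r s d" using ex_diagonal[of "Cod C b"] by auto
  note P = diagonal_star(1)[OF d]
  obtain u where u: "u \<in> Hom C (Dom C b) P" "r \<cdot> u = a" "s \<cdot> u = b"
    using ex_pairing[OF P, of a "Dom C b" b] by (auto simp: in_Hom)
  note [simp] = diagonal_star(3-)[OF d] HomD[OF diagonal_star(2)[OF d]] biproductD[OF P] HomD[OF u(1)]
  have "d = r\<^sup>\<star> \<oplus> s\<^sup>\<star>" by (rule product_ext[OF P, of _ "Cod C b"]) (simp_all add: in_Hom)
  moreover have "a \<oplus> b = d\<^sup>\<star> \<cdot> u" using plus_eq[OF d u(1)] u by simp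
  then have "(a \<oplus> b)\<^sup>\<star> = u\<^sup>\<star> \<cdot> d" by simp
  ultimately have "(a \<oplus> b)\<^sup>\<star> = u\<^sup>\<star> \<cdot> r\<^sup>\<star> \<oplus> u\<^sup>\<star> \<cdot> s\<^sup>\<star>" by simp
  also have "\<dots> = (r \<cdot> u)\<^sup>\<star> \<oplus> (s \<cdot> u)\<^sup>\<star>" by simp
  finally show ?thesis using u by simp
qed

lemma biproduct_sum:
  assumes P: "orthonormal_product C X Y P r s"
  shows "r\<^sup>\<star> \<cdot> r \<oplus> s\<^sup>\<star> \<cdot> s = \<one> P"
proof -
  note [simp] = biproductD[OF P]
  show ?thesis by (rule product_ext[OF P, of _ P]) (simp_all add: in_Hom)
qed

end

section \<open>Kernels, negatives and positivity\<close>

context pre_hilbert_category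
begin

lemma is_kernel_factors:
  assumes k: "is_kernel C k f" and g: "g \<in> Hom C W (Dom C f)" "f \<cdot> g = \<zero> W (Cod C f)"
  shows "\<exists>h\<in>Hom C W (Dom C k). k \<cdot> h = g"
proof -
  have "\<exists>!h. h \<in> Hom C W (Dom C k) \<and> k \<cdot> h = g"
    using k g HomD(4)[OF g(1)] by (simp add: is_kernel_def)
  then show ?thesis by blast
qed

text \<open>Since \<open>k\<close> is isometric, a factor of \<open>g\<close> through
  \<open>k\<close> can only be \<open>k\<^sup>\<star> \<cdot> g\<close>. The universal property thus
  turns into the equation \<open>k \<cdot> (k\<^sup>\<star> \<cdot> g) = g\<close>.\<close>

lemma ex_kernel:
  assumes f: "f \<in> Hom C X Y"
  shows "\<exists>K k. k \<in> Hom C K X \<and> isometry C k \<and> f \<cdot> k = \<zero> K Y \<and>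
    (\<forall>W g. g \<in> Hom C W X \<longrightarrow> f \<cdot> g = \<zero> W Y \<longrightarrow> k \<cdot> (k\<^sup>\<star> \<cdot> g) = g)"
proof -
  note [simp] = HomD[OF f]
  obtain k where k: "is_kernel C k f" "isometry C k" using ex_isometric_kernel[of f] by auto
  obtain K where K: "Dom C k = K" by blast
  have kh: "k \<in> Hom C K X" and fk: "f \<cdot> k = \<zero> K Y" using k K by (auto simp: is_kernel_def in_Hom)
  note [simp] = HomD[OF kh] isometryD[OF k(2) kh]
  have "k \<cdot> (k\<^sup>\<star> \<cdot> g) = g" if g: "g \<in> Hom C W X" "f \<cdot> g = \<zero> W Y" for W g
  proof -
    note [simp] = HomD[OF g(1)]
    obtain h where h: "h \<in> Hom C W K" "k \<cdot> h = g"
      using is_kernel_factors[OF k(1), of g W] g K by auto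
    note [simp] = HomD[OF h(1)]
    show ?thesis using h(2) by auto
  qed
  then show ?thesis using kh fk k(2) by blast
qed

text \<open>With \<open>n\<close> an isometric kernel of the codiagonal,
  \<open>n\<^sup>\<star>\<close> behaves like a difference map: its components \<open>a\<close> and
  \<open>b\<close> add up to zero. As the diagonal is a kernel, it is the kernel of
  \<open>n\<^sup>\<star>\<close>, which makes \<open>a\<close> monic, and the relations between
  \<open>a\<close> and \<open>b\<close> make \<open>a\<^sup>\<star> \<oplus> a\<^sup>\<star>\<close>
  a right inverse of \<open>a\<close>. Hence \<open>c\<close>, which is \<open>b\<close> divided by
  \<open>a\<close>, is minus the identity.\<close>

lemma ex_negative_ide:
  assumes X: "X \<in> Obj C"
  shows "\<exists>c\<in>Hom C X X. c \<oplus> \<one> X = \<zero> X X"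
proof -
  note [simp] = X
  obtain P r s d where d: "is_diagonal C X P r s d" using ex_diagonal[of X] by auto
  note P = diagonal_star(1)[OF d]
  note [simp] = diagonal_star(3-)[OF d] HomD[OF diagonal_star(2)[OF d]] biproductD[OF P]
  obtain f where f: "is_kernel C d f" using diagonal_is_kernel[OF d] by blast
  have [simp]: "f \<in> Arr C" "Dom C f = P" "f \<cdot> d = \<zero> X (Cod C f)"
    using f by (auto simp: is_kernel_def)
  have ds: "d\<^sup>\<star> \<in> Hom C P X" by (simp add: in_Hom)
  obtain K n where n: "n \<in> Hom C K P" "isometry C n" "d\<^sup>\<star> \<cdot> n = \<zero> K X"
    "\<And>W g. g \<in> Hom C W P \<Longrightarrow> d\<^sup>\<star> \<cdot> g = \<zero> W X \<Longrightarrow> n \<cdot> (n\<^sup>\<star> \<cdot> g) = g"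
    using ex_kernel[OF ds] by blast
  note [simp] = HomD[OF n(1)] isometryD[OF n(2,1)]
  have nd: "n\<^sup>\<star> \<cdot> d = \<zero> X K" using arg_cong[OF n(3), of "Star C"] by simp
  \<comment> \<open>\<open>f\<close> vanishes on \<open>d\<close>, so \<open>f\<^sup>\<star>\<close>
    lies in the kernel of \<open>d\<^sup>\<star>\<close>, giving
    \<open>f = f \<cdot> (n \<cdot> n\<^sup>\<star>)\<close>. Whatever
    \<open>n\<^sup>\<star>\<close> kills is then killed by \<open>f\<close> and factors through
    \<open>d\<close>.\<close>
  have dkern: "\<exists>h\<in>Hom C W X. d \<cdot> h = g" if g: "g \<in> Hom C W P" "n\<^sup>\<star> \<cdot> g = \<zero> W K" for W g
  proof -
    note [simp] = HomD[OF g(1)]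
    have "d\<^sup>\<star> \<cdot> f\<^sup>\<star> = (f \<cdot> d)\<^sup>\<star>" by (simp del: \<open>f \<cdot> d = \<zero> X (Cod C f)\<close>)
    then have nf: "n \<cdot> (n\<^sup>\<star> \<cdot> f\<^sup>\<star>) = f\<^sup>\<star>" by (intro n(4)) (auto simp: in_Hom)
    have "f \<cdot> (n \<cdot> n\<^sup>\<star>) = f" using arg_cong[OF nf, of "Star C"] by simp
    then have "f \<cdot> g = (f \<cdot> (n \<cdot> n\<^sup>\<star>)) \<cdot> g" by (simp only:)
    also have "\<dots> = \<zero> W (Cod C f)" by (simp add: g(2))
    finally show ?thesis using is_kernel_factors[OF f, of g W] g by simp
  qed
  define a b where "a = n\<^sup>\<star> \<cdot> r\<^sup>\<star>" and "b = n\<^sup>\<star> \<cdot> s\<^sup>\<star>"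
  have [simp]: "a \<in> Arr C" "b \<in> Arr C" "Dom C a = X" "Dom C b = X" "Cod C a = K" "Cod C b = K"
    by (simp_all add: a_def b_def)
  have "d = r\<^sup>\<star> \<oplus> s\<^sup>\<star>" by (rule product_ext[OF P, of _ X]) (simp_all add: in_Hom)
  then have ab: "a \<oplus> b = \<zero> X K" using nd by (simp add: a_def b_def)
  have ab_comp: "a \<cdot> x \<oplus> b \<cdot> x = \<zero> (Dom C x) K" if "x \<in> Arr C" "Cod C x = X" for x
    using plus_comp[of a b x] that ab by simp
  \<comment> \<open>The pair with components \<open>x\<close> and \<open>y\<close> is killed by
    \<open>n\<^sup>\<star>\<close>, because \<open>a \<cdot> x \<oplus> b \<cdot> y = a \<cdot> y
    \<oplus> b \<cdot> y\<close>; so it factors through the diagonal and its components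
    agree.\<close>
  have a_inj: "x = y" if x: "x \<in> Hom C W X" and y: "y \<in> Hom C W X" and eq: "a \<cdot> x = a \<cdot> y" for W x y
  proof -
    note [simp] = HomD[OF x] HomD[OF y]
    have "n\<^sup>\<star> \<cdot> (r\<^sup>\<star> \<cdot> x \<oplus> s\<^sup>\<star> \<cdot> y) = a \<cdot> x \<oplus> b \<cdot> y" by (simp add: a_def b_def)
    also have "\<dots> = \<zero> W K" using ab_comp[of y] by (simp add: eq)
    finally obtain h where h: "h \<in> Hom C W X" "d \<cdot> h = r\<^sup>\<star> \<cdot> x \<oplus> s\<^sup>\<star> \<cdot> y"
      using dkern[of "r\<^sup>\<star> \<cdot> x \<oplus> s\<^sup>\<star> \<cdot> y" W] by (auto simp: in_Hom)
    note [simp] = HomD[OF h(1)]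
    show ?thesis using arg_cong[OF h(2), of "\<lambda>w. r \<cdot> w"] arg_cong[OF h(2), of "\<lambda>w. s \<cdot> w"] by simp
  qed
  have aabb: "a \<cdot> a\<^sup>\<star> \<oplus> b \<cdot> b\<^sup>\<star> = \<one> K"
  proof -
    have "n\<^sup>\<star> \<cdot> ((r\<^sup>\<star> \<cdot> r \<oplus> s\<^sup>\<star> \<cdot> s) \<cdot> n) = \<one> K" by (simp only: biproduct_sum[OF P]) simp
    then show ?thesis by (simp add: a_def b_def)
  qed
  have ab1: "a \<cdot> a\<^sup>\<star> \<oplus> b \<cdot> a\<^sup>\<star> = \<zero> K K" using ab_comp[of "a\<^sup>\<star>"] by simp
  have ab2: "a \<cdot> b\<^sup>\<star> \<oplus> b \<cdot> b\<^sup>\<star> = \<zero> K K" using ab_comp[of "b\<^sup>\<star>"] by simp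
  have ab3: "b \<cdot> a\<^sup>\<star> \<oplus> b \<cdot> b\<^sup>\<star> = \<zero> K K" using arg_cong[OF ab2, of "Star C"] by simp
  \<comment> \<open>Cancellation is not yet available, so
    \<open>a \<cdot> a\<^sup>\<star> = b \<cdot> b\<^sup>\<star>\<close> comes from regrouping
    vanishing sums. Both being half of the identity, twice \<open>a\<^sup>\<star>\<close> inverts
    \<open>a\<close> on the right.\<close>
  have "a \<cdot> a\<^sup>\<star> = a \<cdot> a\<^sup>\<star> \<oplus> (b \<cdot> a\<^sup>\<star> \<oplus> b \<cdot> b\<^sup>\<star>)" by (simp add: ab3)
  also have "\<dots> = (a \<cdot> a\<^sup>\<star> \<oplus> b \<cdot> a\<^sup>\<star>) \<oplus> b \<cdot> b\<^sup>\<star>" by (simp add: plus_assoc)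
  also have "\<dots> = b \<cdot> b\<^sup>\<star>" by (simp add: ab1)
  finally have aa: "a \<cdot> (a\<^sup>\<star> \<oplus> a\<^sup>\<star>) = \<one> K" using aabb by simp
  define c where "c = (a\<^sup>\<star> \<oplus> a\<^sup>\<star>) \<cdot> b"
  have c: "c \<in> Hom C X X" by (simp add: c_def in_Hom)
  note [simp] = HomD[OF c]
  have "a \<cdot> c = b" unfolding c_def using comp_reassoc[OF aa, of b] by simp
  then have "a \<cdot> (c \<oplus> \<one> X) = a \<cdot> \<zero> X X" using ab plus_comm[of a b] by simp
  then have "c \<oplus> \<one> X = \<zero> X X" by (rule a_inj[rotated 2]) (simp_all add: in_Hom)
  then show ?thesis using c by blast
qed

lemma ex_negative:
  assumes f: "f \<in> Hom C X Y"
  shows "\<exists>g\<in>Hom C X Y. g \<oplus> f = \<zero> X Y"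
proof -
  note [simp] = HomD[OF f]
  obtain c where c: "c \<in> Hom C Y Y" "c \<oplus> \<one> Y = \<zero> Y Y" using ex_negative_ide[of Y] by auto
  note [simp] = HomD[OF c(1)]
  have "c \<cdot> f \<oplus> f = \<zero> X Y" using plus_comp[of c "\<one> Y" f] c(2) by simp
  then show ?thesis by (intro bexI[of _ "c \<cdot> f"]) (simp_all add: in_Hom)
qed

lemma plus_cancel:
  assumes a: "a \<in> Hom C X Y" and b: "b \<in> Hom C X Y" and c: "c \<in> Hom C X Y" and eq: "a \<oplus> c = b \<oplus> c"
  shows "a = b"
proof -
  note [simp] = HomD[OF a] HomD[OF b] HomD[OF c]
  obtain n where n: "n \<in> Hom C X Y" "n \<oplus> c = \<zero> X Y" using ex_negative[OF c] by blast
  note [simp] = HomD[OF n(1)]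
  have "a = a \<oplus> (c \<oplus> n)" using n(2) plus_comm[of c n] by simp
  also have "\<dots> = (a \<oplus> c) \<oplus> n" by (simp add: plus_assoc)
  also have "\<dots> = b \<oplus> (c \<oplus> n)" unfolding eq by (simp add: plus_assoc)
  also have "\<dots> = b" using n(2) plus_comm[of c n] by simp
  finally show ?thesis .
qed

lemma ex_difference:
  assumes f: "f \<in> Hom C X Y" and g: "g \<in> Hom C X Y"
  shows "\<exists>d\<in>Hom C X Y. d \<oplus> g = f"
proof -
  note [simp] = HomD[OF f] HomD[OF g]
  obtain n where n: "n \<in> Hom C X Y" "n \<oplus> g = \<zero> X Y" using ex_negative[OF g] by blast
  note [simp] = HomD[OF n(1)]
  have "(f \<oplus> n) \<oplus> g = f" using n(2) by (simp add: plus_assoc)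
  then show ?thesis by (intro bexI[of _ "f \<oplus> n"]) (simp_all add: in_Hom)
qed

text \<open>A substitute for subtraction: the difference enters only through the sum
  \<open>d \<oplus> g = f\<close>, which can be composed and cancelled like any other
  equation.\<close>

lemma eq_if_difference_zero:
  assumes f: "f \<in> Hom C X Y" and g: "g \<in> Hom C X Y"
    and "\<And>d. d \<in> Hom C X Y \<Longrightarrow> d \<oplus> g = f \<Longrightarrow> d = \<zero> X Y"
  shows "f = g"
proof -
  note [simp] = HomD[OF g]
  obtain d where "d \<in> Hom C X Y" "d \<oplus> g = f" using ex_difference[OF f g] by blast
  then show ?thesis using assms(3)[of d] by simp
qed

text \<open>By hypothesis \<open>f\<close> factors through the kernel \<open>k\<close> of
  \<open>f\<^sup>\<star>\<close>; but \<open>k\<^sup>\<star> \<cdot> f\<close> is the adjoint of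
  \<open>f\<^sup>\<star> \<cdot> k\<close> and vanishes too.\<close>

lemma star_comp_self_zero:
  assumes f: "f \<in> Hom C X Y" and ff: "f\<^sup>\<star> \<cdot> f = \<zero> X X"
  shows "f = \<zero> X Y"
proof -
  note [simp] = HomD[OF f]
  have fs: "f\<^sup>\<star> \<in> Hom C Y X" by (simp add: in_Hom)
  obtain K k where k: "k \<in> Hom C K Y" "f\<^sup>\<star> \<cdot> k = \<zero> K X"
    "\<And>W g. g \<in> Hom C W Y \<Longrightarrow> f\<^sup>\<star> \<cdot> g = \<zero> W X \<Longrightarrow> k \<cdot> (k\<^sup>\<star> \<cdot> g) = g"
    using ex_kernel[OF fs] by blast
  note [simp] = HomD[OF k(1)]
  have "k\<^sup>\<star> \<cdot> f = \<zero> X K" using arg_cong[OF k(2), of "Star C"] by simp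
  then show ?thesis using k(3)[OF f ff] by simp
qed

text \<open>The column with entries \<open>f\<close> and \<open>g\<close>. It shows that positive
  elements add, which underlies transitivity of the order and the dilations below.\<close>

lemma ex_pair:
  assumes f: "f \<in> Hom C A X" and g: "g \<in> Hom C A Y"
  shows "\<exists>P r s h. orthonormal_product C X Y P r s \<and> h \<in> Hom C A P \<and> r \<cdot> h = f \<and> s \<cdot> h = g \<and>
    h\<^sup>\<star> \<cdot> h = f\<^sup>\<star> \<cdot> f \<oplus> g\<^sup>\<star> \<cdot> g"
proof -
  note [simp] = HomD[OF f] HomD[OF g]
  obtain P r s where P: "orthonormal_product C X Y P r s" using ex_orthonormal_product[of X Y] by auto
  note [simp] = biproductD[OF P]
  let ?h = "r\<^sup>\<star> \<cdot> f \<oplus> s\<^sup>\<star> \<cdot> g"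
  have "?h \<in> Hom C A P" "r \<cdot> ?h = f" "s \<cdot> ?h = g" "?h\<^sup>\<star> \<cdot> ?h = f\<^sup>\<star> \<cdot> f \<oplus> g\<^sup>\<star> \<cdot> g"
    by (simp_all add: in_Hom)
  then show ?thesis using P by blast
qed

lemma sum_positive_zero:
  assumes f: "f \<in> Hom C A X" and g: "g \<in> Hom C A Y" and eq: "f\<^sup>\<star> \<cdot> f \<oplus> g\<^sup>\<star> \<cdot> g = \<zero> A A"
  shows "f = \<zero> A X" "g = \<zero> A Y"
proof -
  obtain P r s h where P: "orthonormal_product C X Y P r s" and h: "h \<in> Hom C A P" "r \<cdot> h = f" "s \<cdot> h = g"
    "h\<^sup>\<star> \<cdot> h = f\<^sup>\<star> \<cdot> f \<oplus> g\<^sup>\<star> \<cdot> g"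
    using ex_pair[OF f g] by blast
  note [simp] = biproductD[OF P] HomD[OF h(1)]
  have "h = \<zero> A P" using star_comp_self_zero[OF h(1)] h(4) eq by simp
  then show "f = \<zero> A X" "g = \<zero> A Y" using h by auto
qed

end

section \<open>Order, contractions and factorisation\<close>

context pre_hilbert_category
begin

lemma HermD:
  assumes "a \<in> Herm C A"
  shows "a \<in> Hom C A A" "a \<in> Arr C" "Dom C a = A" "Cod C a = A" "A \<in> Obj C" "a\<^sup>\<star> = a"
  using assms HomD[of a A A] by (auto simp: Herm_def)

lemma Herm_gram:
  assumes "h \<in> Hom C A X"
  shows "h\<^sup>\<star> \<cdot> h \<in> Herm C A"
  using HomD[OF assms] by (simp add: Herm_def in_Hom)

lemma minus_arr_eq_iff:
  assumes a: "a \<in> Hom C X Y" and b: "b \<in> Hom C X Y" and h: "h \<in> Hom C X Y"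
  shows "minus_arr C b a = h \<longleftrightarrow> h \<oplus> a = b"
proof -
  obtain d where d: "d \<in> Hom C X Y" "d \<oplus> a = b" using ex_difference[OF b a] by blast
  have "minus_arr C b a = d" unfolding minus_arr_def
  proof (rule the_equality)
    show "d \<in> Hom C (Dom C b) (Cod C b) \<and> d \<oplus> a = b" using d HomD[OF b] by simp
    fix e assume "e \<in> Hom C (Dom C b) (Cod C b) \<and> e \<oplus> a = b"
    then show "e = d" using plus_cancel[OF _ d(1) a, of e] d(2) HomD[OF b] by simp
  qed
  then show ?thesis using d(2) plus_cancel[OF d(1) h a] by metis
qed

lemma herm_le_iff:
  "herm_le C A a b \<longleftrightarrow> a \<in> Herm C A \<and> b \<in> Herm C A \<and> (\<exists>X. \<exists>h\<in>Hom C A X. h\<^sup>\<star> \<cdot> h \<oplus> a = b)"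
proof (cases "a \<in> Herm C A \<and> b \<in> Herm C A")
  case True
  then have a: "a \<in> Herm C A" and b: "b \<in> Herm C A" by auto
  note [simp] = HermD(2-)[OF a] HermD(2-)[OF b]
  have "minus_arr C b a = h\<^sup>\<star> \<cdot> h \<longleftrightarrow> h\<^sup>\<star> \<cdot> h \<oplus> a = b" if h: "h \<in> Hom C A X" for X h
  proof -
    have "h\<^sup>\<star> \<cdot> h \<in> Hom C A A" using HomD[OF h] by (simp add: in_Hom)
    then show ?thesis by (rule minus_arr_eq_iff[OF HermD(1)[OF a] HermD(1)[OF b]])
  qed
  then show ?thesis using True HomD(5) unfolding herm_le_def by metis
qed (auto simp: herm_le_def)

lemma herm_leI:
  assumes "a \<in> Herm C A" "h \<in> Hom C A X" "h\<^sup>\<star> \<cdot> h \<oplus> a = b"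
  shows "herm_le C A a b"
proof -
  note [simp] = HermD(2-)[OF assms(1)] HomD[OF assms(2)]
  have "b \<in> Herm C A" using assms(3) by (auto simp: Herm_def in_Hom)
  then show ?thesis using assms herm_le_iff by blast
qed

lemma herm_le_trans:
  assumes ab: "herm_le C A a b" and bc: "herm_le C A b c"
  shows "herm_le C A a c"
proof -
  have a: "a \<in> Herm C A" using ab herm_le_iff by blast
  obtain X h Y g where h: "h \<in> Hom C A X" "h\<^sup>\<star> \<cdot> h \<oplus> a = b" and g: "g \<in> Hom C A Y" "g\<^sup>\<star> \<cdot> g \<oplus> b = c"
    using ab bc herm_le_iff by blast
  note [simp] = HermD(2-)[OF a] HomD[OF h(1)] HomD[OF g(1)]
  obtain P k where k: "k \<in> Hom C A P" "k\<^sup>\<star> \<cdot> k = g\<^sup>\<star> \<cdot> g \<oplus> h\<^sup>\<star> \<cdot> h"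
    using ex_pair[OF g(1) h(1)] by blast
  have "k\<^sup>\<star> \<cdot> k \<oplus> a = c" unfolding g(2)[symmetric] h(2)[symmetric] k(2) by (simp add: plus_assoc)
  then show ?thesis using herm_leI[OF a k(1)] by blast
qed

lemma herm_le_antisym:
  assumes ab: "herm_le C A a b" and ba: "herm_le C A b a"
  shows "a = b"
proof -
  have a: "a \<in> Herm C A" using ab herm_le_iff by blast
  obtain X h Y g where h: "h \<in> Hom C A X" "h\<^sup>\<star> \<cdot> h \<oplus> a = b" and g: "g \<in> Hom C A Y" "g\<^sup>\<star> \<cdot> g \<oplus> b = a"
    using ab ba herm_le_iff by blast
  note [simp] = HermD(2-)[OF a] HomD[OF h(1)] HomD[OF g(1)]
  have "(g\<^sup>\<star> \<cdot> g \<oplus> h\<^sup>\<star> \<cdot> h) \<oplus> a = \<zero> A A \<oplus> a" using g(2) h(2) by (simp add: plus_assoc)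
  then have "g\<^sup>\<star> \<cdot> g \<oplus> h\<^sup>\<star> \<cdot> h = \<zero> A A"
    by (rule plus_cancel[rotated 3]) (simp_all add: in_Hom)
  then have "h = \<zero> A X" using sum_positive_zero[OF g(1) h(1)] by simp
  then show ?thesis using h(2) by simp
qed

lemma herm_le_conj:
  assumes ab: "herm_le C A a b" and x: "x \<in> Hom C B A"
  shows "herm_le C B (x\<^sup>\<star> \<cdot> (a \<cdot> x)) (x\<^sup>\<star> \<cdot> (b \<cdot> x))"
proof -
  have a: "a \<in> Herm C A" using ab herm_le_iff by blast
  obtain X h where h: "h \<in> Hom C A X" "h\<^sup>\<star> \<cdot> h \<oplus> a = b" using ab herm_le_iff by blast
  note [simp] = HermD(2-)[OF a] HomD[OF h(1)] HomD[OF x]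
  show ?thesis
    by (rule herm_leI[of _ _ "h \<cdot> x" X]) (simp_all add: in_Hom Herm_def flip: h(2))
qed

lemma contractionD:
  assumes "contraction C f" "f \<in> Hom C X Y"
  shows "herm_le C X (f\<^sup>\<star> \<cdot> f) (\<one> X)" "\<exists>Z. \<exists>z\<in>Hom C X Z. z\<^sup>\<star> \<cdot> z \<oplus> f\<^sup>\<star> \<cdot> f = \<one> X"
  using assms HomD[OF assms(2)] by (auto simp: contraction_def herm_le_iff)

lemma contraction_iff:
  assumes "f \<in> Hom C X Y"
  shows "contraction C f \<longleftrightarrow> herm_le C X (f\<^sup>\<star> \<cdot> f) (\<one> X)"
  using assms HomD[OF assms] by (auto simp: contraction_def)

lemma contractionI:
  assumes f: "f \<in> Hom C X Y" and z: "z \<in> Hom C X Z" "z\<^sup>\<star> \<cdot> z \<oplus> f\<^sup>\<star> \<cdot> f = \<one> X"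
  shows "contraction C f"
  using contraction_iff[OF f] herm_leI[OF Herm_gram[OF f] z] by simp

lemma isometry_contraction:
  assumes "isometry C f" "f \<in> Hom C X Y"
  shows "contraction C f"
proof -
  note [simp] = HomD[OF assms(2)] isometryD[OF assms]
  show ?thesis by (rule contractionI[OF assms(2), of "\<zero> X X" X]) (simp_all add: in_Hom)
qed

lemma contraction_comp:
  assumes f: "contraction C f" "f \<in> Hom C X Y" and g: "contraction C g" "g \<in> Hom C Y Z"
  shows "contraction C (g \<cdot> f)"
proof -
  note [simp] = HomD[OF f(2)] HomD[OF g(2)]
  have gf: "g \<cdot> f \<in> Hom C X Z" by (simp add: in_Hom)
  have "herm_le C X (f\<^sup>\<star> \<cdot> ((g\<^sup>\<star> \<cdot> g) \<cdot> f)) (f\<^sup>\<star> \<cdot> (\<one> Y \<cdot> f))"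
    by (rule herm_le_conj[OF contractionD(1)[OF g] f(2)])
  then show ?thesis using contraction_iff[OF gf] herm_le_trans[OF _ contractionD(1)[OF f]] by simp
qed

text \<open>With \<open>k\<close> a kernel of \<open>u\<^sup>\<star>\<close>, the difference
  \<open>d\<close> between the identity and the sum of the two projections is killed by both
  \<open>u\<^sup>\<star>\<close> and \<open>k\<^sup>\<star>\<close>. The first puts \<open>d\<close>
  in the range of \<open>k\<close>, and then the second makes it zero.\<close>

lemma isometry_complement:
  assumes u: "isometry C u" "u \<in> Hom C X Y"
  shows "\<exists>K k. k \<in> Hom C K Y \<and> isometry C k \<and> u\<^sup>\<star> \<cdot> k = \<zero> K X \<and> u \<cdot> u\<^sup>\<star> \<oplus> k \<cdot> k\<^sup>\<star> = \<one> Y"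
proof -
  note [simp] = HomD[OF u(2)] isometryD[OF u]
  have us: "u\<^sup>\<star> \<in> Hom C Y X" by (simp add: in_Hom)
  obtain K k where k: "k \<in> Hom C K Y" "isometry C k" "u\<^sup>\<star> \<cdot> k = \<zero> K X"
    "\<And>W g. g \<in> Hom C W Y \<Longrightarrow> u\<^sup>\<star> \<cdot> g = \<zero> W X \<Longrightarrow> k \<cdot> (k\<^sup>\<star> \<cdot> g) = g"
    using ex_kernel[OF us] by blast
  note [simp] = HomD[OF k(1)] isometryD[OF k(2,1)]
  have ku: "k\<^sup>\<star> \<cdot> u = \<zero> X K" using arg_cong[OF k(3), of "Star C"] by simp
  have kus: "\<And>x. x \<in> Arr C \<Longrightarrow> Cod C x = X \<Longrightarrow> k\<^sup>\<star> \<cdot> (u \<cdot> x) = \<zero> (Dom C x) K"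
    "\<And>x. x \<in> Arr C \<Longrightarrow> Cod C x = K \<Longrightarrow> u\<^sup>\<star> \<cdot> (k \<cdot> x) = \<zero> (Dom C x) X"
    using comp_reassoc[OF ku] comp_reassoc[OF k(3)] by simp_all
  let ?p = "u \<cdot> u\<^sup>\<star> \<oplus> k \<cdot> k\<^sup>\<star>"
  have p: "?p \<in> Hom C Y Y" by (simp add: in_Hom)
  have "\<one> Y = ?p"
  proof (rule eq_if_difference_zero[OF _ p])
    fix d assume d: "d \<in> Hom C Y Y" "d \<oplus> ?p = \<one> Y"
    note [simp] = HomD[OF d(1)]
    have "u\<^sup>\<star> \<cdot> d \<oplus> u\<^sup>\<star> = \<zero> Y X \<oplus> u\<^sup>\<star>" using arg_cong[OF d(2), of "\<lambda>x. u\<^sup>\<star> \<cdot> x"] by (simp add: kus)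
    then have "u\<^sup>\<star> \<cdot> d = \<zero> Y X" by (rule plus_cancel[rotated 3]) (simp_all add: in_Hom)
    then have d': "k \<cdot> (k\<^sup>\<star> \<cdot> d) = d" by (rule k(4)[OF d(1)])
    have "k\<^sup>\<star> \<cdot> d \<oplus> k\<^sup>\<star> = \<zero> Y K \<oplus> k\<^sup>\<star>" using arg_cong[OF d(2), of "\<lambda>x. k\<^sup>\<star> \<cdot> x"] by (simp add: kus)
    then have "k\<^sup>\<star> \<cdot> d = \<zero> Y K" by (rule plus_cancel[rotated 3]) (simp_all add: in_Hom)
    then show "d = \<zero> Y Y" using d' by simp
  qed (simp add: in_Hom)
  then show ?thesis using k by auto
qed

lemma isometry_star_contraction:
  assumes u: "isometry C u" "u \<in> Hom C X Y"
  shows "contraction C (u\<^sup>\<star>)"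
proof -
  note [simp] = HomD[OF u(2)]
  obtain K k where k: "k \<in> Hom C K Y" "u \<cdot> u\<^sup>\<star> \<oplus> k \<cdot> k\<^sup>\<star> = \<one> Y"
    using isometry_complement[OF u] by blast
  note [simp] = HomD[OF k(1)]
  show ?thesis
    by (rule contractionI[of _ Y X "k\<^sup>\<star>" K]) (use k(2) plus_comm[of "k \<cdot> k\<^sup>\<star>" "u \<cdot> u\<^sup>\<star>"] in \<open>simp_all add: in_Hom\<close>)
qed

lemma biproduct_isometry:
  assumes P: "orthonormal_product C X Y P r s"
  shows "isometry C (r\<^sup>\<star>)" "isometry C (s\<^sup>\<star>)" "contraction C r" "contraction C s"
proof -
  note [simp] = biproductD[OF P]
  have h: "r\<^sup>\<star> \<in> Hom C X P" "s\<^sup>\<star> \<in> Hom C Y P" by (simp_all add: in_Hom)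
  show i: "isometry C (r\<^sup>\<star>)" "isometry C (s\<^sup>\<star>)" by (simp_all add: isometry_def)
  show "contraction C r" "contraction C s"
    using isometry_star_contraction[OF i(1) h(1)] isometry_star_contraction[OF i(2) h(2)] by simp_all
qed

text \<open>The order itself supplies a root \<open>z\<close> of the defect of \<open>f\<close>, and
  the column of \<open>f\<close> and \<open>z\<close> is isometric.\<close>

lemma ex_isometric_dilation:
  assumes f: "contraction C f" "f \<in> Hom C X Y"
  shows "\<exists>Z P r s u. orthonormal_product C Y Z P r s \<and> u \<in> Hom C X P \<and> isometry C u \<and> r \<cdot> u = f"
proof -
  note [simp] = HomD[OF f(2)]
  obtain Z z where z: "z \<in> Hom C X Z" "z\<^sup>\<star> \<cdot> z \<oplus> f\<^sup>\<star> \<cdot> f = \<one> X" using contractionD(2)[OF f] by blast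
  note [simp] = HomD[OF z(1)]
  obtain P r s u where u: "orthonormal_product C Y Z P r s" "u \<in> Hom C X P" "r \<cdot> u = f"
    "u\<^sup>\<star> \<cdot> u = f\<^sup>\<star> \<cdot> f \<oplus> z\<^sup>\<star> \<cdot> z"
    using ex_pair[OF f(2) z(1)] by blast
  have "isometry C u" using isometryI[OF u(2)] u(4) z(2) plus_comm[of "f\<^sup>\<star> \<cdot> f" "z\<^sup>\<star> \<cdot> z"] by simp
  then show ?thesis using u by blast
qed

text \<open>Positivity of \<open>1 - f \<cdot> f\<^sup>\<star>\<close> is not visible from the
  definition. Dilating \<open>f\<close> to \<open>r \<cdot> u\<close> makes
  \<open>f\<^sup>\<star>\<close> the isometry \<open>r\<^sup>\<star>\<close> followed by the adjoint
  of an isometry, and for the latter the orthogonal complement provides the defect.\<close>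

lemma contraction_star:
  assumes f: "contraction C f" "f \<in> Hom C X Y"
  shows "contraction C (f\<^sup>\<star>)"
proof -
  obtain Z P r s u where P: "orthonormal_product C Y Z P r s" and u: "u \<in> Hom C X P" "isometry C u" "r \<cdot> u = f"
    using ex_isometric_dilation[OF f] by blast
  note [simp] = HomD[OF u(1)] biproductD[OF P]
  have "contraction C (u\<^sup>\<star> \<cdot> r\<^sup>\<star>)"
    by (rule contraction_comp[OF isometry_contraction[OF biproduct_isometry(1)[OF P]] _
          isometry_star_contraction[OF u(2,1)]]) (simp_all add: in_Hom)
  then show ?thesis by (simp flip: u(3))
qed

section \<open>Images and Douglas factorisation\<close>

text \<open>The analogue of ranges that together span a dense subspace. The tests run over all
  arrows of \<open>C\<close>, not just contractions, so that differences and adjoints can be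
  compared as well.\<close>

definition jointly_epic :: "'i set \<Rightarrow> ('i \<Rightarrow> 'm) \<Rightarrow> 'o \<Rightarrow> bool" where
  "jointly_epic I v H \<longleftrightarrow>
    (\<forall>Y. \<forall>x\<in>Hom C H Y. \<forall>y\<in>Hom C H Y. (\<forall>j\<in>I. x \<cdot> v j = y \<cdot> v j) \<longrightarrow> x = y)"

abbreviation epic :: "'m \<Rightarrow> 'o \<Rightarrow> bool" where
  "epic v H \<equiv> jointly_epic {()} (\<lambda>_. v) H"

lemma jointly_epicD:
  assumes "jointly_epic I v H" "x \<in> Hom C H Y" "y \<in> Hom C H Y" "\<And>j. j \<in> I \<Longrightarrow> x \<cdot> v j = y \<cdot> v j"
  shows "x = y"
  using assms unfolding jointly_epic_def by blast

lemma epicD: "epic v H \<Longrightarrow> x \<in> Hom C H Y \<Longrightarrow> y \<in> Hom C H Y \<Longrightarrow> x \<cdot> v = y \<cdot> v \<Longrightarrow> x = y"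
  unfolding jointly_epic_def by blast

text \<open>An operator is determined by its matrix entries: the family is cancelled on the right,
  and on the left after taking adjoints.\<close>

lemma jointly_epic_gram:
  assumes q: "jointly_epic I q M" "\<And>j. j \<in> I \<Longrightarrow> q j \<in> Hom C (X j) M"
    and A: "A \<in> Hom C M M" and B: "B \<in> Hom C M M"
    and eq: "\<And>i j. i \<in> I \<Longrightarrow> j \<in> I \<Longrightarrow> (q i)\<^sup>\<star> \<cdot> (A \<cdot> q j) = (q i)\<^sup>\<star> \<cdot> (B \<cdot> q j)"
  shows "A = B"
proof (rule jointly_epicD[OF q(1) A B])
  fix j assume j: "j \<in> I"
  note [simp] = HomD[OF q(2)[OF j]] HomD[OF A] HomD[OF B]
  have "(A \<cdot> q j)\<^sup>\<star> = (B \<cdot> q j)\<^sup>\<star>"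
  proof (rule jointly_epicD[OF q(1), of _ "X j"])
    fix i assume i: "i \<in> I"
    note [simp] = HomD[OF q(2)[OF i]]
    show "(A \<cdot> q j)\<^sup>\<star> \<cdot> q i = (B \<cdot> q j)\<^sup>\<star> \<cdot> q i"
      using arg_cong[OF eq[OF i j], of "Star C"] by simp
  qed (simp_all add: in_Hom)
  then show "A \<cdot> q j = B \<cdot> q j" by (subst (asm) star_eq_iff) simp_all
qed

text \<open>The closure of the range as a double orthogonal complement: \<open>n\<close> is a kernel
  of \<open>v\<^sup>\<star>\<close> and \<open>k\<close> a kernel of \<open>n\<^sup>\<star>\<close>.
  If \<open>d\<close> vanishes on the image, then \<open>k \<cdot> d\<^sup>\<star>\<close> lies in
  the ranges of both \<open>n\<close> and \<open>k\<close>, which are orthogonal.\<close>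

lemma ex_image:
  assumes v: "v \<in> Hom C X H"
  shows "\<exists>M k q. k \<in> Hom C M H \<and> isometry C k \<and> q \<in> Hom C X M \<and> k \<cdot> q = v \<and> epic q M"
proof -
  note [simp] = HomD[OF v]
  have vs: "v\<^sup>\<star> \<in> Hom C H X" by (simp add: in_Hom)
  obtain N n where n: "n \<in> Hom C N H" "isometry C n" "v\<^sup>\<star> \<cdot> n = \<zero> N X"
    "\<And>W g. g \<in> Hom C W H \<Longrightarrow> v\<^sup>\<star> \<cdot> g = \<zero> W X \<Longrightarrow> n \<cdot> (n\<^sup>\<star> \<cdot> g) = g"
    using ex_kernel[OF vs] by blast
  note [simp] = HomD[OF n(1)] isometryD[OF n(2,1)]
  have ns: "n\<^sup>\<star> \<in> Hom C H N" by (simp add: in_Hom)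
  obtain M k where k: "k \<in> Hom C M H" "isometry C k" "n\<^sup>\<star> \<cdot> k = \<zero> M N"
    "\<And>W g. g \<in> Hom C W H \<Longrightarrow> n\<^sup>\<star> \<cdot> g = \<zero> W N \<Longrightarrow> k \<cdot> (k\<^sup>\<star> \<cdot> g) = g"
    using ex_kernel[OF ns] by blast
  note [simp] = HomD[OF k(1)] isometryD[OF k(2,1)]
  have "n\<^sup>\<star> \<cdot> v = \<zero> X N" using arg_cong[OF n(3), of "Star C"] by simp
  then have kv: "k \<cdot> (k\<^sup>\<star> \<cdot> v) = v" by (rule k(4)[OF v])
  have "epic (k\<^sup>\<star> \<cdot> v) M" unfolding jointly_epic_def
  proof (intro allI ballI impI)
    fix Y x y assume x: "x \<in> Hom C M Y" and y: "y \<in> Hom C M Y" and "\<forall>j\<in>{()}. x \<cdot> (k\<^sup>\<star> \<cdot> v) = y \<cdot> (k\<^sup>\<star> \<cdot> v)"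
    then have xy: "x \<cdot> (k\<^sup>\<star> \<cdot> v) = y \<cdot> (k\<^sup>\<star> \<cdot> v)" by simp
    note [simp] = HomD[OF x] HomD[OF y]
    show "x = y"
    proof (rule eq_if_difference_zero[OF x y])
      fix d assume d: "d \<in> Hom C M Y" "d \<oplus> y = x"
      note [simp] = HomD[OF d(1)]
      have "d \<cdot> (k\<^sup>\<star> \<cdot> v) \<oplus> y \<cdot> (k\<^sup>\<star> \<cdot> v) = \<zero> X Y \<oplus> y \<cdot> (k\<^sup>\<star> \<cdot> v)"
        using xy by (simp flip: d(2))
      then have "d \<cdot> (k\<^sup>\<star> \<cdot> v) = \<zero> X Y" by (rule plus_cancel[rotated 3]) (simp_all add: in_Hom)
      from arg_cong[OF this, of "Star C"] have "v\<^sup>\<star> \<cdot> (k \<cdot> d\<^sup>\<star>) = \<zero> Y X" by simp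
      then have "n \<cdot> (n\<^sup>\<star> \<cdot> (k \<cdot> d\<^sup>\<star>)) = k \<cdot> d\<^sup>\<star>" by (rule n(4)[rotated]) (simp add: in_Hom)
      moreover have "n\<^sup>\<star> \<cdot> (k \<cdot> d\<^sup>\<star>) = \<zero> Y N" using comp_reassoc[OF k(3), of "d\<^sup>\<star>"] by simp
      ultimately have kd: "k \<cdot> d\<^sup>\<star> = \<zero> Y H" by simp
      have ds: "d\<^sup>\<star> = \<zero> Y M" using arg_cong[OF kd, of "\<lambda>w. k\<^sup>\<star> \<cdot> w"] by simp
      show "d = \<zero> M Y" using arg_cong[OF ds, of "Star C"] by simp
    qed
  qed
  then show ?thesis using k kv by (intro exI[of _ M] exI[of _ k] exI[of _ "k\<^sup>\<star> \<cdot> v"]) (simp add: in_Hom)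
qed

text \<open>Each step replaces the image \<open>M\<close> by the image of the row \<open>w\<close>
  with entries \<open>k\<close> and \<open>v a\<close> on the biproduct of \<open>M\<close> and
  \<open>X a\<close>; the start is a zero object.\<close>

lemma ex_joint_image:
  assumes "finite I" "\<And>j. j \<in> I \<Longrightarrow> v j \<in> Hom C (X j) H" "H \<in> Obj C"
  shows "\<exists>M k q. k \<in> Hom C M H \<and> isometry C k \<and>
    (\<forall>j\<in>I. q j \<in> Hom C (X j) M \<and> k \<cdot> q j = v j) \<and> jointly_epic I q M"
  using assms
proof (induction I rule: finite_induct)
  case empty
  obtain Z where Z: "is_zero_object C Z" using ex_zero_object by blast
  then have [simp]: "Z \<in> Obj C" "H \<in> Obj C" using empty by (auto simp: is_zero_object_def)
  have "\<zero> Z Z = \<one> Z" using is_zero_objectD(3)[OF Z, of Z "\<zero> Z Z" "\<one> Z"] by (simp add: in_Hom)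
  then have "isometry C (\<zero> Z H)" "\<zero> Z H \<in> Hom C Z H" by (simp_all add: isometry_def in_Hom)
  moreover have "jointly_epic {} q Z" for q :: "'a \<Rightarrow> 'm"
    unfolding jointly_epic_def using is_zero_objectD(4)[OF Z] HomD(5) by blast
  ultimately show ?case by blast
next
  case (insert a I)
  then obtain M k q where k: "k \<in> Hom C M H" "isometry C k"
    and q: "\<And>j. j \<in> I \<Longrightarrow> q j \<in> Hom C (X j) M" "\<And>j. j \<in> I \<Longrightarrow> k \<cdot> q j = v j" "jointly_epic I q M"
    by fastforce
  have va: "v a \<in> Hom C (X a) H" using insert by simp
  note [simp] = HomD[OF k(1)] HomD[OF va]
  obtain P r s where P: "orthonormal_product C M (X a) P r s" using ex_orthonormal_product[of M "X a"] by auto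
  note [simp] = biproductD[OF P]
  define w where "w = k \<cdot> r \<oplus> v a \<cdot> s"
  have w: "w \<in> Hom C P H" by (simp add: w_def in_Hom)
  have wr: "w \<cdot> (r\<^sup>\<star> \<cdot> x) = k \<cdot> x" if "x \<in> Arr C" "Cod C x = M" for x using that by (simp add: w_def)
  have ws: "w \<cdot> s\<^sup>\<star> = v a" by (simp add: w_def)
  obtain M' k' p where M': "k' \<in> Hom C M' H" "isometry C k'" "p \<in> Hom C P M'" "k' \<cdot> p = w" "epic p M'"
    using ex_image[OF w] by blast
  note [simp] = HomD[OF M'(1)] HomD[OF M'(3)] HomD[OF w]
  define q' where "q' j = (if j = a then p \<cdot> s\<^sup>\<star> else p \<cdot> (r\<^sup>\<star> \<cdot> q j))" for j
  have "q' j \<in> Hom C (X j) M' \<and> k' \<cdot> q' j = v j" if j: "j \<in> insert a I" for j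
  proof (cases "j = a")
    case True
    then show ?thesis using comp_reassoc[OF M'(4), of "s\<^sup>\<star>"] by (simp add: q'_def in_Hom ws)
  next
    case False
    with j have j: "j \<in> I" by simp
    note [simp] = HomD[OF q(1)[OF j]]
    show ?thesis using False comp_reassoc[OF M'(4), of "r\<^sup>\<star> \<cdot> q j"] by (simp add: q'_def in_Hom wr q(2)[OF j])
  qed
  moreover have "jointly_epic (insert a I) q' M'" unfolding jointly_epic_def
  proof (intro allI ballI impI)
    fix Y x y assume x: "x \<in> Hom C M' Y" and y: "y \<in> Hom C M' Y" and eq: "\<forall>j\<in>insert a I. x \<cdot> q' j = y \<cdot> q' j"
    note [simp] = HomD[OF x] HomD[OF y]
    have "(x \<cdot> p) \<cdot> r\<^sup>\<star> = (y \<cdot> p) \<cdot> r\<^sup>\<star>"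
    proof (rule jointly_epicD[OF q(3), of _ Y])
      fix j assume j: "j \<in> I"
      note [simp] = HomD[OF q(1)[OF j]]
      have "j \<noteq> a" using j insert.hyps by auto
      then show "((x \<cdot> p) \<cdot> r\<^sup>\<star>) \<cdot> q j = ((y \<cdot> p) \<cdot> r\<^sup>\<star>) \<cdot> q j" using eq j by (auto simp: q'_def)
    qed (simp_all add: in_Hom)
    moreover have "(x \<cdot> p) \<cdot> s\<^sup>\<star> = (y \<cdot> p) \<cdot> s\<^sup>\<star>" using eq by (auto simp: q'_def)
    ultimately have "x \<cdot> p = y \<cdot> p" by (rule coproduct_ext[OF P, of _ Y, rotated 2]) (simp_all add: in_Hom)
    then show "x = y" using epicD[OF M'(5) x y] by simp
  qed
  ultimately show ?case using M'(1,2) by blast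
qed

text \<open>A form of Douglas' factorisation lemma. No completeness is needed: the image \<open>(a, b)\<close> of the
  pairing of \<open>e\<close> and \<open>t\<close> is closed, and \<open>a\<^sup>\<star> a = b\<^sup>\<star> b\<close> together with \<open>a\<^sup>\<star> a + b\<^sup>\<star> b = 1\<close>
  exhibits \<open>a\<^sup>\<star> + a\<^sup>\<star>\<close> as an inverse of \<open>a\<close>.\<close>

lemma ex_isometric_extension:
  assumes fin: "finite I" and e: "\<And>j. j \<in> I \<Longrightarrow> e j \<in> Hom C (X j) V" "jointly_epic I e V"
    and t: "\<And>j. j \<in> I \<Longrightarrow> t j \<in> Hom C (X j) W" and VW: "V \<in> Obj C" "W \<in> Obj C"
    and gram: "\<And>i j. i \<in> I \<Longrightarrow> j \<in> I \<Longrightarrow> (e i)\<^sup>\<star> \<cdot> e j = (t i)\<^sup>\<star> \<cdot> t j"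
  shows "\<exists>u\<in>Hom C V W. isometry C u \<and> (\<forall>j\<in>I. u \<cdot> e j = t j)"
proof -
  obtain P r s where P: "orthonormal_product C V W P r s" using ex_orthonormal_product VW by blast
  note [simp] = biproductD[OF P]
  have "r\<^sup>\<star> \<cdot> e j \<oplus> s\<^sup>\<star> \<cdot> t j \<in> Hom C (X j) P" if "j \<in> I" for j
    using HomD[OF e(1)[OF that]] HomD[OF t[OF that]] by (simp add: in_Hom)
  then obtain M k q where k: "k \<in> Hom C M P" "isometry C k"
    and q: "\<And>j. j \<in> I \<Longrightarrow> q j \<in> Hom C (X j) M" "\<And>j. j \<in> I \<Longrightarrow> k \<cdot> q j = r\<^sup>\<star> \<cdot> e j \<oplus> s\<^sup>\<star> \<cdot> t j" "jointly_epic I q M"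
    using ex_joint_image[OF fin, of "\<lambda>j. r\<^sup>\<star> \<cdot> e j \<oplus> s\<^sup>\<star> \<cdot> t j" X P] biproductD(11)[OF P] by blast
  note [simp] = HomD[OF k(1)] isometryD[OF k(2,1)]
  define a b where "a = r \<cdot> k" and "b = s \<cdot> k"
  have [simp]: "a \<in> Arr C" "Dom C a = M" "Cod C a = V" "b \<in> Arr C" "Dom C b = M" "Cod C b = W"
    by (simp_all add: a_def b_def)
  have aq: "a \<cdot> q j = e j" and bq: "b \<cdot> q j = t j" if "j \<in> I" for j
    using HomD[OF e(1)[OF that]] HomD[OF t[OF that]] HomD[OF q(1)[OF that]] q(2)[OF that]
    by (simp_all add: a_def b_def)
  have ab: "a\<^sup>\<star> \<cdot> a = b\<^sup>\<star> \<cdot> b"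
  proof (rule jointly_epic_gram[OF q(3,1)])
    fix i j assume ij: "i \<in> I" "j \<in> I"
    note [simp] = HomD[OF q(1)[OF ij(1)]] HomD[OF q(1)[OF ij(2)]]
    have "(a \<cdot> q i)\<^sup>\<star> \<cdot> (a \<cdot> q j) = (b \<cdot> q i)\<^sup>\<star> \<cdot> (b \<cdot> q j)"
      using gram[OF ij] by (simp only: aq[OF ij(1)] aq[OF ij(2)] bq[OF ij(1)] bq[OF ij(2)])
    then show "(q i)\<^sup>\<star> \<cdot> ((a\<^sup>\<star> \<cdot> a) \<cdot> q j) = (q i)\<^sup>\<star> \<cdot> ((b\<^sup>\<star> \<cdot> b) \<cdot> q j)" by simp
  qed (simp_all add: in_Hom)
  have "k\<^sup>\<star> \<cdot> ((r\<^sup>\<star> \<cdot> r \<oplus> s\<^sup>\<star> \<cdot> s) \<cdot> k) = \<one> M" by (simp only: biproduct_sum[OF P]) simp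
  then have aa: "(a\<^sup>\<star> \<oplus> a\<^sup>\<star>) \<cdot> a = \<one> M" using ab by (simp add: a_def b_def)
  define u where "u = b \<cdot> (a\<^sup>\<star> \<oplus> a\<^sup>\<star>)"
  have u: "u \<in> Hom C V W" by (simp add: u_def in_Hom)
  note [simp] = HomD[OF u]
  have ue: "u \<cdot> e j = t j" if "j \<in> I" for j
  proof -
    note [simp] = HomD[OF q(1)[OF that]]
    have "u \<cdot> (a \<cdot> q j) = b \<cdot> (((a\<^sup>\<star> \<oplus> a\<^sup>\<star>) \<cdot> a) \<cdot> q j)" by (simp add: u_def)
    then show ?thesis using aq bq that by (simp add: aa)
  qed
  \<comment> \<open>Since \<open>e\<close> is jointly epic, being isometric is a statement about
    Gram entries, where it reduces to the hypothesis \<open>gram\<close>.\<close>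
  have "u\<^sup>\<star> \<cdot> u = \<one> V"
  proof (rule jointly_epic_gram[OF e(2,1)])
    fix i j assume ij: "i \<in> I" "j \<in> I"
    note [simp] = HomD[OF e(1)[OF ij(1)]] HomD[OF e(1)[OF ij(2)]]
    have "(u \<cdot> e i)\<^sup>\<star> \<cdot> (u \<cdot> e j) = (e i)\<^sup>\<star> \<cdot> e j" using ue ij gram by simp
    then show "(e i)\<^sup>\<star> \<cdot> ((u\<^sup>\<star> \<cdot> u) \<cdot> e j) = (e i)\<^sup>\<star> \<cdot> (\<one> V \<cdot> e j)" by simp
  qed (simp_all add: in_Hom VW)
  then show ?thesis using isometryI[OF u] u ue by blast
qed

lemma ex_isometric_factor:
  assumes e: "e \<in> Hom C X V" "epic e V" and t: "t \<in> Hom C X W" and gram: "e\<^sup>\<star> \<cdot> e = t\<^sup>\<star> \<cdot> t"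
  shows "\<exists>u\<in>Hom C V W. isometry C u \<and> u \<cdot> e = t"
  using ex_isometric_extension[of "{()}" "\<lambda>_. e" "\<lambda>_. X" V "\<lambda>_. t" W] assms HomD[OF e(1)] HomD[OF t] by auto

text \<open>A further entry \<open>z\<close> fills the inequality up to an equality: the column of
  \<open>z\<close> and \<open>t\<close> has the Gram element of \<open>e\<close>, so it factors
  isometrically through \<open>e\<close>, and projecting to \<open>W\<close> leaves a
  contraction.\<close>

lemma ex_contractive_factor:
  assumes e: "e \<in> Hom C X V" "epic e V" and t: "t \<in> Hom C X W" and le: "herm_le C X (t\<^sup>\<star> \<cdot> t) (e\<^sup>\<star> \<cdot> e)"
  shows "\<exists>u\<in>Hom C V W. contraction C u \<and> u \<cdot> e = t"
proof -
  obtain Z z where z: "z \<in> Hom C X Z" "z\<^sup>\<star> \<cdot> z \<oplus> t\<^sup>\<star> \<cdot> t = e\<^sup>\<star> \<cdot> e" using le herm_le_iff by blast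
  obtain P r s h where P: "orthonormal_product C Z W P r s" and h: "h \<in> Hom C X P" "s \<cdot> h = t" "h\<^sup>\<star> \<cdot> h = z\<^sup>\<star> \<cdot> z \<oplus> t\<^sup>\<star> \<cdot> t"
    using ex_pair[OF z(1) t] by blast
  obtain i where i: "i \<in> Hom C V P" "isometry C i" "i \<cdot> e = h"
    using ex_isometric_factor[OF e h(1)] z(2) h(3) by auto
  note [simp] = HomD[OF e(1)] HomD[OF i(1)] biproductD[OF P]
  have "contraction C (s \<cdot> i)"
    by (rule contraction_comp[OF isometry_contraction[OF i(2,1)] i(1) biproduct_isometry(4)[OF P]]) (simp add: in_Hom)
  then show ?thesis using h(2) i(3) by (intro bexI[of _ "s \<cdot> i"]) (simp_all add: in_Hom)
qed

text \<open>Passing to the image keeps \<open>z\<^sup>\<star> \<cdot> z\<close> and makes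
  \<open>z\<close> epic, so that comparisons between defects are unique. This is what makes the
  defects of a cocone functorial.\<close>

lemma ex_epic_defect:
  assumes f: "contraction C f" "f \<in> Hom C X Y"
  shows "\<exists>Z z. z \<in> Hom C X Z \<and> epic z Z \<and> z\<^sup>\<star> \<cdot> z \<oplus> f\<^sup>\<star> \<cdot> f = \<one> X"
proof -
  obtain Z z where z: "z \<in> Hom C X Z" "z\<^sup>\<star> \<cdot> z \<oplus> f\<^sup>\<star> \<cdot> f = \<one> X" using contractionD(2)[OF f] by blast
  obtain M k q where k: "k \<in> Hom C M Z" "isometry C k" "q \<in> Hom C X M" "k \<cdot> q = z" "epic q M"
    using ex_image[OF z(1)] by blast
  note [simp] = HomD[OF k(1)] HomD[OF k(3)] isometryD[OF k(2,1)]
  have "z\<^sup>\<star> \<cdot> z = q\<^sup>\<star> \<cdot> q" by (simp flip: k(4))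
  then show ?thesis using z(2) k(3,5) by auto
qed

end

section \<open>Contractions versus \<open>\<ell>\<^sup>2\<close>-limits and isometries\<close>

lemma wide_subcat_simps [simp]:
  "Obj (wide_subcat C S) = Obj C" "Ide (wide_subcat C S) = Ide C" "Comp (wide_subcat C S) = Comp C"
  "f \<in> Hom (wide_subcat C S) X Y \<longleftrightarrow> f \<in> Hom C X Y \<and> f \<in> S"
  by (auto simp: wide_subcat_def Hom_def)

lemma directed_diagram_wide_subcat:
  "directed_diagram (wide_subcat C S) J r X f \<longleftrightarrow>
    directed_diagram C J r X f \<and> (\<forall>j k. (j, k) \<in> r \<longrightarrow> f j k \<in> S)"
  by (auto simp: directed_diagram_def)

lemma is_cocone_wide_subcat:
  "is_cocone (wide_subcat C S) J r X f Y g \<longleftrightarrow> is_cocone C J r X f Y g \<and> (\<forall>j\<in>J. g j \<in> S)"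
  by (auto simp: is_cocone_def)

lemma (in category) category_wide_subcat:
  assumes ide: "\<And>X. X \<in> Obj C \<Longrightarrow> \<one> X \<in> S"
    and comp: "\<And>f g X Y Z. f \<in> Hom C X Y \<Longrightarrow> g \<in> Hom C Y Z \<Longrightarrow> f \<in> S \<Longrightarrow> g \<in> S \<Longrightarrow> g \<cdot> f \<in> S"
  shows "category (wide_subcat C S)"
proof
  show "f \<in> Arr (wide_subcat C S) \<Longrightarrow> Dom (wide_subcat C S) f \<in> Obj (wide_subcat C S)"
    "f \<in> Arr (wide_subcat C S) \<Longrightarrow> Cod (wide_subcat C S) f \<in> Obj (wide_subcat C S)" for f
    by (auto simp: wide_subcat_def)
qed (auto intro: ide_in_Hom ide comp comp_in_Hom comp_assoc comp_ide_left comp_ide_right)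

lemma codirected_diagramD:
  assumes "codirected_diagram C J r X f"
  shows "directed_set J r" "\<And>j. j \<in> J \<Longrightarrow> X j \<in> Obj C"
    "\<And>j k. (j, k) \<in> r \<Longrightarrow> f j k \<in> Hom C (X k) (X j)"
    "\<And>j. j \<in> J \<Longrightarrow> f j j = \<one>\<^bsub>C\<^esub> (X j)"
    "\<And>j k l. (j, k) \<in> r \<Longrightarrow> (k, l) \<in> r \<Longrightarrow> f j k \<cdot>\<^bsub>C\<^esub> f k l = f j l"
    "\<And>j k. (j, k) \<in> r \<Longrightarrow> j \<in> J" "\<And>j k. (j, k) \<in> r \<Longrightarrow> k \<in> J"
  using assms directed_setD(2)[of J r] by (auto simp: codirected_diagram_def)

lemma is_coneD:
  assumes "is_cone C J r X f Y g"
  shows "Y \<in> Obj C" "\<And>j. j \<in> J \<Longrightarrow> g j \<in> Hom C Y (X j)"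
    "\<And>j k. (j, k) \<in> r \<Longrightarrow> f j k \<cdot>\<^bsub>C\<^esub> g k = g j"
  using assms by (auto simp: is_cone_def)

context star_category
begin

lemma codirected_diagram_star:
  assumes "directed_diagram C J r X f"
  shows "codirected_diagram C J r X (\<lambda>j k. (f j k)\<^sup>\<star>)"
proof -
  note D = directed_diagramD[OF assms]
  have "(f j k)\<^sup>\<star> \<cdot> (f k l)\<^sup>\<star> = (f j l)\<^sup>\<star>" if "(j, k) \<in> r" "(k, l) \<in> r" for j k l
    using HomD[OF D(3)[OF that(1)]] HomD[OF D(3)[OF that(2)]] by (simp flip: D(5)[OF that])
  then show ?thesis using D star_in_Hom by (auto simp: codirected_diagram_def)
qed

lemma directed_diagram_star:
  assumes "codirected_diagram C J r X f"
  shows "directed_diagram C J r X (\<lambda>j k. (f j k)\<^sup>\<star>)"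
proof -
  note D = codirected_diagramD[OF assms]
  have "(f k l)\<^sup>\<star> \<cdot> (f j k)\<^sup>\<star> = (f j l)\<^sup>\<star>" if "(j, k) \<in> r" "(k, l) \<in> r" for j k l
    using HomD[OF D(3)[OF that(1)]] HomD[OF D(3)[OF that(2)]] by (simp flip: D(5)[OF that])
  then show ?thesis using D star_in_Hom by (auto simp: directed_diagram_def)
qed

lemma is_cone_star:
  assumes "is_cocone C J r X f Y g" and f: "\<And>j k. (j, k) \<in> r \<Longrightarrow> f j k \<in> Hom C (X j) (X k)"
    and r: "r \<subseteq> J \<times> J"
  shows "is_cone C J r X (\<lambda>j k. (f j k)\<^sup>\<star>) Y (\<lambda>j. (g j)\<^sup>\<star>)"
proof -
  note G = is_coconeD[OF assms(1)]
  have "(f j k)\<^sup>\<star> \<cdot> (g k)\<^sup>\<star> = (g j)\<^sup>\<star>" if "(j, k) \<in> r" for j k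
  proof -
    have "k \<in> J" using r that by auto
    then show ?thesis using HomD[OF f[OF that]] HomD[OF G(2)[of k]] by (simp flip: G(3)[OF that])
  qed
  then show ?thesis using G star_in_Hom by (auto simp: is_cone_def)
qed

lemma is_cocone_star:
  assumes "is_cone C J r X f Y g" and f: "\<And>j k. (j, k) \<in> r \<Longrightarrow> f j k \<in> Hom C (X k) (X j)"
    and r: "r \<subseteq> J \<times> J"
  shows "is_cocone C J r X (\<lambda>j k. (f j k)\<^sup>\<star>) Y (\<lambda>j. (g j)\<^sup>\<star>)"
proof -
  note G = is_coneD[OF assms(1)]
  have "(g k)\<^sup>\<star> \<cdot> (f j k)\<^sup>\<star> = (g j)\<^sup>\<star>" if "(j, k) \<in> r" for j k
  proof -
    have "k \<in> J" using r that by auto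
    then show ?thesis using HomD[OF f[OF that]] HomD[OF G(2)[of k]] by (simp flip: G(3)[OF that])
  qed
  then show ?thesis using G star_in_Hom by (auto simp: is_cocone_def)
qed

end

section \<open>Limits of bounded cones and colimits of contractions\<close>

context pre_hilbert_category
begin

lemma contraction_ide: "X \<in> Obj C \<Longrightarrow> contraction C (\<one> X)"
  using isometry_contraction[OF isometry_ide ide_in_Hom] by simp

lemma category_contraction_subcat: "category (contraction_subcat C)"
  unfolding contraction_subcat_def
  by (rule category_wide_subcat) (auto intro: contraction_ide contraction_comp)

lemma category_isometry_subcat: "category (isometry_subcat C)"
  unfolding isometry_subcat_def
  by (rule category_wide_subcat) (auto intro: isometry_ide isometry_comp)

lemma Hom_contraction_subcat [simp]:
  "f \<in> Hom (contraction_subcat C) X Y \<longleftrightarrow> f \<in> Hom C X Y \<and> contraction C f"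
  "Obj (contraction_subcat C) = Obj C" "Ide (contraction_subcat C) = Ide C" "Comp (contraction_subcat C) = Comp C"
  by (auto simp: contraction_subcat_def)

lemma Hom_isometry_subcat [simp]:
  "f \<in> Hom (isometry_subcat C) X Y \<longleftrightarrow> f \<in> Hom C X Y \<and> isometry C f"
  "Obj (isometry_subcat C) = Obj C" "Ide (isometry_subcat C) = Ide C" "Comp (isometry_subcat C) = Comp C"
  by (auto simp: isometry_subcat_def)

lemma directed_diagram_contraction_subcat:
  "directed_diagram (contraction_subcat C) J r X f \<longleftrightarrow>
    directed_diagram C J r X f \<and> (\<forall>j k. (j, k) \<in> r \<longrightarrow> contraction C (f j k))"
  by (simp add: contraction_subcat_def directed_diagram_wide_subcat)

lemma directed_diagram_isometry_subcat:
  "directed_diagram (isometry_subcat C) J r X f \<longleftrightarrow>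
    directed_diagram C J r X f \<and> (\<forall>j k. (j, k) \<in> r \<longrightarrow> isometry C (f j k))"
  by (simp add: isometry_subcat_def directed_diagram_wide_subcat)

lemma is_cocone_contraction_subcat:
  "is_cocone (contraction_subcat C) J r X f Y g \<longleftrightarrow> is_cocone C J r X f Y g \<and> (\<forall>j\<in>J. contraction C (g j))"
  by (simp add: contraction_subcat_def is_cocone_wide_subcat)

lemma is_cocone_isometry_subcat:
  "is_cocone (isometry_subcat C) J r X f Y g \<longleftrightarrow> is_cocone C J r X f Y g \<and> (\<forall>j\<in>J. isometry C (g j))"
  by (simp add: isometry_subcat_def is_cocone_wide_subcat)

lemma directed_diagram_contraction_if_isometry:
  assumes "directed_diagram (isometry_subcat C) J r X f"
  shows "directed_diagram (contraction_subcat C) J r X f"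
proof -
  have dd: "directed_diagram C J r X f" and iso: "\<And>j k. (j, k) \<in> r \<Longrightarrow> isometry C (f j k)"
    using assms by (simp_all add: directed_diagram_isometry_subcat)
  have "contraction C (f j k)" if "(j, k) \<in> r" for j k
    by (rule isometry_contraction[OF iso[OF that] directed_diagramD(3)[OF dd that]])
  then show ?thesis using dd by (simp add: directed_diagram_contraction_subcat)
qed

lemma is_cocone_contraction_if_isometry:
  assumes "is_cocone (isometry_subcat C) J r X f Y g"
  shows "is_cocone (contraction_subcat C) J r X f Y g"
proof -
  have gc: "is_cocone C J r X f Y g" and iso: "\<And>j. j \<in> J \<Longrightarrow> isometry C (g j)"
    using assms by (simp_all add: is_cocone_isometry_subcat)
  have "contraction C (g j)" if "j \<in> J" for j
    by (rule isometry_contraction[OF iso[OF that] is_coconeD(2)[OF gc that]])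
  then show ?thesis using gc by (simp add: is_cocone_contraction_subcat)
qed

lemma l2_cone_contractions:
  assumes g: "is_cone C J r X f Y g" and con: "\<And>j. j \<in> J \<Longrightarrow> contraction C (g j)"
  shows "l2_cone C J r X f Y g"
proof -
  note G = is_coneD[OF g]
  have "herm_le C Y ((g j)\<^sup>\<star> \<cdot> g j) (\<one> Y)" if "j \<in> J" for j
    by (rule contractionD(1)[OF con[OF that] G(2)[OF that]])
  moreover have "\<one> Y \<in> Herm C Y" using G(1) by (simp add: Herm_def in_Hom)
  ultimately show ?thesis using g unfolding l2_cone_def herm_bdd_above_def by blast
qed

text \<open>Under the involution a cocone of contractions becomes a cone bounded by the identity,
  and the supremum clause of the limit keeps projections and mediators contractive.\<close>

lemma hilbert_imp_contraction_colimits: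
  assumes "hilbert_category TYPE('j) C"
  shows "has_directed_colimits TYPE('j) (contraction_subcat C)"
  unfolding has_directed_colimits_def
proof (intro allI impI)
  fix J :: "'j set" and r X f assume "directed_diagram (contraction_subcat C) J r X f"
  then have dd: "directed_diagram C J r X f" and con: "\<And>j k. (j, k) \<in> r \<Longrightarrow> contraction C (f j k)"
    by (auto simp: directed_diagram_contraction_subcat)
  note D = directed_diagramD[OF dd] and r = directed_setD(2)[OF directed_diagramD(1)[OF dd]]
  let ?f = "\<lambda>j k. (f j k)\<^sup>\<star>"
  have "\<forall>(j, k)\<in>r. contraction C (?f j k)" using contraction_star con D(3) by blast
  then obtain L p where Lp: "l2_limit C J r X ?f L p"
    using assms codirected_diagram_star[OF dd] unfolding hilbert_category_def by blast
  then have cone: "l2_cone C J r X ?f L p" by (simp add: l2_limit_def)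
  have uni: "\<exists>u\<in>Hom C Y L. (\<forall>j\<in>J. p j \<cdot> u = g j)" if "l2_cone C J r X ?f Y g" for Y g
    using Lp that unfolding l2_limit_def by blast
  have uniq: "u = v" if "l2_cone C J r X ?f Y g" "u \<in> Hom C Y L" "v \<in> Hom C Y L"
    "\<And>j. j \<in> J \<Longrightarrow> p j \<cdot> u = g j" "\<And>j. j \<in> J \<Longrightarrow> p j \<cdot> v = g j" for Y g u v
    using Lp that unfolding l2_limit_def by blast
  have sup: "herm_is_sup C Y ((\<lambda>j. (g j)\<^sup>\<star> \<cdot> g j) ` J) (u\<^sup>\<star> \<cdot> u)"
    if "l2_cone C J r X ?f Y g" "u \<in> Hom C Y L" "\<And>j. j \<in> J \<Longrightarrow> p j \<cdot> u = g j" for Y g u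
    using Lp that unfolding l2_limit_def by blast
  note P = is_coneD[OF cone[unfolded l2_cone_def, THEN conjunct1]]
  have L: "L \<in> Obj C" using P(1) .
  \<comment> \<open>The identity mediates from the limit cone to itself, so the supremum of the Gram
    elements of the \<open>p j\<close> is the identity.\<close>
  have pcon: "contraction C (p j)" if "j \<in> J" for j
    using sup[OF cone ide_in_Hom[OF L] comp_ide_right[OF P(2)]] contraction_iff[OF P(2)[OF that]] that L
    by (auto simp: herm_is_sup_def)
  have l2: "l2_cone C J r X ?f Y (\<lambda>j. (g j)\<^sup>\<star>)" if g: "is_cocone (contraction_subcat C) J r X f Y g" for Y g
  proof -
    have gc: "is_cocone C J r X f Y g" and gcon: "\<And>j. j \<in> J \<Longrightarrow> contraction C (g j)"
      using g by (auto simp: is_cocone_contraction_subcat)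
    note G = is_coconeD[OF gc]
    show ?thesis
      by (rule l2_cone_contractions[OF is_cone_star[OF gc D(3) r]], assumption)
        (rule contraction_star[OF gcon G(2)])
  qed
  have "is_colimit (contraction_subcat C) J r X f L (\<lambda>j. (p j)\<^sup>\<star>)"
  proof (rule is_colimitI)
    have "is_cocone C J r X (\<lambda>j k. (?f j k)\<^sup>\<star>) L (\<lambda>j. (p j)\<^sup>\<star>)"
      by (rule is_cocone_star[OF cone[unfolded l2_cone_def, THEN conjunct1] star_in_Hom[OF D(3)] r])
    then have "is_cocone C J r X f L (\<lambda>j. (p j)\<^sup>\<star>)"
      using HomD(1)[OF D(3)] by (auto simp: is_cocone_def)
    then show "is_cocone (contraction_subcat C) J r X f L (\<lambda>j. (p j)\<^sup>\<star>)"
      using contraction_star[OF pcon P(2)] by (simp add: is_cocone_contraction_subcat)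
    fix Y g assume g: "is_cocone (contraction_subcat C) J r X f Y g"
    then have gc: "is_cocone C J r X f Y g" and gcon: "\<And>j. j \<in> J \<Longrightarrow> contraction C (g j)"
      by (auto simp: is_cocone_contraction_subcat)
    note G = is_coconeD[OF gc]
    show "\<exists>u\<in>Hom (contraction_subcat C) L Y. \<forall>j\<in>J. u \<cdot>\<^bsub>contraction_subcat C\<^esub> (p j)\<^sup>\<star> = g j"
    proof -
      obtain u where u: "u \<in> Hom C Y L" "\<And>j. j \<in> J \<Longrightarrow> p j \<cdot> u = (g j)\<^sup>\<star>" using uni[OF l2[OF g]] by blast
      note [simp] = HomD[OF u(1)]
      \<comment> \<open>The identity bounds the Gram elements of the cone, and
        \<open>u\<^sup>\<star> \<cdot> u\<close> is their least bound.\<close>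
      have "herm_is_sup C Y ((\<lambda>j. ((g j)\<^sup>\<star>)\<^sup>\<star> \<cdot> (g j)\<^sup>\<star>) ` J) (u\<^sup>\<star> \<cdot> u)"
        by (rule sup[OF l2[OF g] u(1) u(2)])
      moreover have "herm_le C Y (((g j)\<^sup>\<star>)\<^sup>\<star> \<cdot> (g j)\<^sup>\<star>) (\<one> Y)" if "j \<in> J" for j
        using contractionD(1)[OF contraction_star[OF gcon G(2)] star_in_Hom[OF G(2)]] that by blast
      moreover have "\<one> Y \<in> Herm C Y" by (simp add: Herm_def in_Hom)
      ultimately have "contraction C u"
        unfolding contraction_iff[OF u(1)] herm_is_sup_def by blast
      moreover have "u\<^sup>\<star> \<cdot> (p j)\<^sup>\<star> = g j" if "j \<in> J" for j
        using arg_cong[OF u(2)[OF that], of "Star C"] HomD[OF P(2)[OF that]] HomD[OF G(2)[OF that]] by simp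
      ultimately show ?thesis
        using contraction_star[OF _ u(1)] star_in_Hom[OF u(1)] by (intro bexI[of _ "u\<^sup>\<star>"]) simp_all
    qed
    fix u v assume "u \<in> Hom (contraction_subcat C) L Y" "v \<in> Hom (contraction_subcat C) L Y"
      and uv: "\<And>j. j \<in> J \<Longrightarrow> u \<cdot>\<^bsub>contraction_subcat C\<^esub> (p j)\<^sup>\<star> = g j"
        "\<And>j. j \<in> J \<Longrightarrow> v \<cdot>\<^bsub>contraction_subcat C\<^esub> (p j)\<^sup>\<star> = g j"
    then have u: "u \<in> Hom C L Y" and v: "v \<in> Hom C L Y" by auto
    note [simp] = HomD[OF u] HomD[OF v]
    have "p j \<cdot> u\<^sup>\<star> = (g j)\<^sup>\<star>" "p j \<cdot> v\<^sup>\<star> = (g j)\<^sup>\<star>" if "j \<in> J" for j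
      using uv[OF that] HomD[OF P(2)[OF that]] by (auto dest: arg_cong[of _ _ "Star C"])
    then have "u\<^sup>\<star> = v\<^sup>\<star>"
      using uniq[OF l2[OF g], of "u\<^sup>\<star>" "v\<^sup>\<star>"] star_in_Hom[OF u] star_in_Hom[OF v] by blast
    then show "u = v" by (simp add: star_eq_iff)
  qed
  then show "\<exists>L c. is_colimit (contraction_subcat C) J r X f L c" by blast
qed

text \<open>\<open>h\<close> acts as a square root of the bound \<open>b\<close>. Comparison with
  one Gram element exhibits \<open>b\<close> as positive, and the image makes \<open>h\<close> epic,
  so that cones bounded by \<open>b\<close> can be divided by \<open>h\<close>.\<close>

lemma ex_epic_root:
  assumes b: "herm_le C A (g\<^sup>\<star> \<cdot> g) b" and g: "g \<in> Hom C A X"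
  shows "\<exists>V h. h \<in> Hom C A V \<and> epic h V \<and> h\<^sup>\<star> \<cdot> h = b"
proof -
  obtain Z z where z: "z \<in> Hom C A Z" "z\<^sup>\<star> \<cdot> z \<oplus> g\<^sup>\<star> \<cdot> g = b" using b herm_le_iff by blast
  obtain P h where h: "h \<in> Hom C A P" "h\<^sup>\<star> \<cdot> h = z\<^sup>\<star> \<cdot> z \<oplus> g\<^sup>\<star> \<cdot> g" using ex_pair[OF z(1) g] by blast
  obtain M k q where k: "k \<in> Hom C M P" "isometry C k" "q \<in> Hom C A M" "k \<cdot> q = h" "epic q M"
    using ex_image[OF h(1)] by blast
  note [simp] = HomD[OF k(1)] HomD[OF k(3)] isometryD[OF k(2,1)]
  have "h\<^sup>\<star> \<cdot> h = q\<^sup>\<star> \<cdot> q" by (simp flip: k(4))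
  then show ?thesis using h(2) z(2) k(3,5) by auto
qed

lemma contraction_colimit_is_l2_limit:
  assumes cd: "codirected_diagram C J r X f" and con: "\<And>j k. (j, k) \<in> r \<Longrightarrow> contraction C (f j k)"
    and colim: "is_colimit (contraction_subcat C) J r X (\<lambda>j k. (f j k)\<^sup>\<star>) L c"
  shows "l2_limit C J r X f L (\<lambda>j. (c j)\<^sup>\<star>)"
proof -
  note D = codirected_diagramD[OF cd]
  note S = directed_setD[OF D(1)]
  note K0 = is_colimitD(1)[OF colim, unfolded is_cocone_contraction_subcat]
  note K = is_coconeD[OF K0[THEN conjunct1]]
  define p where "p j = (c j)\<^sup>\<star>" for j
  have p: "p j \<in> Hom C L (X j)" if "j \<in> J" for j unfolding p_def by (rule star_in_Hom[OF K(2)[OF that]])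
  have pcon: "contraction C (p j)" if "j \<in> J" for j
    unfolding p_def using contraction_star[OF _ K(2)[OF that]] K0 that by blast
  have cone: "is_cone C J r X f L p"
  proof -
    have "is_cone C J r X (\<lambda>j k. ((f j k)\<^sup>\<star>)\<^sup>\<star>) L p"
      unfolding p_def by (rule is_cone_star[OF K0[THEN conjunct1] star_in_Hom[OF D(3)] S(2)])
    then show ?thesis using HomD(1)[OF D(3)] by (auto simp: is_cone_def)
  qed
  have cocone: "is_cocone (contraction_subcat C) J r X (\<lambda>j k. (f j k)\<^sup>\<star>) V (\<lambda>j. (t j)\<^sup>\<star>)"
    if t: "is_cone C J r X f V t" "\<And>j. j \<in> J \<Longrightarrow> contraction C (t j)" for V t
    using is_cocone_star[OF t(1) D(3) S(2)] contraction_star[OF t(2) is_coneD(2)[OF t(1)]]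
    by (simp add: is_cocone_contraction_subcat)
  \<comment> \<open>Keeping \<open>b\<close> arbitrary pays off in \<open>sup\<close>: the mediator
    is unique, hence the same for every bound, and its Gram element lies below each of them.\<close>
  have mediator: "\<exists>u\<in>Hom C Y L. (\<forall>j\<in>J. p j \<cdot> u = g j) \<and> herm_le C Y (u\<^sup>\<star> \<cdot> u) b"
    if g: "is_cone C J r X f Y g" and b: "\<And>j. j \<in> J \<Longrightarrow> herm_le C Y ((g j)\<^sup>\<star> \<cdot> g j) b" for Y g b
  proof -
    note G = is_coneD[OF g]
    obtain j0 where j0: "j0 \<in> J" using S(1) by blast
    obtain V h where h: "h \<in> Hom C Y V" "epic h V" "h\<^sup>\<star> \<cdot> h = b"
      using ex_epic_root[OF b[OF j0] G(2)[OF j0]] by blast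
    note [simp] = HomD[OF h(1)]
    have "\<exists>t\<in>Hom C V (X j). contraction C t \<and> t \<cdot> h = g j" if "j \<in> J" for j
      by (rule ex_contractive_factor[OF h(1,2) G(2)[OF that]]) (use b[OF that] h(3) in simp)
    then obtain t where t: "\<And>j. j \<in> J \<Longrightarrow> t j \<in> Hom C V (X j)" "\<And>j. j \<in> J \<Longrightarrow> contraction C (t j)"
      "\<And>j. j \<in> J \<Longrightarrow> t j \<cdot> h = g j" by metis
    have "f j k \<cdot> t k = t j" if jk: "(j, k) \<in> r" for j k
    proof (rule epicD[OF h(2)])
      have j: "j \<in> J" and k: "k \<in> J" using D(6,7) jk by blast+
      note [simp] = HomD[OF D(3)[OF jk]] HomD[OF t(1)[OF k]]
      show "f j k \<cdot> t k \<in> Hom C V (X j)" "t j \<in> Hom C V (X j)" using t(1)[OF j] by (simp_all add: in_Hom)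
      show "(f j k \<cdot> t k) \<cdot> h = t j \<cdot> h" using t(3) j k G(3)[OF jk] by simp
    qed
    then have tc: "is_cone C J r X f V t" using t(1) by (auto simp: is_cone_def)
    obtain w where w: "w \<in> Hom C L V" "contraction C w" "\<And>j. j \<in> J \<Longrightarrow> w \<cdot> c j = (t j)\<^sup>\<star>"
      using is_colimitD(2)[OF colim cocone[OF tc t(2)]] by auto
    note [simp] = HomD[OF w(1)]
    have "p j \<cdot> (w\<^sup>\<star> \<cdot> h) = g j" if "j \<in> J" for j
    proof -
      note [simp] = HomD[OF K(2)[OF that]] HomD[OF t(1)[OF that]]
      have "p j \<cdot> w\<^sup>\<star> = t j" using arg_cong[OF w(3)[OF that], of "Star C"] by (simp add: p_def)
      from comp_reassoc[OF this, of h] show ?thesis using t(3)[OF that] by (simp add: p_def)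
    qed
    moreover have "herm_le C Y (h\<^sup>\<star> \<cdot> (((w\<^sup>\<star>)\<^sup>\<star> \<cdot> w\<^sup>\<star>) \<cdot> h)) (h\<^sup>\<star> \<cdot> (\<one> V \<cdot> h))"
      by (rule herm_le_conj[OF contractionD(1)[OF contraction_star[OF w(2,1)] star_in_Hom[OF w(1)]] h(1)])
    then have "herm_le C Y ((w\<^sup>\<star> \<cdot> h)\<^sup>\<star> \<cdot> (w\<^sup>\<star> \<cdot> h)) b" using h(3) by simp
    ultimately show ?thesis by (intro bexI[of _ "w\<^sup>\<star> \<cdot> h"]) (auto simp: in_Hom)
  qed
  \<comment> \<open>The colimit separates only contractions. A common root \<open>h\<close> of
    \<open>u\<^sup>\<star> \<cdot> u \<oplus> v\<^sup>\<star> \<cdot> v\<close> rescales the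
    arbitrary arrows \<open>u\<close> and \<open>v\<close> to contractions \<open>u'\<close> and
    \<open>v'\<close>.\<close>
  have unique: "u = v" if u: "u \<in> Hom C Y L" and v: "v \<in> Hom C Y L"
    and eq: "\<And>j. j \<in> J \<Longrightarrow> p j \<cdot> u = p j \<cdot> v" for Y u v
  proof -
    note [simp] = HomD[OF u] HomD[OF v]
    have le: "herm_le C Y (u\<^sup>\<star> \<cdot> u) (u\<^sup>\<star> \<cdot> u \<oplus> v\<^sup>\<star> \<cdot> v)" "herm_le C Y (v\<^sup>\<star> \<cdot> v) (u\<^sup>\<star> \<cdot> u \<oplus> v\<^sup>\<star> \<cdot> v)"
      by (rule herm_leI[OF Herm_gram[OF u] v], simp add: plus_comm)
        (rule herm_leI[OF Herm_gram[OF v] u], simp)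
    obtain V h where h: "h \<in> Hom C Y V" "epic h V" "h\<^sup>\<star> \<cdot> h = u\<^sup>\<star> \<cdot> u \<oplus> v\<^sup>\<star> \<cdot> v"
      using ex_epic_root[OF le(1) u] by blast
    obtain u' v' where u': "u' \<in> Hom C V L" "contraction C u'" "u' \<cdot> h = u"
      and v': "v' \<in> Hom C V L" "contraction C v'" "v' \<cdot> h = v"
      using ex_contractive_factor[OF h(1,2) u] ex_contractive_factor[OF h(1,2) v] le h(3) by auto
    note [simp] = HomD[OF h(1)] HomD[OF u'(1)] HomD[OF v'(1)]
    have pu: "p j \<cdot> u' = p j \<cdot> v'" if "j \<in> J" for j
    proof (rule epicD[OF h(2)])
      note [simp] = HomD[OF p[OF that]]
      show "p j \<cdot> u' \<in> Hom C V (X j)" "p j \<cdot> v' \<in> Hom C V (X j)" by (simp_all add: in_Hom)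
      show "(p j \<cdot> u') \<cdot> h = (p j \<cdot> v') \<cdot> h" using eq[OF that] u'(3) v'(3) by simp
    qed
    have "is_cone C J r X f V (\<lambda>j. p j \<cdot> u')"
    proof -
      have "f j k \<cdot> (p k \<cdot> u') = p j \<cdot> u'" if jk: "(j, k) \<in> r" for j k
        using comp_reassoc[OF is_coneD(3)[OF cone jk], of u'] HomD[OF D(3)[OF jk]] HomD[OF p[OF D(7)[OF jk]]] by simp
      then show ?thesis using comp_in_Hom[OF u'(1) p] by (auto simp: is_cone_def)
    qed
    then have cc: "is_cocone (contraction_subcat C) J r X (\<lambda>j k. (f j k)\<^sup>\<star>) V (\<lambda>j. (p j \<cdot> u')\<^sup>\<star>)"
      by (rule cocone) (rule contraction_comp[OF u'(2,1) pcon p])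
    have u'c: "u'\<^sup>\<star> \<cdot> c j = (p j \<cdot> u')\<^sup>\<star>" if "j \<in> J" for j
      using HomD[OF K(2)[OF that]] by (simp add: p_def)
    have v'c: "v'\<^sup>\<star> \<cdot> c j = (p j \<cdot> u')\<^sup>\<star>" if "j \<in> J" for j
      unfolding pu[OF that] using HomD[OF K(2)[OF that]] by (simp add: p_def)
    have "u'\<^sup>\<star> = v'\<^sup>\<star>"
      using u'c v'c is_colimitD(3)[OF colim cc, of "u'\<^sup>\<star>" "v'\<^sup>\<star>"] contraction_star[OF u'(2,1)] contraction_star[OF v'(2,1)]
        star_in_Hom[OF u'(1)] star_in_Hom[OF v'(1)] by simp
    then show ?thesis using u'(3) v'(3) by (simp add: star_eq_iff)
  qed
  have sup: "herm_is_sup C Y ((\<lambda>j. (g j)\<^sup>\<star> \<cdot> g j) ` J) (u\<^sup>\<star> \<cdot> u)"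
    if g: "is_cone C J r X f Y g" and u: "u \<in> Hom C Y L" and pu: "\<And>j. j \<in> J \<Longrightarrow> p j \<cdot> u = g j" for Y g u
    unfolding herm_is_sup_def
  proof (intro conjI ballI impI)
    note [simp] = HomD[OF u]
    show "u\<^sup>\<star> \<cdot> u \<in> Herm C Y" by (rule Herm_gram[OF u])
    fix a assume "a \<in> (\<lambda>j. (g j)\<^sup>\<star> \<cdot> g j) ` J"
    then obtain j where j: "j \<in> J" "a = (g j)\<^sup>\<star> \<cdot> g j" by blast
    note [simp] = HomD[OF p[OF j(1)]]
    have "herm_le C Y (u\<^sup>\<star> \<cdot> (((p j)\<^sup>\<star> \<cdot> p j) \<cdot> u)) (u\<^sup>\<star> \<cdot> (\<one> L \<cdot> u))"
      by (rule herm_le_conj[OF contractionD(1)[OF pcon[OF j(1)] p[OF j(1)]] u])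
    then show "herm_le C Y a (u\<^sup>\<star> \<cdot> u)" by (simp add: j(2) flip: pu[OF j(1)])
  next
    fix b assume "b \<in> Herm C Y" "\<forall>a\<in>(\<lambda>j. (g j)\<^sup>\<star> \<cdot> g j) ` J. herm_le C Y a b"
    then obtain v where v: "v \<in> Hom C Y L" "\<And>j. j \<in> J \<Longrightarrow> p j \<cdot> v = g j" "herm_le C Y (v\<^sup>\<star> \<cdot> v) b"
      using mediator[OF g, of b] by auto
    then have "v = u" using unique[OF v(1) u] pu by simp
    then show "herm_le C Y (u\<^sup>\<star> \<cdot> u) b" using v(3) by simp
  qed
  have "l2_cone C J r X f L p" by (rule l2_cone_contractions[OF cone pcon])
  moreover have "\<exists>!u. u \<in> Hom C Y L \<and> (\<forall>j\<in>J. p j \<cdot> u = g j)" if g: "l2_cone C J r X f Y g" for Y g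
  proof -
    obtain b where "\<And>j. j \<in> J \<Longrightarrow> herm_le C Y ((g j)\<^sup>\<star> \<cdot> g j) b"
      using g unfolding l2_cone_def herm_bdd_above_def by blast
    then obtain u where u: "u \<in> Hom C Y L" "\<forall>j\<in>J. p j \<cdot> u = g j"
      using mediator[of Y g b] g unfolding l2_cone_def by blast
    show ?thesis
      by (rule ex1I[of _ u]) (use u unique in auto)
  qed
  moreover have "is_cone C J r X f Y g" if "l2_cone C J r X f Y g" for Y g
    using that by (simp add: l2_cone_def)
  ultimately have "l2_limit C J r X f L p" unfolding l2_limit_def using sup by blast
  then show ?thesis by (simp add: p_def[abs_def])
qed

lemma contraction_colimits_imp_hilbert:
  assumes "has_directed_colimits TYPE('j) (contraction_subcat C)"
  shows "hilbert_category TYPE('j) C"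
  unfolding hilbert_category_def
proof (intro conjI allI impI)
  fix J :: "'j set" and r X f
  assume cd: "codirected_diagram C J r X f" and "\<forall>(j, k)\<in>r. contraction C (f j k)"
  then have con: "\<And>j k. (j, k) \<in> r \<Longrightarrow> contraction C (f j k)" by auto
  have "directed_diagram (contraction_subcat C) J r X (\<lambda>j k. (f j k)\<^sup>\<star>)"
    using directed_diagram_star[OF cd] contraction_star[OF con codirected_diagramD(3)[OF cd]]
    by (auto simp: directed_diagram_contraction_subcat)
  then obtain L c where "is_colimit (contraction_subcat C) J r X (\<lambda>j k. (f j k)\<^sup>\<star>) L c"
    using assms unfolding has_directed_colimits_def by blast
  from contraction_colimit_is_l2_limit[OF cd con this] show "\<exists>L p. l2_limit C J r X f L p" by blast
qed (rule pre_hilbert_category_axioms)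

lemma is_colimit_isometry_if_contraction:
  assumes dd: "directed_diagram (isometry_subcat C) J r X f"
    and colim: "is_colimit (contraction_subcat C) J r X f L c"
  shows "is_colimit (isometry_subcat C) J r X f L c"
proof -
  have ddC: "directed_diagram C J r X f" and iso: "\<And>j k. (j, k) \<in> r \<Longrightarrow> isometry C (f j k)"
    using dd by (auto simp: directed_diagram_isometry_subcat)
  note D = directed_diagramD[OF ddC]
  note S = directed_setD[OF D(1)]
  note K0 = is_colimitD(1)[OF colim, unfolded is_cocone_contraction_subcat]
  note K = is_coconeD[OF K0[THEN conjunct1]]
  have ciso: "isometry C (c i)" if i: "i \<in> J" for i
  proof -
    obtain n where n: "\<And>k. k \<in> J \<Longrightarrow> (i, n k) \<in> r" "\<And>k. k \<in> J \<Longrightarrow> (k, n k) \<in> r"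
      using S(5)[OF i] by metis
    \<comment> \<open>The expected value of \<open>(c i)\<^sup>\<star> \<cdot> c k\<close>. It may
      be computed at any bound of \<open>i\<close> and \<open>k\<close>, because a further
      transition is isometric and cancels.\<close>
    define g where "g k = (f i (n k))\<^sup>\<star> \<cdot> f k (n k)" for k
    have later: "(f i l)\<^sup>\<star> \<cdot> f k l = (f i m)\<^sup>\<star> \<cdot> f k m" if "(i, l) \<in> r" "(k, l) \<in> r" "(l, m) \<in> r" for k l m
    proof -
      note [simp] = HomD[OF D(3)[OF that(1)]] HomD[OF D(3)[OF that(2)]] HomD[OF D(3)[OF that(3)]]
        isometryD[OF iso D(3), OF that(3) that(3)]
      show ?thesis by (simp flip: D(5)[OF that(1) that(3)] D(5)[OF that(2) that(3)])
    qed
    have g: "g k = (f i l)\<^sup>\<star> \<cdot> f k l" if l: "(i, l) \<in> r" "(k, l) \<in> r" for k l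
    proof -
      have k: "k \<in> J" using D(6) l by blast
      obtain m where m: "(n k, m) \<in> r" "(l, m) \<in> r" using S(5)[OF D(7)[OF n(1)[OF k]] D(7)[OF l(1)]] by blast
      show ?thesis using later[OF n(1,2)[OF k] m(1)] later[OF l m(2)] by (simp add: g_def)
    qed
    have gh: "g k \<in> Hom C (X k) (X i)" "contraction C (g k)" if k: "k \<in> J" for k
    proof -
      note f1 = D(3)[OF n(1)[OF k]] and f2 = D(3)[OF n(2)[OF k]]
      show "g k \<in> Hom C (X k) (X i)" unfolding g_def by (rule comp_in_Hom[OF f2 star_in_Hom[OF f1]])
      show "contraction C (g k)" unfolding g_def
        by (rule contraction_comp[OF isometry_contraction[OF iso[OF n(2)[OF k]] f2] f2
              isometry_star_contraction[OF iso[OF n(1)[OF k]] f1] star_in_Hom[OF f1]])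
    qed
    have "g l \<cdot> f k l = g k" if kl: "(k, l) \<in> r" for k l
    proof -
      have l: "l \<in> J" using D(7) kl by blast
      note f1 = D(3)[OF n(1)[OF l]] and f2 = D(3)[OF n(2)[OF l]]
      note [simp] = HomD[OF D(3)[OF kl]] HomD[OF f1] HomD[OF f2]
      have "g l \<cdot> f k l = (f i (n l))\<^sup>\<star> \<cdot> f k (n l)" by (simp add: g_def D(5)[OF kl n(2)[OF l]])
      then show ?thesis using g[OF n(1)[OF l] transD[OF S(4) kl n(2)[OF l]]] by simp
    qed
    then have gc: "is_cocone (contraction_subcat C) J r X f (X i) g"
      using gh D(2)[OF i] by (auto simp: is_cocone_contraction_subcat is_cocone_def)
    obtain u where u: "u \<in> Hom C L (X i)" "contraction C u" "u \<cdot> c i = g i"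
      using is_colimitD(2)[OF colim gc] i by auto
    have gi: "g i = \<one> (X i)" using g[OF S(3)[OF i] S(3)[OF i]] D(4)[OF i] D(2)[OF i] by simp
    note [simp] = HomD[OF u(1)] HomD[OF K(2)[OF i]]
    \<comment> \<open>As \<open>u\<close> is contractive and \<open>u \<cdot> c i\<close> is the
      identity, the Gram element of \<open>c i\<close> is at least the identity; contractivity of
      \<open>c i\<close> gives the reverse.\<close>
    have "herm_le C (X i) ((c i)\<^sup>\<star> \<cdot> ((u\<^sup>\<star> \<cdot> u) \<cdot> c i)) ((c i)\<^sup>\<star> \<cdot> (\<one> L \<cdot> c i))"
      by (rule herm_le_conj[OF contractionD(1)[OF u(2,1)] K(2)[OF i]])
    moreover have "(c i)\<^sup>\<star> \<cdot> ((u\<^sup>\<star> \<cdot> u) \<cdot> c i) = (u \<cdot> c i)\<^sup>\<star> \<cdot> (u \<cdot> c i)" by simp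
    ultimately have "herm_le C (X i) (\<one> (X i)) ((c i)\<^sup>\<star> \<cdot> c i)" unfolding u(3) gi by simp
    moreover have "herm_le C (X i) ((c i)\<^sup>\<star> \<cdot> c i) (\<one> (X i))"
      using contractionD(1)[OF _ K(2)[OF i]] K0 i by blast
    ultimately show ?thesis using isometryI[OF K(2)[OF i]] herm_le_antisym by blast
  qed
  show ?thesis
  proof (rule is_colimitI)
    show "is_cocone (isometry_subcat C) J r X f L c"
      using K0 ciso by (auto simp: is_cocone_isometry_subcat)
    fix Y g assume g: "is_cocone (isometry_subcat C) J r X f Y g"
    note G = is_coconeD[OF g[unfolded is_cocone_isometry_subcat, THEN conjunct1]]
    show "\<exists>u\<in>Hom (isometry_subcat C) L Y. \<forall>j\<in>J. u \<cdot>\<^bsub>isometry_subcat C\<^esub> c j = g j"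
    proof -
      obtain u where u: "u \<in> Hom C L Y" "contraction C u" "\<And>j. j \<in> J \<Longrightarrow> u \<cdot> c j = g j"
        using is_colimitD(2)[OF colim is_cocone_contraction_if_isometry[OF g]] by auto
      obtain Z h where h: "h \<in> Hom C L Z" "h\<^sup>\<star> \<cdot> h \<oplus> u\<^sup>\<star> \<cdot> u = \<one> L"
        using contractionD(2)[OF u(2,1)] by blast
      note [simp] = HomD[OF u(1)] HomD[OF h(1)]
      \<comment> \<open>Both \<open>c j\<close> and \<open>g j = u \<cdot> c j\<close> are
        isometric, so compressing \<open>h\<^sup>\<star> \<cdot> h \<oplus> u\<^sup>\<star> \<cdot>
        u = \<one> L\<close> by \<open>c j\<close> leaves nothing for \<open>h\<close>.\<close>
      have hc: "h \<cdot> c j = \<zero> (X j) Z" if j: "j \<in> J" for j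
      proof -
        note [simp] = HomD[OF K(2)[OF j]] isometryD[OF ciso[OF j] K(2)[OF j]]
        have gi: "(g j)\<^sup>\<star> \<cdot> g j = \<one> (X j)"
          using g j isometryD(1)[OF _ G(2)[OF j]] by (auto simp: is_cocone_isometry_subcat)
        have "(h \<cdot> c j)\<^sup>\<star> \<cdot> (h \<cdot> c j) \<oplus> (u \<cdot> c j)\<^sup>\<star> \<cdot> (u \<cdot> c j) = (c j)\<^sup>\<star> \<cdot> ((h\<^sup>\<star> \<cdot> h \<oplus> u\<^sup>\<star> \<cdot> u) \<cdot> c j)"
          by simp
        also have "\<dots> = \<zero> (X j) (X j) \<oplus> \<one> (X j)" unfolding h(2) by simp
        finally have "(h \<cdot> c j)\<^sup>\<star> \<cdot> (h \<cdot> c j) \<oplus> \<one> (X j) = \<zero> (X j) (X j) \<oplus> \<one> (X j)"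
          unfolding u(3)[OF j] gi .
        then have "(h \<cdot> c j)\<^sup>\<star> \<cdot> (h \<cdot> c j) = \<zero> (X j) (X j)"
          by (rule plus_cancel[rotated 3]) (simp_all add: in_Hom)
        then show ?thesis by (rule star_comp_self_zero[rotated]) (simp add: in_Hom)
      qed
      \<comment> \<open>Mediators are known to be unique among contractions, so \<open>h\<close> and
        the zero arrow are first seen to be contractive.\<close>
      have "contraction C h"
        by (rule contractionI[OF h(1) u(1)]) (use h(2) plus_comm[of "h\<^sup>\<star> \<cdot> h" "u\<^sup>\<star> \<cdot> u"] in simp)
      moreover have "contraction C (\<zero> L Z)"
        by (rule contractionI[of _ L Z "\<one> L" L]) (simp_all add: in_Hom)
      moreover have "is_cocone (contraction_subcat C) J r X f Z (\<lambda>j. h \<cdot> c j)"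
      proof -
        have "(h \<cdot> c k) \<cdot> f j k = h \<cdot> c j" if jk: "(j, k) \<in> r" for j k
          using HomD[OF D(3)[OF jk]] HomD[OF K(2)[OF D(7)[OF jk]]] K(3)[OF jk] by simp
        moreover have "contraction C (h \<cdot> c j)" if "j \<in> J" for j
          by (rule contraction_comp[OF _ K(2)[OF that] \<open>contraction C h\<close> h(1)]) (use K0 that in blast)
        ultimately show ?thesis using comp_in_Hom[OF K(2) h(1)]
          by (auto simp: is_cocone_contraction_subcat is_cocone_def)
      qed
      moreover have "\<zero> L Z \<cdot> c j = h \<cdot> c j" if "j \<in> J" for j
        using hc[OF that] HomD[OF K(2)[OF that]] by simp
      ultimately have "h = \<zero> L Z"
        using is_colimitD(3)[OF colim, of Z "\<lambda>j. h \<cdot> c j" h "\<zero> L Z"] h(1) by (simp add: in_Hom)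
      then have "isometry C u" using isometryI[OF u(1)] h(2) by simp
      then show ?thesis using u(1,3) by (intro bexI[of _ u]) simp_all
    qed
    fix u v assume "u \<in> Hom (isometry_subcat C) L Y" "v \<in> Hom (isometry_subcat C) L Y"
      "\<And>j. j \<in> J \<Longrightarrow> u \<cdot>\<^bsub>isometry_subcat C\<^esub> c j = g j" "\<And>j. j \<in> J \<Longrightarrow> v \<cdot>\<^bsub>isometry_subcat C\<^esub> c j = g j"
    then show "u = v" using is_colimitD(3)[OF colim is_cocone_contraction_if_isometry[OF g], of u v] isometry_contraction by auto
  qed
qed

lemma contraction_colimits_imp_isometry_colimits:
  assumes "has_directed_colimits TYPE('j) (contraction_subcat C)"
  shows "has_directed_colimits TYPE('j) (isometry_subcat C)"
  unfolding has_directed_colimits_def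
proof (intro allI impI)
  fix J :: "'j set" and r X f assume dd: "directed_diagram (isometry_subcat C) J r X f"
  then have "directed_diagram (contraction_subcat C) J r X f"
    by (rule directed_diagram_contraction_if_isometry)
  then obtain L c where "is_colimit (contraction_subcat C) J r X f L c"
    using assms unfolding has_directed_colimits_def by blast
  then show "\<exists>L c. is_colimit (isometry_subcat C) J r X f L c"
    using is_colimit_isometry_if_contraction[OF dd] by blast
qed

end

section \<open>From isometric to contractive colimits\<close>

context pre_hilbert_category
begin

text \<open>The kernel \<open>k\<close> of the difference contains the diagram, so the colimit property provides a right
  inverse of \<open>k\<close>.\<close>

lemma isometric_colimit_ext:
  assumes dd: "directed_diagram (isometry_subcat C) J r X f"
    and colim: "is_colimit (isometry_subcat C) J r X f L c"
    and x: "x \<in> Hom C L Y" and y: "y \<in> Hom C L Y" and eq: "\<And>j. j \<in> J \<Longrightarrow> x \<cdot> c j = y \<cdot> c j"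
  shows "x = y"
proof (rule eq_if_difference_zero[OF x y])
  have ddC: "directed_diagram C J r X f"
    using dd by (auto simp: directed_diagram_isometry_subcat)
  note D = directed_diagramD[OF ddC]
  note K0 = is_colimitD(1)[OF colim, unfolded is_cocone_isometry_subcat]
  note K = is_coconeD[OF K0[THEN conjunct1]]
  have ciso: "isometry C (c j)" if "j \<in> J" for j using K0 that by blast
  fix d assume d: "d \<in> Hom C L Y" "d \<oplus> y = x"
  note [simp] = HomD[OF d(1)] HomD[OF y]
  obtain M k where k: "k \<in> Hom C M L" "isometry C k" "d \<cdot> k = \<zero> M Y"
    "\<And>W g. g \<in> Hom C W L \<Longrightarrow> d \<cdot> g = \<zero> W Y \<Longrightarrow> k \<cdot> (k\<^sup>\<star> \<cdot> g) = g"
    using ex_kernel[OF d(1)] by blast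
  note [simp] = HomD[OF k(1)] isometryD[OF k(2,1)]
  have kc: "k \<cdot> (k\<^sup>\<star> \<cdot> c j) = c j" if j: "j \<in> J" for j
  proof (rule k(4)[OF K(2)[OF j]])
    note [simp] = HomD[OF K(2)[OF j]]
    have "d \<cdot> c j \<oplus> y \<cdot> c j = \<zero> (X j) Y \<oplus> y \<cdot> c j" using eq[OF j] by (simp flip: d(2))
    then show "d \<cdot> c j = \<zero> (X j) Y" by (rule plus_cancel[rotated 3]) (simp_all add: in_Hom)
  qed
  have "is_cocone (isometry_subcat C) J r X f M (\<lambda>j. k\<^sup>\<star> \<cdot> c j)"
  proof -
    have "(k\<^sup>\<star> \<cdot> c j) \<cdot> f i j = k\<^sup>\<star> \<cdot> c i" if "(i, j) \<in> r" for i j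
      using HomD[OF K(2)[OF D(7)[OF that]]] HomD[OF D(3)[OF that]] K(3)[OF that] by simp
    moreover have "isometry C (k\<^sup>\<star> \<cdot> c j)" "k\<^sup>\<star> \<cdot> c j \<in> Hom C (X j) M" if j: "j \<in> J" for j
    proof -
      note [simp] = HomD[OF K(2)[OF j]] isometryD[OF ciso[OF j] K(2)[OF j]]
      show h: "k\<^sup>\<star> \<cdot> c j \<in> Hom C (X j) M" by (simp add: in_Hom)
      show "isometry C (k\<^sup>\<star> \<cdot> c j)" by (rule isometryI[OF h]) (simp add: kc[OF j])
    qed
    ultimately show ?thesis by (simp add: is_cocone_isometry_subcat is_cocone_def split_beta)
  qed
  then obtain m where m: "m \<in> Hom C L M" "isometry C m" "\<And>j. j \<in> J \<Longrightarrow> m \<cdot> c j = k\<^sup>\<star> \<cdot> c j"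
    using is_colimitD(2)[OF colim] by fastforce
  note [simp] = HomD[OF m(1)]
  have "k \<cdot> m = \<one> L"
  proof (rule is_colimitD(3)[OF colim is_colimitD(1)[OF colim]])
    show "k \<cdot> m \<in> Hom (isometry_subcat C) L L" "\<one> L \<in> Hom (isometry_subcat C) L L"
      using isometry_comp[OF m(2) k(2) m(1) k(1)] isometry_ide by (simp_all add: in_Hom)
    fix j assume j: "j \<in> J"
    note [simp] = HomD[OF K(2)[OF j]]
    show "(k \<cdot> m) \<cdot>\<^bsub>isometry_subcat C\<^esub> c j = c j" "\<one> L \<cdot>\<^bsub>isometry_subcat C\<^esub> c j = c j"
      using m(3)[OF j] kc[OF j] by simp_all
  qed
  then have "d = (d \<cdot> k) \<cdot> m" by simp
  then show "d = \<zero> L Y" using k(3) by simp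
qed

text \<open>The defects form a diagram of the same shape, so \<open>has\<close> is asked for just
  this \<open>J\<close> and \<open>r\<close>. This admits index sets outside the universe type, such
  as the finite parts of a chain.\<close>

lemma ex_contractive_mediator:
  assumes dd: "directed_diagram (isometry_subcat C) J r X f"
    and has: "\<And>D v. directed_diagram (isometry_subcat C) J r D v \<Longrightarrow>
      \<exists>L c. is_colimit (isometry_subcat C) J r D v L c"
    and colim: "is_colimit (isometry_subcat C) J r X f L c"
    and g: "is_cocone (contraction_subcat C) J r X f Y g"
  shows "\<exists>u\<in>Hom C L Y. contraction C u \<and> (\<forall>j\<in>J. u \<cdot> c j = g j)"
proof -
  have ddC: "directed_diagram C J r X f" and iso: "\<And>j k. (j, k) \<in> r \<Longrightarrow> isometry C (f j k)"
    using dd by (auto simp: directed_diagram_isometry_subcat)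
  note D = directed_diagramD[OF ddC]
  note S = directed_setD[OF D(1)]
  note G0 = g[unfolded is_cocone_contraction_subcat]
  note G = is_coconeD[OF G0[THEN conjunct1]]
  have "\<exists>Z z. z \<in> Hom C (X j) Z \<and> epic z Z \<and> z\<^sup>\<star> \<cdot> z \<oplus> (g j)\<^sup>\<star> \<cdot> g j = \<one> (X j)" if "j \<in> J" for j
    by (rule ex_epic_defect[OF _ G(2)[OF that]]) (use G0 that in blast)
  then obtain Z z where z: "\<And>j. j \<in> J \<Longrightarrow> z j \<in> Hom C (X j) (Z j)" "\<And>j. j \<in> J \<Longrightarrow> epic (z j) (Z j)"
    "\<And>j. j \<in> J \<Longrightarrow> (z j)\<^sup>\<star> \<cdot> z j \<oplus> (g j)\<^sup>\<star> \<cdot> g j = \<one> (X j)" by metis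
  \<comment> \<open>Conjugating the defect of \<open>g k\<close> by the isometry
    \<open>f j k\<close> gives the defect of \<open>g j\<close>. So \<open>z k \<cdot> f j k\<close>
    and the epic \<open>z j\<close> have equal Gram elements and differ by an isometry.\<close>
  have "\<exists>v\<in>Hom C (Z j) (Z k). isometry C v \<and> v \<cdot> z j = z k \<cdot> f j k" if jk: "(j, k) \<in> r" for j k
  proof -
    have j: "j \<in> J" and k: "k \<in> J" using D(6,7) jk by blast+
    note [simp] = HomD[OF D(3)[OF jk]] HomD[OF z(1)[OF j]] HomD[OF z(1)[OF k]] HomD[OF G(2)[OF j]] HomD[OF G(2)[OF k]]
      isometryD[OF iso[OF jk] D(3)[OF jk]]
    have "(z k \<cdot> f j k)\<^sup>\<star> \<cdot> (z k \<cdot> f j k) \<oplus> (g k \<cdot> f j k)\<^sup>\<star> \<cdot> (g k \<cdot> f j k) =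
        (f j k)\<^sup>\<star> \<cdot> (((z k)\<^sup>\<star> \<cdot> z k \<oplus> (g k)\<^sup>\<star> \<cdot> g k) \<cdot> f j k)" by simp
    also have "\<dots> = (z j)\<^sup>\<star> \<cdot> z j \<oplus> (g j)\<^sup>\<star> \<cdot> g j" unfolding z(3)[OF j] z(3)[OF k] by simp
    finally have "(z k \<cdot> f j k)\<^sup>\<star> \<cdot> (z k \<cdot> f j k) \<oplus> (g j)\<^sup>\<star> \<cdot> g j = (z j)\<^sup>\<star> \<cdot> z j \<oplus> (g j)\<^sup>\<star> \<cdot> g j"
      unfolding G(3)[OF jk] .
    then have "(z k \<cdot> f j k)\<^sup>\<star> \<cdot> (z k \<cdot> f j k) = (z j)\<^sup>\<star> \<cdot> z j"
      by (rule plus_cancel[rotated 3]) (simp_all add: in_Hom)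
    then show ?thesis
      by (intro ex_isometric_factor[OF z(1,2)[OF j]]) (simp_all add: in_Hom)
  qed
  then have "\<exists>v. (j, k) \<in> r \<longrightarrow> v \<in> Hom C (Z j) (Z k) \<and> isometry C v \<and> v \<cdot> z j = z k \<cdot> f j k" for j k
    by blast
  then obtain v where v0: "\<And>j k. (j, k) \<in> r \<longrightarrow>
      v j k \<in> Hom C (Z j) (Z k) \<and> isometry C (v j k) \<and> v j k \<cdot> z j = z k \<cdot> f j k" by metis
  then have v: "v j k \<in> Hom C (Z j) (Z k)" "isometry C (v j k)" "v j k \<cdot> z j = z k \<cdot> f j k"
    if "(j, k) \<in> r" for j k using that by auto
  have vdd: "directed_diagram (isometry_subcat C) J r Z v"
  proof -
    have "v j j = \<one> (Z j)" if j: "j \<in> J" for j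
    proof (rule epicD[OF z(2)[OF j]])
      note [simp] = HomD[OF z(1)[OF j]]
      show "v j j \<in> Hom C (Z j) (Z j)" "\<one> (Z j) \<in> Hom C (Z j) (Z j)"
        using v(1)[OF S(3)[OF j]] by (simp_all add: in_Hom)
      show "v j j \<cdot> z j = \<one> (Z j) \<cdot> z j" using v(3)[OF S(3)[OF j]] D(4)[OF j] by simp
    qed
    moreover have "v k l \<cdot> v j k = v j l" if jk: "(j, k) \<in> r" and kl: "(k, l) \<in> r" for j k l
    proof (rule epicD[OF z(2)])
      show j: "j \<in> J" using D(6) jk by blast
      have jl: "(j, l) \<in> r" by (rule transD[OF S(4) jk kl])
      note [simp] = HomD[OF z(1)[OF j]] HomD[OF v(1)[OF jk]] HomD[OF v(1)[OF kl]] HomD[OF v(1)[OF jl]]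
        HomD[OF z(1)[OF D(7)[OF jk]]] HomD[OF z(1)[OF D(7)[OF kl]]] HomD[OF D(3)[OF jk]] HomD[OF D(3)[OF kl]]
      show "v k l \<cdot> v j k \<in> Hom C (Z j) (Z l)" "v j l \<in> Hom C (Z j) (Z l)" by (simp_all add: in_Hom)
      show "(v k l \<cdot> v j k) \<cdot> z j = v j l \<cdot> z j"
        using comp_reassoc[OF v(3)[OF kl], of "f j k"] by (simp add: v(3)[OF jk] v(3)[OF jl] D(5)[OF jk kl])
    qed
    moreover have "Z j \<in> Obj C" if "j \<in> J" for j using HomD(5)[OF z(1)[OF that]] .
    ultimately show ?thesis using v D(1)
      by (simp add: directed_diagram_isometry_subcat directed_diagram_def split_beta)
  qed
  obtain W \<delta> where W: "is_colimit (isometry_subcat C) J r Z v W \<delta>" using has[OF vdd] by blast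
  note W0 = is_colimitD(1)[OF W, unfolded is_cocone_isometry_subcat]
  note WK = is_coconeD[OF W0[THEN conjunct1]]
  obtain P a b where P: "orthonormal_product C Y W P a b"
    using ex_orthonormal_product[OF G(1) WK(1)] by blast
  note [simp] = biproductD[OF P]
  \<comment> \<open>The length that \<open>g j\<close> loses is stored in the colimit
    \<open>W\<close> of the defects; projecting the mediator of \<open>h\<close> along
    \<open>a\<close> recovers \<open>g\<close>.\<close>
  define h where "h j = a\<^sup>\<star> \<cdot> g j \<oplus> b\<^sup>\<star> \<cdot> (\<delta> j \<cdot> z j)" for j
  have h: "h j \<in> Hom C (X j) P" "isometry C (h j)" "a \<cdot> h j = g j" if j: "j \<in> J" for j
  proof -
    have di: "isometry C (\<delta> j)" using W0 j by blast
    note [simp] = HomD[OF z(1)[OF j]] HomD[OF G(2)[OF j]] HomD[OF WK(2)[OF j]] isometryD[OF di WK(2)[OF j]]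
    show hh: "h j \<in> Hom C (X j) P" by (simp add: h_def in_Hom)
    have "(h j)\<^sup>\<star> \<cdot> h j = (g j)\<^sup>\<star> \<cdot> g j \<oplus> (z j)\<^sup>\<star> \<cdot> z j" by (simp add: h_def)
    also have "\<dots> = \<one> (X j)" using z(3)[OF j] by (simp add: plus_comm)
    finally show "isometry C (h j)" by (rule isometryI[OF hh])
    show "a \<cdot> h j = g j" by (simp add: h_def)
  qed
  have "is_cocone (isometry_subcat C) J r X f P h"
  proof -
    have "h k \<cdot> f j k = h j" if jk: "(j, k) \<in> r" for j k
    proof -
      have j: "j \<in> J" and k: "k \<in> J" using D(6,7) jk by blast+
      note [simp] = HomD[OF D(3)[OF jk]] HomD[OF z(1)[OF j]] HomD[OF z(1)[OF k]] HomD[OF G(2)[OF k]]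
        HomD[OF WK(2)[OF k]] HomD[OF v(1)[OF jk]]
      have "\<delta> k \<cdot> (z k \<cdot> f j k) = \<delta> j \<cdot> z j"
        using comp_reassoc[OF WK(3)[OF jk], of "z j"] by (simp add: v(3)[OF jk])
      then show ?thesis by (simp add: h_def G(3)[OF jk])
    qed
    then show ?thesis using h by (simp add: is_cocone_isometry_subcat is_cocone_def split_beta)
  qed
  then obtain u where u: "u \<in> Hom C L P" "isometry C u" "\<And>j. j \<in> J \<Longrightarrow> u \<cdot> c j = h j"
    using is_colimitD(2)[OF colim] by fastforce
  note K = is_coconeD[OF is_colimitD(1)[OF colim, unfolded is_cocone_isometry_subcat, THEN conjunct1]]
  have "(a \<cdot> u) \<cdot> c j = g j" if j: "j \<in> J" for j
    using HomD[OF u(1)] HomD[OF K(2)[OF j]] by (simp add: u(3)[OF j] h(3)[OF j])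
  moreover have "contraction C (a \<cdot> u)"
    by (rule contraction_comp[OF isometry_contraction[OF u(2,1)] u(1) biproduct_isometry(3)[OF P] biproductD(1)[OF P]])
  moreover have "a \<cdot> u \<in> Hom C L Y" by (rule comp_in_Hom[OF u(1) biproductD(1)[OF P]])
  ultimately show ?thesis by blast
qed

end

text \<open>On a chain the condition prescribes all inner products \<open>(v j)\<^sup>\<star> v i\<close>, so jointly epic
  dilations of \<open>F \<subseteq> G\<close> are related by a unique isometry.\<close>

definition chain_dilation ::
    "('o, 'm, 'z) star_cat_scheme \<Rightarrow> 'j rel \<Rightarrow> ('j \<Rightarrow> 'o) \<Rightarrow> ('j \<Rightarrow> 'j \<Rightarrow> 'm) \<Rightarrow> 'j set \<Rightarrow> 'o \<Rightarrow> ('j \<Rightarrow> 'm) \<Rightarrow> bool" where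
  "chain_dilation C w X f F H v \<longleftrightarrow> H \<in> Obj C \<and> (\<forall>j\<in>F. v j \<in> Hom C (X j) H) \<and>
    (\<forall>i\<in>F. \<forall>j\<in>F. (i, j) \<in> w \<longrightarrow> (v j)\<^sup>\<star>\<^bsub>C\<^esub> \<cdot>\<^bsub>C\<^esub> v i = f i j)"

lemma finite_chain_has_max:
  assumes lin: "linear_order_on I w" and F: "finite F" "F \<noteq> {}" "F \<subseteq> I"
  shows "\<exists>m\<in>F. \<forall>j\<in>F. (j, m) \<in> w"
proof -
  have "directed_set F (w \<inter> F \<times> F)"
    by (rule linear_order_directed_set[OF linear_order_on_restrict[OF lin F(3)] F(2)])
  from finite_directed_upper_bound[OF this F(1)] show ?thesis by auto
qed

section \<open>Chains of contractions and their dilations\<close>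

locale contraction_chain = pre_hilbert_category C
  for C :: "('o, 'm, 'z) star_cat_scheme" (structure) +
  fixes I :: "'j set" and w X f
  assumes lin: "linear_order_on I w"
    and diagram: "directed_diagram (contraction_subcat C) I w X f"
begin

lemma underlying_diagram: "directed_diagram C I w X f"
  and contraction_step: "(j, k) \<in> w \<Longrightarrow> contraction C (f j k)"
  using diagram by (auto simp: directed_diagram_contraction_subcat)

lemmas diagramD = directed_diagramD[OF underlying_diagram]
lemmas orderD = directed_setD[OF diagramD(1)]

lemma total: "i \<in> I \<Longrightarrow> j \<in> I \<Longrightarrow> (i, j) \<in> w \<or> (j, i) \<in> w"
  using lin orderD(3)[of i] by (cases "i = j") (auto simp: linear_order_on_def total_on_def)

lemma antisym: "(i, j) \<in> w \<Longrightarrow> (j, i) \<in> w \<Longrightarrow> i = j"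
  using lin by (auto simp: linear_order_on_def partial_order_on_def antisym_def)

text \<open>A Markov dilation: the newest object sees the past only through its predecessor. With
  \<open>m\<close> the top of \<open>F\<close> and \<open>n\<close> the top of the rest, the new leg
  is \<open>v n \<cdot> (f n m)\<^sup>\<star>\<close> plus a fresh orthogonal part that makes it
  isometric; then \<open>f n m \<cdot> f i n = f i m\<close> produces its inner products with all
  older legs.\<close>

lemma ex_chain_dilation:
  assumes "finite F" "F \<noteq> {}" "F \<subseteq> I"
  shows "\<exists>H v. chain_dilation C w X f F H v"
  using assms
proof (induction F rule: finite_psubset_induct)
  case (psubset F)
  obtain m where m: "m \<in> F" "\<And>j. j \<in> F \<Longrightarrow> (j, m) \<in> w"
    using finite_chain_has_max[OF lin psubset(1,3,4)] by blast
  have mI: "m \<in> I" using m(1) psubset.prems by blast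
  show ?case
  proof (cases "F = {m}")
    case True
    have "chain_dilation C w X f F (X m) (\<lambda>_. \<one> (X m))"
      using diagramD(2,4)[OF mI] by (auto simp: chain_dilation_def True in_Hom)
    then show ?thesis by blast
  next
    case False
    let ?G = "F - {m}"
    have G: "finite ?G" "?G \<noteq> {}" "?G \<subseteq> I" "?G \<subset> F" using psubset False m(1) by auto
    obtain n where n: "n \<in> ?G" "\<And>j. j \<in> ?G \<Longrightarrow> (j, n) \<in> w" using finite_chain_has_max[OF lin G(1-3)] by blast
    obtain H v where H: "chain_dilation C w X f ?G H v" using psubset.IH[OF G(4,2,3)] by blast
    then have v: "H \<in> Obj C" "\<And>j. j \<in> ?G \<Longrightarrow> v j \<in> Hom C (X j) H"
      "\<And>i j. i \<in> ?G \<Longrightarrow> j \<in> ?G \<Longrightarrow> (i, j) \<in> w \<Longrightarrow> (v j)\<^sup>\<star> \<cdot> v i = f i j"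
      by (auto simp: chain_dilation_def)
    have nm: "(n, m) \<in> w" using m(2) n(1) by blast
    have nn: "(n, n) \<in> w" using orderD(3) n(1) G(3) by blast
    note fnm = diagramD(3)[OF nm]
    note [simp] = HomD[OF fnm] HomD[OF v(2)[OF n(1)]]
    obtain Z z where z: "z \<in> Hom C (X m) Z" "z\<^sup>\<star> \<cdot> z \<oplus> ((f n m)\<^sup>\<star>)\<^sup>\<star> \<cdot> (f n m)\<^sup>\<star> = \<one> (X m)"
      using contractionD(2)[OF contraction_star[OF contraction_step[OF nm] fnm] star_in_Hom[OF fnm]] by blast
    note [simp] = HomD[OF z(1)]
    obtain P r s where P: "orthonormal_product C H Z P r s" using ex_orthonormal_product[OF v(1)] by fastforce
    note [simp] = biproductD[OF P]
    define v' where "v' j = (if j = m then r\<^sup>\<star> \<cdot> (v n \<cdot> (f n m)\<^sup>\<star>) \<oplus> s\<^sup>\<star> \<cdot> z else r\<^sup>\<star> \<cdot> v j)" for j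
    have v'm: "v' m = r\<^sup>\<star> \<cdot> (v n \<cdot> (f n m)\<^sup>\<star>) \<oplus> s\<^sup>\<star> \<cdot> z" by (simp add: v'_def)
    have v'j: "v' j = r\<^sup>\<star> \<cdot> v j" if "j \<in> ?G" for j using that by (simp add: v'_def)
    have vn: "(v n)\<^sup>\<star> \<cdot> v n = \<one> (X n)" using v(3)[OF n(1) n(1) nn] diagramD(4) n(1) G(3) by auto
    have vnx: "(v n)\<^sup>\<star> \<cdot> (v n \<cdot> x) = x" if "x \<in> Arr C" "Cod C x = X n" for x
      using comp_reassoc[OF vn, of x] that by simp
    have mm: "(v' m)\<^sup>\<star> \<cdot> v' m = \<one> (X m)"
    proof -
      have "(v' m)\<^sup>\<star> \<cdot> v' m = f n m \<cdot> (f n m)\<^sup>\<star> \<oplus> z\<^sup>\<star> \<cdot> z" by (simp add: v'm vnx)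
      also have "\<dots> = \<one> (X m)" using z(2) plus_comm[of "z\<^sup>\<star> \<cdot> z" "f n m \<cdot> (f n m)\<^sup>\<star>"] by simp
      finally show ?thesis .
    qed
    have "chain_dilation C w X f F P v'"
      unfolding chain_dilation_def
    proof (intro conjI ballI impI)
      show "P \<in> Obj C" by simp
      show "v' j \<in> Hom C (X j) P" if "j \<in> F" for j
      proof (cases "j = m")
        case True
        then show ?thesis by (simp add: v'm in_Hom)
      next
        case False
        with that have "j \<in> ?G" by simp
        then show ?thesis using HomD[OF v(2)] by (simp add: v'j in_Hom)
      qed
      fix i j assume i: "i \<in> F" and j: "j \<in> F" and ij: "(i, j) \<in> w"
      show "(v' j)\<^sup>\<star> \<cdot> v' i = f i j"
      proof (cases "i = m")
        case True
        then have "j = m" using antisym ij m(2)[OF j] by blast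
        then show ?thesis using True mm diagramD(4)[OF mI] by simp
      next
        case False
        with i have iG: "i \<in> ?G" by simp
        note [simp] = HomD[OF v(2)[OF iG]]
        show ?thesis
        proof (cases "j = m")
          case True
          have "(v' m)\<^sup>\<star> \<cdot> v' i = f n m \<cdot> ((v n)\<^sup>\<star> \<cdot> v i)" by (simp add: v'm v'j[OF iG])
          also have "\<dots> = f i m" unfolding v(3)[OF iG n(1) n(2)[OF iG]] by (rule diagramD(5)[OF n(2)[OF iG] nm])
          finally show ?thesis using True by simp
        next
          case False
          with j have jG: "j \<in> ?G" by simp
          note [simp] = HomD[OF v(2)[OF jG]]
          show ?thesis using v(3)[OF iG jG ij] by (simp add: v'j[OF iG] v'j[OF jG])
        qed
      qed
    qed
    then show ?thesis by blast
  qed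
qed

text \<open>Cutting down to the joint image keeps all inner products, because \<open>k\<close> is
  isometric, and gains uniqueness of the comparison isometries, hence functoriality in
  \<open>F\<close>.\<close>

lemma ex_minimal_chain_dilation:
  assumes F: "finite F" "F \<noteq> {}" "F \<subseteq> I"
  shows "\<exists>H v. chain_dilation C w X f F H v \<and> jointly_epic F v H"
proof -
  obtain H v where "chain_dilation C w X f F H v" using ex_chain_dilation[OF F] by blast
  then have v: "H \<in> Obj C" "\<And>j. j \<in> F \<Longrightarrow> v j \<in> Hom C (X j) H"
    "\<And>i j. i \<in> F \<Longrightarrow> j \<in> F \<Longrightarrow> (i, j) \<in> w \<Longrightarrow> (v j)\<^sup>\<star> \<cdot> v i = f i j"
    by (auto simp: chain_dilation_def)
  obtain M k q where k: "k \<in> Hom C M H" "isometry C k"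
    and q: "\<And>j. j \<in> F \<Longrightarrow> q j \<in> Hom C (X j) M" "\<And>j. j \<in> F \<Longrightarrow> k \<cdot> q j = v j" "jointly_epic F q M"
    using ex_joint_image[where X = X, OF F(1) v(2,1)] by blast
  note [simp] = HomD[OF k(1)] isometryD[OF k(2,1)]
  have "(q j)\<^sup>\<star> \<cdot> q i = f i j" if "i \<in> F" "j \<in> F" "(i, j) \<in> w" for i j
    using HomD[OF q(1)[OF that(1)]] HomD[OF q(1)[OF that(2)]] v(3)[OF that]
    by (simp flip: q(2)[OF that(1)] q(2)[OF that(2)])
  then have "chain_dilation C w X f F M q" using q(1) by (simp add: chain_dilation_def)
  then show ?thesis using q(3) by blast
qed

lemma chain_dilation_gram:
  assumes H: "chain_dilation C w X f F H v" and H': "chain_dilation C w X f F' H' v'"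
    and ij: "i \<in> F" "j \<in> F" and sub: "F \<subseteq> F'" "F' \<subseteq> I"
  shows "(v i)\<^sup>\<star> \<cdot> v j = (v' i)\<^sup>\<star> \<cdot> v' j"
proof -
  have v: "v i \<in> Hom C (X i) H" "v j \<in> Hom C (X j) H" "v' i \<in> Hom C (X i) H'" "v' j \<in> Hom C (X j) H'"
    using assms by (auto simp: chain_dilation_def)
  note [simp] = HomD[OF v(1)] HomD[OF v(2)] HomD[OF v(3)] HomD[OF v(4)]
  consider "(j, i) \<in> w" | "(i, j) \<in> w" using total ij sub by blast
  then show ?thesis
  proof cases
    case 1
    then show ?thesis using H H' ij subsetD[OF sub(1)] by (simp add: chain_dilation_def)
  next
    case 2
    then have "(v j)\<^sup>\<star> \<cdot> v i = (v' j)\<^sup>\<star> \<cdot> v' i"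
      using H H' ij subsetD[OF sub(1)] by (simp add: chain_dilation_def)
    from arg_cong[OF this, of "Star C"] show ?thesis by simp
  qed
qed

text \<open>In \<open>V\<close> every \<open>X j\<close> sits isometrically by \<open>e j\<close>,
  but \<open>e k \<cdot> f j k\<close> and \<open>e j\<close> may still differ. Their difference
  comes from the kernel of the compression \<open>\<pi> {j, k}\<close> to \<open>X k\<close>, so the
  kernels of all \<open>\<pi> F\<close> are collected into the subobject \<open>t\<close> and
  divided out. This identifies no more than it should: a cocone \<open>g\<close> extends to
  \<open>V\<close> by \<open>g (mx F) \<cdot> \<pi> F\<close>, which vanishes on these
  kernels.\<close>

lemma ex_colimit:
  assumes has: "has_directed_colimits TYPE('u) (isometry_subcat C)" and inj: "inj_on (\<phi> :: 'j set \<Rightarrow> 'u) (Fpow I)"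
  shows "\<exists>L c. is_colimit (contraction_subcat C) I w X f L c"
proof -
  \<comment> \<open>The empty set is left out because each finite part must have a largest
    element.\<close>
  define \<F> where "\<F> = Fpow I - {{}}"
  have FI: "finite F" "F \<noteq> {}" "F \<subseteq> I" if "F \<in> \<F>" for F using that by (auto simp: \<F>_def Fpow_def)
  have sing: "{j} \<in> \<F>" if "j \<in> I" for j using that by (simp add: \<F>_def Fpow_def)
  have pair: "{i, j} \<in> \<F>" if "i \<in> I" "j \<in> I" for i j using that by (simp add: \<F>_def Fpow_def)
  have dir: "directed_set \<F> (incl \<F>)"
    by (rule directed_set_incl) (use orderD(1) in \<open>auto simp: \<F>_def Fpow_def\<close>)
  have \<F>sub: "\<F> \<subseteq> Fpow I" by (auto simp: \<F>_def)
  have colims: "\<exists>L c. is_colimit (isometry_subcat C) \<F> (incl \<F>) V v L c"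
    if "directed_diagram (isometry_subcat C) \<F> (incl \<F>) V v" for V v
    by (rule category.colimit_of_smaller_index[OF category_isometry_subcat has that inj_on_subset[OF inj \<F>sub]])

  have "\<exists>H v. chain_dilation C w X f F H v \<and> jointly_epic F v H" if "F \<in> \<F>" for F
    using ex_minimal_chain_dilation FI[OF that] by blast
  then obtain H v where dil: "\<And>F. F \<in> \<F> \<Longrightarrow> chain_dilation C w X f F (H F) (v F)"
    and epi: "\<And>F. F \<in> \<F> \<Longrightarrow> jointly_epic F (v F) (H F)" by metis
  have v: "H F \<in> Obj C" "\<And>j. j \<in> F \<Longrightarrow> v F j \<in> Hom C (X j) (H F)"
    "\<And>i j. i \<in> F \<Longrightarrow> j \<in> F \<Longrightarrow> (i, j) \<in> w \<Longrightarrow> (v F j)\<^sup>\<star> \<cdot> v F i = f i j" if "F \<in> \<F>" for F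
    using dil[OF that] by (auto simp: chain_dilation_def)
  have "\<exists>u\<in>Hom C (H F) (H G). isometry C u \<and> (\<forall>j\<in>F. u \<cdot> v F j = v G j)"
    if FG: "F \<in> \<F>" "G \<in> \<F>" "F \<subseteq> G" for F G
  proof (rule ex_isometric_extension)
    show "finite F" using FI FG by blast
    show "jointly_epic F (v F) (H F)" by (rule epi[OF FG(1)])
    show "v F j \<in> Hom C (X j) (H F)" "v G j \<in> Hom C (X j) (H G)" if "j \<in> F" for j
      using v FG that by auto
    show "(v F i)\<^sup>\<star> \<cdot> v F j = (v G i)\<^sup>\<star> \<cdot> v G j" if "i \<in> F" "j \<in> F" for i j
      by (rule chain_dilation_gram[OF dil[OF FG(1)] dil[OF FG(2)] that FG(3) FI(3)[OF FG(2)]])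
  qed (use v FG in auto)
  then have "\<exists>u. F \<in> \<F> \<and> G \<in> \<F> \<and> F \<subseteq> G \<longrightarrow>
      u \<in> Hom C (H F) (H G) \<and> isometry C u \<and> (\<forall>j\<in>F. u \<cdot> v F j = v G j)" for F G by blast
  then obtain \<iota> where \<iota>0: "\<And>F G. F \<in> \<F> \<and> G \<in> \<F> \<and> F \<subseteq> G \<longrightarrow>
      \<iota> F G \<in> Hom C (H F) (H G) \<and> isometry C (\<iota> F G) \<and> (\<forall>j\<in>F. \<iota> F G \<cdot> v F j = v G j)" by metis
  have \<iota>: "\<iota> F G \<in> Hom C (H F) (H G)" "isometry C (\<iota> F G)" "\<And>j. j \<in> F \<Longrightarrow> \<iota> F G \<cdot> v F j = v G j"
    if "F \<in> \<F>" "G \<in> \<F>" "F \<subseteq> G" for F G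
    using \<iota>0[of F G] that by auto
  have \<iota>_id: "\<iota> F F = \<one> (H F)" if F: "F \<in> \<F>" for F
  proof (rule jointly_epicD[OF epi[OF F]])
    show "\<iota> F F \<in> Hom C (H F) (H F)" "\<one> (H F) \<in> Hom C (H F) (H F)"
      using \<iota>(1)[OF F F] v(1)[OF F] by (auto intro: ide_in_Hom)
    show "\<iota> F F \<cdot> v F j = \<one> (H F) \<cdot> v F j" if "j \<in> F" for j
      using \<iota>(3)[OF F F _ that] HomD[OF v(2)[OF F that]] by simp
  qed
  have \<iota>_comp: "\<iota> G K \<cdot> \<iota> F G = \<iota> F K" if FGK: "F \<in> \<F>" "G \<in> \<F>" "K \<in> \<F>" "F \<subseteq> G" "G \<subseteq> K" for F G K
  proof (rule jointly_epicD[OF epi[OF FGK(1)]])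
    have FK: "F \<subseteq> K" using FGK by blast
    note fg = \<iota>[OF FGK(1,2,4)] and gk = \<iota>[OF FGK(2,3,5)] and fk = \<iota>[OF FGK(1,3) FK]
    show "\<iota> G K \<cdot> \<iota> F G \<in> Hom C (H F) (H K)" "\<iota> F K \<in> Hom C (H F) (H K)"
      using comp_in_Hom[OF fg(1) gk(1)] fk(1) by auto
    fix j assume j: "j \<in> F"
    then have jG: "j \<in> G" using FGK by blast
    show "(\<iota> G K \<cdot> \<iota> F G) \<cdot> v F j = \<iota> F K \<cdot> v F j"
      using HomD[OF fg(1)] HomD[OF gk(1)] HomD[OF v(2)[OF FGK(1) j]] fg(3)[OF j] gk(3)[OF jG] fk(3)[OF j]
      by simp
  qed
  have Hdd: "directed_diagram (isometry_subcat C) \<F> (incl \<F>) H \<iota>"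
    using dir v(1) \<iota>(1,2) \<iota>_id \<iota>_comp
    by (auto simp: directed_diagram_isometry_subcat directed_diagram_def)
  obtain V \<eta> where V: "is_colimit (isometry_subcat C) \<F> (incl \<F>) H \<iota> V \<eta>" using colims[OF Hdd] by blast
  note V0 = is_colimitD(1)[OF V, unfolded is_cocone_isometry_subcat]
  note VK = is_coconeD[OF V0[THEN conjunct1]]
  have \<eta>iso: "isometry C (\<eta> F)" if "F \<in> \<F>" for F using V0 that by blast
  define e where "e j = \<eta> {j} \<cdot> v {j} j" for j
  have e_eq: "\<eta> F \<cdot> v F j = e j" if F: "F \<in> \<F>" and j: "j \<in> F" for F j
  proof -
    have j1: "{j} \<in> \<F>" "{j} \<subseteq> F" using sing FI(3)[OF F] j by auto
    note s = \<iota>[OF j1(1) F j1(2)]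
    have "\<eta> F \<cdot> (\<iota> {j} F \<cdot> v {j} j) = \<eta> {j} \<cdot> v {j} j"
      by (rule comp_reassoc[OF VK(3)])
        (use j1 F HomD[OF s(1)] HomD[OF v(2)[OF j1(1), of j]] HomD[OF VK(2)[OF F]] in simp_all)
    then show ?thesis using s(3)[of j] by (simp add: e_def)
  qed
  have e: "e j \<in> Hom C (X j) V" if "j \<in> I" for j
    unfolding e_def by (rule comp_in_Hom[OF v(2)[OF sing[OF that]] VK(2)[OF sing[OF that]]]) simp
  have econ: "contraction C (e j)" if j: "j \<in> I" for j
  proof -
    note s = v(2)[OF sing[OF j], of j, OF singletonI]
    have "(v {j} j)\<^sup>\<star> \<cdot> v {j} j = \<one> (X j)" using v(3)[OF sing[OF j], of j j] orderD(3)[OF j] diagramD(4)[OF j] by simp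
    then have "isometry C (v {j} j)" by (rule isometryI[OF s])
    then have "isometry C (e j)" unfolding e_def
      by (rule isometry_comp[OF _ \<eta>iso[OF sing[OF j]] s VK(2)[OF sing[OF j]]])
    then show ?thesis by (rule isometry_contraction[OF _ e[OF j]])
  qed
  \<comment> \<open>Equality on the \<open>e j\<close> passes to each \<open>H F\<close> by joint
    epicness, and from there to \<open>V\<close> by \<open>isometric_colimit_ext\<close>.\<close>
  have e_ext: "x = y" if x: "x \<in> Hom C V Y" and y: "y \<in> Hom C V Y" and eq: "\<And>j. j \<in> I \<Longrightarrow> x \<cdot> e j = y \<cdot> e j" for x y Y
  proof (rule isometric_colimit_ext[OF Hdd V x y])
    fix F assume F: "F \<in> \<F>"
    show "x \<cdot> \<eta> F = y \<cdot> \<eta> F"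
    proof (rule jointly_epicD[OF epi[OF F]])
      show "x \<cdot> \<eta> F \<in> Hom C (H F) Y" "y \<cdot> \<eta> F \<in> Hom C (H F) Y"
        using comp_in_Hom[OF VK(2)[OF F]] x y by auto
      fix j assume j: "j \<in> F"
      then have "j \<in> I" using FI(3)[OF F] by blast
      then show "(x \<cdot> \<eta> F) \<cdot> v F j = (y \<cdot> \<eta> F) \<cdot> v F j"
        using HomD[OF x] HomD[OF y] HomD[OF VK(2)[OF F]] HomD[OF v(2)[OF F j]] e_eq[OF F j] eq by simp
    qed
  qed

  have "\<exists>m\<in>F. \<forall>j\<in>F. (j, m) \<in> w" if "F \<in> \<F>" for F
    by (rule finite_chain_has_max[OF lin FI[OF that]])
  then obtain mx where mx: "\<And>F. F \<in> \<F> \<Longrightarrow> mx F \<in> F" "\<And>F j. F \<in> \<F> \<Longrightarrow> j \<in> F \<Longrightarrow> (j, mx F) \<in> w" by metis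
  define \<pi> where "\<pi> F = (v F (mx F))\<^sup>\<star>" for F
  have \<pi>: "\<pi> F \<in> Hom C (H F) (X (mx F))" if "F \<in> \<F>" for F
    unfolding \<pi>_def by (rule star_in_Hom[OF v(2)[OF that mx(1)[OF that]]])
  have \<pi>v: "\<pi> F \<cdot> v F j = f j (mx F)" if "F \<in> \<F>" "j \<in> F" for F j
    unfolding \<pi>_def by (rule v(3)[OF that(1,2) mx(1)[OF that(1)] mx(2)[OF that]])
  \<comment> \<open>The target of \<open>\<pi>\<close> moves with the maximum, so naturality
    involves a transition of the original chain. On the generators \<open>v F j\<close> it is
    functoriality of \<open>f\<close>.\<close>
  have \<pi>nat: "\<pi> G \<cdot> \<iota> F G = f (mx F) (mx G) \<cdot> \<pi> F" if FG: "F \<in> \<F>" "G \<in> \<F>" "F \<subseteq> G" for F G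
  proof (rule jointly_epicD[OF epi[OF FG(1)]])
    have mm: "(mx F, mx G) \<in> w" using mx FG by blast
    note [simp] = HomD[OF \<pi>[OF FG(1)]] HomD[OF \<pi>[OF FG(2)]] HomD[OF \<iota>(1)[OF FG]] HomD[OF diagramD(3)[OF mm]]
    show "\<pi> G \<cdot> \<iota> F G \<in> Hom C (H F) (X (mx G))" "f (mx F) (mx G) \<cdot> \<pi> F \<in> Hom C (H F) (X (mx G))"
      by (simp_all add: in_Hom)
    fix j assume j: "j \<in> F"
    then have jG: "j \<in> G" using FG by blast
    note [simp] = HomD[OF v(2)[OF FG(1) j]]
    show "(\<pi> G \<cdot> \<iota> F G) \<cdot> v F j = (f (mx F) (mx G) \<cdot> \<pi> F) \<cdot> v F j"
      using \<iota>(3)[OF FG j] \<pi>v[OF FG(1) j] \<pi>v[OF FG(2) jG] diagramD(5)[OF mx(2)[OF FG(1) j] mm] by simp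
  qed
  have "\<exists>K k. k \<in> Hom C K (H F) \<and> isometry C k \<and> \<pi> F \<cdot> k = \<zero> K (X (mx F)) \<and>
      (\<forall>Y g. g \<in> Hom C Y (H F) \<longrightarrow> \<pi> F \<cdot> g = \<zero> Y (X (mx F)) \<longrightarrow> k \<cdot> (k\<^sup>\<star> \<cdot> g) = g)" if "F \<in> \<F>" for F
    by (rule ex_kernel[OF \<pi>[OF that]])
  then obtain Z z where z: "\<And>F. F \<in> \<F> \<Longrightarrow> z F \<in> Hom C (Z F) (H F)" "\<And>F. F \<in> \<F> \<Longrightarrow> isometry C (z F)"
    "\<And>F. F \<in> \<F> \<Longrightarrow> \<pi> F \<cdot> z F = \<zero> (Z F) (X (mx F))"
    "\<And>F Y g. F \<in> \<F> \<Longrightarrow> g \<in> Hom C Y (H F) \<Longrightarrow> \<pi> F \<cdot> g = \<zero> Y (X (mx F)) \<Longrightarrow> z F \<cdot> ((z F)\<^sup>\<star> \<cdot> g) = g"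
    by metis
  \<comment> \<open>Naturality of \<open>\<pi>\<close> sends the kernel of \<open>\<pi> F\<close>
    into that of \<open>\<pi> G\<close>; \<open>\<zeta> F G\<close> is the resulting restriction of
    \<open>\<iota> F G\<close>.\<close>
  define \<zeta> where "\<zeta> F G = (z G)\<^sup>\<star> \<cdot> (\<iota> F G \<cdot> z F)" for F G
  have \<zeta>: "\<zeta> F G \<in> Hom C (Z F) (Z G)" "z G \<cdot> \<zeta> F G = \<iota> F G \<cdot> z F" "isometry C (\<zeta> F G)"
    if FG: "F \<in> \<F>" "G \<in> \<F>" "F \<subseteq> G" for F G
  proof -
    have mm: "(mx F, mx G) \<in> w" using mx FG by blast
    note [simp] = HomD[OF z(1)[OF FG(1)]] HomD[OF z(1)[OF FG(2)]] HomD[OF \<iota>(1)[OF FG]] HomD[OF diagramD(3)[OF mm]]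
      HomD[OF \<pi>[OF FG(1)]] HomD[OF \<pi>[OF FG(2)]] isometryD[OF z(2,1)[OF FG(1)]] isometryD[OF \<iota>(2,1)[OF FG]]
    show h: "\<zeta> F G \<in> Hom C (Z F) (Z G)" by (simp add: \<zeta>_def in_Hom)
    show eq: "z G \<cdot> \<zeta> F G = \<iota> F G \<cdot> z F" unfolding \<zeta>_def
    proof (rule z(4)[OF FG(2)])
      show "\<iota> F G \<cdot> z F \<in> Hom C (Z F) (H G)" by (simp add: in_Hom)
      show "\<pi> G \<cdot> (\<iota> F G \<cdot> z F) = \<zero> (Z F) (X (mx G))"
        using comp_reassoc[OF \<pi>nat[OF FG], of "z F"] z(3)[OF FG(1)] by simp
    qed
    have "(\<zeta> F G)\<^sup>\<star> \<cdot> \<zeta> F G = (z F)\<^sup>\<star> \<cdot> ((\<iota> F G)\<^sup>\<star> \<cdot> (z G \<cdot> \<zeta> F G))"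
      using HomD[OF h] by (simp add: \<zeta>_def)
    then show "isometry C (\<zeta> F G)" by (intro isometryI[OF h]) (simp add: eq)
  qed
  have z_mono: "x = y" if F: "F \<in> \<F>" and "x \<in> Hom C Y (Z F)" "y \<in> Hom C Y (Z F)" and eq: "z F \<cdot> x = z F \<cdot> y" for F x y Y
    using HomD[OF that(2)] HomD[OF that(3)] isometryD[OF z(2,1)[OF F]] arg_cong[OF eq, of "\<lambda>t. (z F)\<^sup>\<star> \<cdot> t"] by simp
  have \<zeta>_id: "\<zeta> F F = \<one> (Z F)" if F: "F \<in> \<F>" for F
    using HomD[OF z(1)[OF F]] isometryD[OF z(2,1)[OF F]] \<iota>_id[OF F] by (simp add: \<zeta>_def)
  have \<zeta>_comp: "\<zeta> G K \<cdot> \<zeta> F G = \<zeta> F K" if FGK: "F \<in> \<F>" "G \<in> \<F>" "K \<in> \<F>" "F \<subseteq> G" "G \<subseteq> K" for F G K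
  proof (rule z_mono[OF FGK(3)])
    have FK: "F \<subseteq> K" using FGK by blast
    note fg = \<zeta>[OF FGK(1,2,4)] and gk = \<zeta>[OF FGK(2,3,5)] and fk = \<zeta>[OF FGK(1,3) FK]
    note i1 = \<iota>(1)[OF FGK(1,2,4)] and i2 = \<iota>(1)[OF FGK(2,3,5)]
    show "\<zeta> G K \<cdot> \<zeta> F G \<in> Hom C (Z F) (Z K)" "\<zeta> F K \<in> Hom C (Z F) (Z K)"
      using comp_in_Hom[OF fg(1) gk(1)] fk(1) by auto
    note [simp] = HomD[OF fg(1)] HomD[OF gk(1)] HomD[OF i1] HomD[OF i2] HomD[OF z(1)[OF FGK(1)]]
      HomD[OF z(1)[OF FGK(2)]] HomD[OF z(1)[OF FGK(3)]]
    have "z K \<cdot> (\<zeta> G K \<cdot> \<zeta> F G) = \<iota> G K \<cdot> (z G \<cdot> \<zeta> F G)"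
      using comp_reassoc[OF gk(2), of "\<zeta> F G"] by simp
    also have "\<dots> = \<iota> F K \<cdot> z F" unfolding fg(2) by (rule comp_reassoc[OF \<iota>_comp[OF FGK]]) simp_all
    finally show "z K \<cdot> (\<zeta> G K \<cdot> \<zeta> F G) = z K \<cdot> \<zeta> F K" unfolding fk(2) .
  qed
  have Zdd: "directed_diagram (isometry_subcat C) \<F> (incl \<F>) Z \<zeta>"
    using dir HomD(4)[OF z(1)] \<zeta>(1,3) \<zeta>_id \<zeta>_comp
    by (auto simp: directed_diagram_isometry_subcat directed_diagram_def)
  obtain T \<tau> where T: "is_colimit (isometry_subcat C) \<F> (incl \<F>) Z \<zeta> T \<tau>" using colims[OF Zdd] by blast
  note TK = is_coconeD[OF is_colimitD(1)[OF T, unfolded is_cocone_isometry_subcat, THEN conjunct1]]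
  have "is_cocone (isometry_subcat C) \<F> (incl \<F>) Z \<zeta> V (\<lambda>F. \<eta> F \<cdot> z F)"
  proof -
    have "(\<eta> G \<cdot> z G) \<cdot> \<zeta> F G = \<eta> F \<cdot> z F" if FG: "F \<in> \<F>" "G \<in> \<F>" "F \<subseteq> G" for F G
    proof -
      note [simp] = HomD[OF z(1)[OF FG(1)]] HomD[OF z(1)[OF FG(2)]] HomD[OF \<zeta>(1)[OF FG]] HomD[OF \<iota>(1)[OF FG]]
        HomD[OF VK(2)[OF FG(2)]]
      have "(\<eta> G \<cdot> z G) \<cdot> \<zeta> F G = \<eta> G \<cdot> (\<iota> F G \<cdot> z F)" by (simp add: \<zeta>(2)[OF FG])
      also have "\<dots> = \<eta> F \<cdot> z F" by (rule comp_reassoc[OF VK(3)]) (use FG in simp_all)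
      finally show ?thesis .
    qed
    then show ?thesis using comp_in_Hom[OF z(1) VK(2)] isometry_comp[OF z(2) \<eta>iso z(1) VK(2)] VK(1)
      by (auto simp: is_cocone_isometry_subcat is_cocone_def)
  qed
  then obtain t where t: "t \<in> Hom C T V" "isometry C t" "\<And>F. F \<in> \<F> \<Longrightarrow> t \<cdot> \<tau> F = \<eta> F \<cdot> z F"
    using is_colimitD(2)[OF T] by fastforce
  \<comment> \<open>The part of \<open>V\<close> orthogonal to all the kernels;
    \<open>l\<^sup>\<star>\<close> plays the role of the quotient by \<open>t\<close>.\<close>
  obtain L l where l: "l \<in> Hom C L V" "isometry C l" "t\<^sup>\<star> \<cdot> l = \<zero> L T" "t \<cdot> t\<^sup>\<star> \<oplus> l \<cdot> l\<^sup>\<star> = \<one> V"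
    using isometry_complement[OF t(2,1)] by blast
  note [simp] = HomD[OF t(1)] HomD[OF l(1)] isometryD[OF l(2,1)]
  have lt: "l\<^sup>\<star> \<cdot> t = \<zero> T L" using arg_cong[OF l(3), of "Star C"] by simp
  have l_kills: "l\<^sup>\<star> \<cdot> (\<eta> F \<cdot> g) = \<zero> Y L" if F: "F \<in> \<F>" and g: "g \<in> Hom C Y (H F)" and "\<pi> F \<cdot> g = \<zero> Y (X (mx F))" for F g Y
  proof -
    note [simp] = HomD[OF g] HomD[OF VK(2)[OF F]] HomD[OF z(1)[OF F]] HomD[OF TK(2)[OF F]]
    have "\<eta> F \<cdot> g = \<eta> F \<cdot> (z F \<cdot> ((z F)\<^sup>\<star> \<cdot> g))" using z(4)[OF F g that(3)] by simp
    also have "\<dots> = t \<cdot> (\<tau> F \<cdot> ((z F)\<^sup>\<star> \<cdot> g))" using comp_reassoc[OF t(3)[OF F], of "(z F)\<^sup>\<star> \<cdot> g"] by simp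
    finally have "l\<^sup>\<star> \<cdot> (\<eta> F \<cdot> g) = l\<^sup>\<star> \<cdot> (t \<cdot> (\<tau> F \<cdot> ((z F)\<^sup>\<star> \<cdot> g)))" by simp
    also have "\<dots> = \<zero> T L \<cdot> (\<tau> F \<cdot> ((z F)\<^sup>\<star> \<cdot> g))" by (rule comp_reassoc[OF lt]) simp_all
    finally show ?thesis by simp
  qed
  define c where "c j = l\<^sup>\<star> \<cdot> e j" for j
  have c: "c j \<in> Hom C (X j) L" if "j \<in> I" for j
    unfolding c_def by (rule comp_in_Hom[OF e[OF that] star_in_Hom[OF l(1)]])
  have "is_colimit (contraction_subcat C) I w X f L c"
  proof (rule is_colimitI)
    have "c k \<cdot> f j k = c j" if jk: "(j, k) \<in> w" for j k
    proof -
      have j: "j \<in> I" and k: "k \<in> I" using diagramD(6,7) jk by blast+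
      let ?F = "{j, k}"
      have F: "?F \<in> \<F>" using pair j k by blast
      have mk: "mx ?F = k" using mx[OF F] antisym[of k "mx ?F"] antisym[OF jk] by (cases "mx ?F = k") auto
      note [simp] = HomD[OF e[OF j]] HomD[OF e[OF k]] HomD[OF diagramD(3)[OF jk]] HomD[OF VK(2)[OF F]]
      have vj: "v ?F j \<in> Hom C (X j) (H ?F)" and vk: "v ?F k \<in> Hom C (X k) (H ?F)" using v(2)[OF F] by auto
      note [simp] = HomD[OF vj] HomD[OF vk] HomD[OF \<pi>[OF F]]
      have "v ?F k \<cdot> f j k \<in> Hom C (X j) (H ?F)" by (simp add: in_Hom)
      \<comment> \<open>Both \<open>v ?F k \<cdot> f j k\<close> and \<open>v ?F j\<close> are sent
        to \<open>f j k\<close> by \<open>\<pi> ?F\<close>, so their difference \<open>d\<close>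
        lies in its kernel and disappears under \<open>l\<^sup>\<star>\<close>.\<close>
      then obtain d where d: "d \<in> Hom C (X j) (H ?F)" "d \<oplus> v ?F j = v ?F k \<cdot> f j k"
        using ex_difference[OF _ vj] by blast
      note [simp] = HomD[OF d(1)]
      have "\<pi> ?F \<cdot> (v ?F k \<cdot> f j k) = \<pi> ?F \<cdot> v ?F j"
        using comp_reassoc[OF \<pi>v[OF F, of k], of "f j k"] \<pi>v[OF F, of j] diagramD(4)[OF k] mk by simp
      then have "\<pi> ?F \<cdot> d \<oplus> \<pi> ?F \<cdot> v ?F j = \<zero> (X j) (X (mx ?F)) \<oplus> \<pi> ?F \<cdot> v ?F j"
        by (simp flip: d(2))
      then have "\<pi> ?F \<cdot> d = \<zero> (X j) (X (mx ?F))" by (rule plus_cancel[rotated 3]) (simp_all add: in_Hom)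
      then have "l\<^sup>\<star> \<cdot> (\<eta> ?F \<cdot> d) = \<zero> (X j) L" by (rule l_kills[OF F d(1)])
      then have "l\<^sup>\<star> \<cdot> (\<eta> ?F \<cdot> (v ?F k \<cdot> f j k)) = l\<^sup>\<star> \<cdot> (\<eta> ?F \<cdot> v ?F j)" by (simp flip: d(2))
      moreover have "\<eta> ?F \<cdot> (v ?F k \<cdot> f j k) = e k \<cdot> f j k"
        by (rule comp_reassoc[OF e_eq[OF F]]) simp_all
      ultimately show ?thesis using e_eq[OF F, of j] by (simp add: c_def)
    qed
    moreover have "contraction C (c j)" if "j \<in> I" for j
      unfolding c_def
      by (rule contraction_comp[OF econ[OF that] e[OF that] isometry_star_contraction[OF l(2,1)] star_in_Hom[OF l(1)]])
    ultimately show "is_cocone (contraction_subcat C) I w X f L c"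
      using c by (simp add: is_cocone_contraction_subcat is_cocone_def split_beta)
    fix Y g assume g: "is_cocone (contraction_subcat C) I w X f Y g"
    note G0 = g[unfolded is_cocone_contraction_subcat]
    note G = is_coconeD[OF G0[THEN conjunct1]]
    have mxI: "mx F \<in> I" if "F \<in> \<F>" for F using mx(1)[OF that] FI(3)[OF that] by blast
    \<comment> \<open>The cocone is extended to the dilations by compressing each of them to its top
      object first; \<open>\<pi>nat\<close> makes this compatible with
      \<open>\<iota>\<close>.\<close>
    have "is_cocone (contraction_subcat C) \<F> (incl \<F>) H \<iota> Y (\<lambda>F. g (mx F) \<cdot> \<pi> F)"
    proof -
      have "(g (mx G') \<cdot> \<pi> G') \<cdot> \<iota> F G' = g (mx F) \<cdot> \<pi> F" if FG: "F \<in> \<F>" "G' \<in> \<F>" "F \<subseteq> G'" for F G'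
      proof -
        have mm: "(mx F, mx G') \<in> w" using mx FG by blast
        note [simp] = HomD[OF \<pi>[OF FG(1)]] HomD[OF \<pi>[OF FG(2)]] HomD[OF \<iota>(1)[OF FG]] HomD[OF diagramD(3)[OF mm]]
          HomD[OF G(2)[OF mxI[OF FG(2)]]]
        show ?thesis using comp_reassoc[OF G(3)[OF mm], of "\<pi> F"] by (simp add: \<pi>nat[OF FG])
      qed
      moreover have "contraction C (g (mx F) \<cdot> \<pi> F)" if F: "F \<in> \<F>" for F
      proof (rule contraction_comp[OF _ \<pi>[OF F] _ G(2)[OF mxI[OF F]]])
        have vm: "v F (mx F) \<in> Hom C (X (mx F)) (H F)" by (rule v(2)[OF F mx(1)[OF F]])
        have "(v F (mx F))\<^sup>\<star> \<cdot> v F (mx F) = \<one> (X (mx F))"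
          using v(3)[OF F mx(1)[OF F] mx(1)[OF F]] orderD(3)[OF mxI[OF F]] diagramD(4)[OF mxI[OF F]] by simp
        then show "contraction C (\<pi> F)"
          unfolding \<pi>_def by (rule isometry_star_contraction[OF isometryI[OF vm] vm])
        show "contraction C (g (mx F))" using G0 mxI[OF F] by blast
      qed
      ultimately show ?thesis using comp_in_Hom[OF \<pi> G(2)[OF mxI]] G(1)
        by (auto simp: is_cocone_contraction_subcat is_cocone_def)
    qed
    then obtain u where u: "u \<in> Hom C V Y" "contraction C u" "\<And>F. F \<in> \<F> \<Longrightarrow> u \<cdot> \<eta> F = g (mx F) \<cdot> \<pi> F"
      using ex_contractive_mediator[OF Hdd colims V] by blast
    note [simp] = HomD[OF u(1)]
    have ue: "u \<cdot> e j = g j" if j: "j \<in> I" for j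
    proof -
      have F: "{j} \<in> \<F>" by (rule sing[OF j])
      have m: "mx {j} = j" using mx(1)[OF F] by simp
      note [simp] = HomD[OF v(2)[OF F, of j, OF singletonI]] HomD[OF VK(2)[OF F]] HomD[OF \<pi>[OF F]] HomD[OF G(2)[OF j]]
      have "u \<cdot> e j = (g j \<cdot> \<pi> {j}) \<cdot> v {j} j"
        unfolding e_def using u(3)[OF F] m by (intro comp_reassoc) simp_all
      then show ?thesis using \<pi>v[OF F, of j] m diagramD(4)[OF j] by simp
    qed
    \<comment> \<open>On each \<open>Z F\<close> the mediator factors through
      \<open>\<pi> F \<cdot> z F\<close>, which is zero. Hence \<open>u\<close> sees only the
      complement, that is, \<open>u = u \<cdot> (l \<cdot> l\<^sup>\<star>)\<close>.\<close>
    have "u \<cdot> t = \<zero> T Y"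
    proof (rule isometric_colimit_ext[OF Zdd T])
      show "u \<cdot> t \<in> Hom C T Y" "\<zero> T Y \<in> Hom C T Y" by (simp_all add: in_Hom)
      fix F assume F: "F \<in> \<F>"
      note [simp] = HomD[OF z(1)[OF F]] HomD[OF VK(2)[OF F]] HomD[OF TK(2)[OF F]] HomD[OF \<pi>[OF F]]
        HomD[OF G(2)[OF mxI[OF F]]]
      have "(u \<cdot> t) \<cdot> \<tau> F = (g (mx F) \<cdot> \<pi> F) \<cdot> z F"
        using comp_reassoc[OF u(3)[OF F], of "z F"] t(3)[OF F] by simp
      then show "(u \<cdot> t) \<cdot> \<tau> F = \<zero> T Y \<cdot> \<tau> F" using z(3)[OF F] by simp
    qed
    then have ut: "u \<cdot> (t \<cdot> t\<^sup>\<star>) = \<zero> V Y" using comp_reassoc[of u t "\<zero> T Y" "t\<^sup>\<star>"] by simp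
    have "u \<cdot> (t \<cdot> t\<^sup>\<star> \<oplus> l \<cdot> l\<^sup>\<star>) = u \<cdot> (l \<cdot> l\<^sup>\<star>)" by (simp add: ut)
    then have ull: "u \<cdot> (l \<cdot> l\<^sup>\<star>) = u" unfolding l(4) by simp
    show "\<exists>u\<in>Hom (contraction_subcat C) L Y. \<forall>j\<in>I. u \<cdot>\<^bsub>contraction_subcat C\<^esub> c j = g j"
    proof (intro bexI[of _ "u \<cdot> l"] ballI)
      show "u \<cdot> l \<in> Hom (contraction_subcat C) L Y"
        using contraction_comp[OF isometry_contraction[OF l(2,1)] l(1) u(2,1)] by (simp add: in_Hom)
      fix j assume j: "j \<in> I"
      note [simp] = HomD[OF e[OF j]]
      have "(u \<cdot> (l \<cdot> l\<^sup>\<star>)) \<cdot> e j = g j" unfolding ull by (rule ue[OF j])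
      then show "(u \<cdot> l) \<cdot>\<^bsub>contraction_subcat C\<^esub> c j = g j" by (simp add: c_def)
    qed
    fix x y assume "x \<in> Hom (contraction_subcat C) L Y" "y \<in> Hom (contraction_subcat C) L Y"
      and xy: "\<And>j. j \<in> I \<Longrightarrow> x \<cdot>\<^bsub>contraction_subcat C\<^esub> c j = g j"
        "\<And>j. j \<in> I \<Longrightarrow> y \<cdot>\<^bsub>contraction_subcat C\<^esub> c j = g j"
    then have x: "x \<in> Hom C L Y" and y: "y \<in> Hom C L Y" by auto
    note [simp] = HomD[OF x] HomD[OF y]
    \<comment> \<open>Composition with \<open>l\<^sup>\<star>\<close> moves the comparison to
      \<open>V\<close>, where the \<open>e j\<close> separate arrows; composing with
      \<open>l\<close> afterwards undoes it.\<close>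
    have "x \<cdot> l\<^sup>\<star> = y \<cdot> l\<^sup>\<star>"
    proof (rule e_ext)
      show "x \<cdot> l\<^sup>\<star> \<in> Hom C V Y" "y \<cdot> l\<^sup>\<star> \<in> Hom C V Y" by (simp_all add: in_Hom)
      show "(x \<cdot> l\<^sup>\<star>) \<cdot> e j = (y \<cdot> l\<^sup>\<star>) \<cdot> e j" if "j \<in> I" for j
        using xy[OF that] HomD[OF e[OF that]] by (simp add: c_def)
    qed
    from arg_cong[OF this, of "\<lambda>s. s \<cdot> l"] show "x = y" by simp
  qed
  then show ?thesis by blast
qed

end

section \<open>All directed diagrams of contractions\<close>

context pre_hilbert_category
begin

lemma isometry_colimits_imp_contraction_colimits:
  assumes has: "has_directed_colimits TYPE('j) (isometry_subcat C)"
  shows "has_directed_colimits TYPE('j) (contraction_subcat C)"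
proof (cases "finite (UNIV :: 'j set)")
  case True
  show ?thesis unfolding has_directed_colimits_def
  proof (intro allI impI)
    fix J :: "'j set" and r X f assume dd: "directed_diagram (contraction_subcat C) J r X f"
    have "finite J" by (rule finite_subset[OF subset_UNIV True])
    then obtain t where "t \<in> J" "\<And>j. j \<in> J \<Longrightarrow> (j, t) \<in> r"
      using finite_directed_upper_bound[OF directed_diagramD(1)[OF dd] _ subset_refl] by blast
    from category.colimit_top[OF category_contraction_subcat dd this]
    show "\<exists>L c. is_colimit (contraction_subcat C) J r X f L c" by blast
  qed
next
  case False
  obtain \<phi> :: "'j set \<Rightarrow> 'j" where \<phi>: "inj_on \<phi> (Fpow UNIV)" using ex_inj_on_Fpow[OF False] by blast
  show ?thesis
  proof (rule category.directed_colimits_from_chains[OF category_contraction_subcat])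
    fix I :: "'j set" and w X f
    assume "linear_order_on I w" "directed_diagram (contraction_subcat C) I w X f"
    then interpret contraction_chain C I w X f by unfold_locales
    show "\<exists>L c. is_colimit (contraction_subcat C) I w X f L c"
      by (rule ex_colimit[OF has inj_on_subset[OF \<phi> Fpow_mono]]) simp
  qed
qed

end

theorem theorem5p1:
  fixes C :: "('o, 'm, 'z) star_cat_scheme"
  assumes "pre_hilbert_category C"
  shows "(hilbert_category TYPE('j) C \<longleftrightarrow> has_directed_colimits TYPE('j) (contraction_subcat C)) \<and>
    (has_directed_colimits TYPE('j) (contraction_subcat C) \<longleftrightarrow>
      has_directed_colimits TYPE('j) (isometry_subcat C))"
proof -
  interpret pre_hilbert_category C by fact
  show ?thesis
    using hilbert_imp_contraction_colimits contraction_colimits_imp_hilbert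
      contraction_colimits_imp_isometry_colimits isometry_colimits_imp_contraction_colimits
    by metis
qed

end
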